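(* Let $L$ be a real-valued function on $\partial\mathbb{D}$ such that $e^{i\theta}\mapsto L(\theta)$ is analytic in a neighborhood of $\partial\mathbb{D}$ (i.e. extends to a holomorphic function on an open neighborhood of $\partial\mathbb{D}$ in $\mathbb{C}$), and let $d\mu(\theta)=e^{L(\theta)}\frac{d\theta}{2\pi}$. Then $$\lim_{n\to\infty}\bigl[\log D_n(d\mu)-(n+1)\hat L_0\bigr]=\sum_{k=1}^\infty k\,|\hat L_k|^2 .$$
   Context: $\partial\mathbb{D}=\{z\in\mathbb{C}:|z|=1\}$, parametrized by $e^{i\theta}$. Fourier coefficients: $\hat L_k=\int_0^{2\pi}e^{-ik\theta}L(\theta)\,\frac{d\theta}{2\pi}$. For a measure $d\mu$ on $\partial\mathbb{D}$ let $c_m=\int e^{-im\theta}\,d\mu(\theta)$; $D_n(d\mu)$ is the determinant of the $(n+1)\times(n+1)$ Toeplitz matrix $(c_{j-i})_{0\le i,j\le n}$. *)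

theory Defs
  imports
    "HOL-Complex_Analysis.Complex_Analysis"
    "Jordan_Normal_Form.Determinant"
begin

text \<open>Functions on the unit circle are represented by functions on \<^typ>\<open>complex\<close> whose values off
  \<^term>\<open>sphere (0::complex) 1\<close> are irrelevant; \<open>L(\<theta>)\<close> is \<open>L (cis \<theta>)\<close>. Measures on the circle live on the
  Borel sets of the circle (not of the plane), so that no regularity is needed off the circle.\<close>

text \<open>\<^const>\<open>uniform_measure\<close> normalises, so this is \<open>d\<theta>/(2\<pi>)\<close>.\<close>

definition circle_measure :: "complex measure" where
  "circle_measure =
     distr (uniform_measure lborel {0..<2 * pi}) (restrict_space borel (sphere 0 1)) cis"

definition fourier_coeff :: "(complex \<Rightarrow> real) \<Rightarrow> int \<Rightarrow> complex" where
  "fourier_coeff L k =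
     (CLBINT t:{0..2 * pi}. exp (- \<i> * of_int k * of_real t) * of_real (L (cis t)))
       / of_real (2 * pi)"

text \<open>With \<open>z = cis \<theta>\<close>, the integrand \<open>z powi (- m)\<close> is \<open>exp (- \<i> m \<theta>)\<close>.\<close>

definition moment :: "complex measure \<Rightarrow> int \<Rightarrow> complex" where
  "moment \<mu> m = (CLINT z|\<mu>. z powi (- m))"

definition toeplitz_matrix :: "complex measure \<Rightarrow> nat \<Rightarrow> complex mat" where
  "toeplitz_matrix \<mu> n =
     Matrix.mat (n + 1) (n + 1) (\<lambda>(i, j). moment \<mu> (int j - int i))"

definition toeplitz_det :: "complex measure \<Rightarrow> nat \<Rightarrow> complex" where
  "toeplitz_det \<mu> n = Determinant.det (toeplitz_matrix \<mu> n)"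

definition analytic_near_circle :: "(complex \<Rightarrow> real) \<Rightarrow> bool" where
  "analytic_near_circle L \<longleftrightarrow>
     (\<exists>U F. open U \<and> sphere 0 1 \<subseteq> U \<and> F holomorphic_on U \<and>
       (\<forall>z\<in>sphere 0 1. F z = complex_of_real (L z)))"

end

theory Submission
  imports Defs
begin

text \<open>Write \<open>L = L\<^sub>0 + a + b\<close> with \<open>a\<close> and \<open>b\<close> the parts of positive and negative frequency. Up to the
  factor \<open>exp ((n + 1) L\<^sub>0)\<close>, the Toeplitz matrix is the corner of \<open>U V\<close>, where \<open>U\<close> and \<open>V\<close> are the
  infinite upper and lower triangular Toeplitz matrices of \<open>exp a\<close> and \<open>exp b\<close>. As \<open>U\<close> and \<open>V\<close> are unit
  triangular, the corner of the commutator \<open>V\<^sup>-\<^sup>1 U V U\<^sup>-\<^sup>1\<close> has the same determinant; by analyticity of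
  \<open>L\<close>, this commutator is the identity plus a matrix with geometrically decaying entries. The identity
  \<open>[U, V V'] = V\<^sup>-\<^sup>1 [U, V'] V [U, V]\<close> makes the determinant asymptotically multiplicative in \<open>exp b\<close>, and by
  transposition in \<open>exp a\<close>. For
  fixed \<open>m\<close>, it is therefore asymptotic to the \<open>m\<^sup>2\<close>-th power of the determinant belonging to \<open>a / m\<close> and
  \<open>b / m\<close>. The latter is \<open>1 + m\<^sup>-\<^sup>2 c\<^sub>n + O(m\<^sup>-\<^sup>3)\<close> uniformly in \<open>n\<close>, where \<open>c\<^sub>n\<close> tends to \<open>\<Sum>k. k \<bar>L\<^sub>k\<bar>\<^sup>2\<close>,
  so its \<open>m\<^sup>2\<close>-th power is \<open>exp c\<^sub>n + O(m\<^sup>-\<^sup>1)\<close>. Let first \<open>n\<close> and then \<open>m\<close> tend to infinity.\<close>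

section \<open>Infinite matrices with bounded row sums\<close>

text \<open>The obstacle is that truncation to a corner is multiplicative only if the left factor is
  lower or the right factor is upper triangular, and in \<open>U V\<close> both factors stand on the
  wrong side. In the commutator the inverses stand on the good sides, and what is left is a
  perturbation of the identity whose entries are absolutely summable over the whole quadrant.
  Determinants of all sizes are then estimated at once by sums of absolute values, without Fredholm
  determinants. The scaling by \<open>1 / m\<close> takes the place of the Helton-Howe-Pincus
  formula \<open>det (e^A e^B e^-A e^-B) = exp (tr [A, B])\<close>: it brings the commutator within
  order \<open>m^-2\<close> of the identity, where only its trace survives. This trace is that of a
  product of two Hankel matrices, in which the coefficients of frequency \<open>k\<close> meet
  exactly \<open>k\<close> times; hence the weight \<open>k\<close> in the limit. All error bounds
  in \<open>m\<close> are uniform in \<open>n\<close>, which is what allows the two limits to be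
  taken one after the other.\<close>

type_synonym imat = "nat \<Rightarrow> nat \<Rightarrow> complex"

text \<open>Finiteness of the maximal row sum: the matrix acts boundedly on bounded sequences.
  Finite partial sums keep summability out of the definition.\<close>

definition rows_bounded :: "imat \<Rightarrow> bool" where
  "rows_bounded X \<longleftrightarrow> (\<exists>M. \<forall>i F. finite F \<longrightarrow> (\<Sum>j\<in>F. cmod (X i j)) \<le> M)"

text \<open>A divergent \<open>infsum\<close> is 0, so the algebra below rests either on row bounds
  or on finitely many nonzero terms.\<close>

definition imat_mult :: "imat \<Rightarrow> imat \<Rightarrow> imat" (infixl \<open>\<star>\<close> 70) where
  "X \<star> Y = (\<lambda>i j. \<Sum>\<^sub>\<infinity>p. X i p * Y p j)"

definition imat_id :: imat where
  "imat_id = (\<lambda>i j. if i = j then 1 else 0)"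

lemma rows_boundedI:
  assumes "\<And>i F. finite F \<Longrightarrow> (\<Sum>j\<in>F. cmod (X i j)) \<le> M"
  shows "rows_bounded X"
  using assms unfolding rows_bounded_def by blast

lemma rows_boundedE:
  assumes "rows_bounded X"
  obtains M where "M \<ge> 0" "\<And>i. (\<lambda>j. cmod (X i j)) summable_on UNIV" "\<And>i. (\<Sum>\<^sub>\<infinity>j. cmod (X i j)) \<le> M"
    "\<And>i j. cmod (X i j) \<le> M"
proof -
  from assms obtain M where M: "\<And>i F. finite F \<Longrightarrow> (\<Sum>j\<in>F. cmod (X i j)) \<le> M"
    unfolding rows_bounded_def by blast
  show thesis
  proof
    show "M \<ge> 0" using M[of "{}"] by simp
    show sm: "(\<lambda>j. cmod (X i j)) summable_on UNIV" for i
      by (rule nonneg_bdd_above_summable_on) (auto intro!: bdd_aboveI2[where M = M] M)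
    show "(\<Sum>\<^sub>\<infinity>j. cmod (X i j)) \<le> M" for i
      by (rule infsum_le_finite_sums[OF sm M])
    show "cmod (X i j) \<le> M" for i j
      using M[of "{j}" i] by simp
  qed
qed

text \<open>Summing over \<open>j\<close> first costs at most the row bound of \<open>Y\<close> and
  leaves the summable \<open>c\<close>. This is the input for exchanging the two sums in
  associativity.\<close>

lemma abs_summable_on_rows_bounded:
  fixes c :: "nat \<Rightarrow> complex"
  assumes c: "(\<lambda>p. cmod (c p)) summable_on UNIV" and Y: "rows_bounded Y"
  shows "(\<lambda>(p, j). cmod (c p * Y p j)) summable_on UNIV \<times> UNIV"
proof -
  obtain M where M: "M \<ge> 0" "\<And>i. (\<lambda>j. cmod (Y i j)) summable_on UNIV" "\<And>i. (\<Sum>\<^sub>\<infinity>j. cmod (Y i j)) \<le> M"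
    using rows_boundedE[OF Y] by metis
  have 1: "(\<lambda>y. cmod (c p * Y p y)) summable_on UNIV" for p
    unfolding norm_mult by (intro summable_on_cmult_right M)
  have 2: "(\<lambda>p. norm (\<Sum>\<^sub>\<infinity>y. cmod (c p * Y p y))) summable_on UNIV"
  proof (rule summable_on_comparison_test)
    show "(\<lambda>p. M * cmod (c p)) summable_on UNIV"
      by (intro summable_on_cmult_right c)
    fix p
    have "(\<Sum>\<^sub>\<infinity>y. cmod (c p * Y p y)) = cmod (c p) * (\<Sum>\<^sub>\<infinity>y. cmod (Y p y))"
      by (simp add: norm_mult infsum_cmult_right')
    moreover have "\<dots> \<le> cmod (c p) * M"
      by (intro mult_left_mono M) auto
    moreover have "0 \<le> (\<Sum>\<^sub>\<infinity>y. cmod (c p * Y p y))"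
      by (intro infsum_nonneg) auto
    ultimately show "norm (\<Sum>\<^sub>\<infinity>y. cmod (c p * Y p y)) \<le> M * cmod (c p)"
      by (simp add: mult.commute)
  qed auto
  have "(\<lambda>x. norm ((\<lambda>(p, j). c p * Y p j) x)) summable_on UNIV \<times> UNIV"
    unfolding Infinite_Sum.abs_summable_on_Sigma_iff using 1 2 by simp
  then show ?thesis
    by (simp add: case_prod_unfold)
qed

lemma abs_summable_on_mult_column:
  fixes c :: "nat \<Rightarrow> complex"
  assumes "(\<lambda>p. cmod (c p)) summable_on UNIV" "rows_bounded Y"
  shows "(\<lambda>p. cmod (c p * Y p j)) summable_on UNIV"
proof -
  obtain M where M: "\<And>i j. cmod (Y i j) \<le> M"
    using rows_boundedE[OF assms(2)] by metis
  show ?thesis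
    by (rule summable_on_comparison_test[where f = "\<lambda>p. cmod (c p) * M"])
      (use assms in \<open>auto simp: norm_mult intro!: summable_on_cmult_left mult_left_mono M\<close>)
qed

lemma rows_bounded_abs_summable: "rows_bounded X \<Longrightarrow> (\<lambda>j. cmod (X i j)) summable_on UNIV"
  using rows_boundedE by metis

lemma summable_on_imat_mult:
  assumes "rows_bounded X" "rows_bounded Y"
  shows "(\<lambda>p. X i p * Y p j) summable_on UNIV"
  by (rule abs_summable_summable[OF abs_summable_on_mult_column[OF rows_bounded_abs_summable]])
    (rule assms)+

lemma infsum_minus:
  fixes f g :: "'a \<Rightarrow> complex"
  assumes "f summable_on A" "g summable_on A"
  shows "(\<Sum>\<^sub>\<infinity>x\<in>A. f x - g x) = infsum f A - infsum g A"
  using infsum_add[OF assms(1) summable_on_uminus[THEN iffD2, OF assms(2)]]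
  by (simp add: infsum_uminus)

lemma has_sum_finite_sum:
  fixes f :: "'b \<Rightarrow> 'a \<Rightarrow> real"
  assumes "finite F" "\<And>j. j \<in> F \<Longrightarrow> f j summable_on A"
  shows "((\<lambda>p. \<Sum>j\<in>F. f j p) has_sum (\<Sum>j\<in>F. infsum (f j) A)) A"
  using assms
  by (induction F rule: finite_induct) (auto intro!: has_sum_add has_sum_infsum)

lemma rows_bounded_mult:
  assumes X: "rows_bounded X" and Y: "rows_bounded Y"
  shows "rows_bounded (X \<star> Y)"
proof -
  obtain M where M: "M \<ge> 0" "\<And>i. (\<lambda>j. cmod (X i j)) summable_on UNIV" "\<And>i. (\<Sum>\<^sub>\<infinity>j. cmod (X i j)) \<le> M"
    using rows_boundedE[OF X] by metis
  from Y obtain N where N: "\<And>i F. finite F \<Longrightarrow> (\<Sum>j\<in>F. cmod (Y i j)) \<le> N"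
    unfolding rows_bounded_def by blast
  have N0: "N \<ge> 0" using N[of "{}"] by simp
  show ?thesis
  proof (rule rows_boundedI)
    fix i F assume F: "finite (F :: nat set)"
    have s: "(\<lambda>p. cmod (X i p * Y p j)) summable_on UNIV" for j
      by (intro abs_summable_on_mult_column M Y)
    have "(\<Sum>j\<in>F. cmod ((X \<star> Y) i j)) \<le> (\<Sum>j\<in>F. \<Sum>\<^sub>\<infinity>p. cmod (X i p * Y p j))"
      unfolding imat_mult_def by (intro sum_mono norm_infsum_bound s)
    also have "\<dots> = (\<Sum>\<^sub>\<infinity>p. \<Sum>j\<in>F. cmod (X i p * Y p j))"
      by (intro infsumI[symmetric] has_sum_finite_sum F s)
    also have "\<dots> \<le> (\<Sum>\<^sub>\<infinity>p. cmod (X i p) * N)"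
    proof (rule infsum_mono)
      show "(\<lambda>p. \<Sum>j\<in>F. cmod (X i p * Y p j)) summable_on UNIV"
        by (intro has_sum_imp_summable[OF has_sum_finite_sum] F s)
      show "(\<lambda>p. cmod (X i p) * N) summable_on UNIV"
        by (intro summable_on_cmult_left M)
      show "(\<Sum>j\<in>F. cmod (X i p * Y p j)) \<le> cmod (X i p) * N" for p
        unfolding norm_mult sum_distrib_left[symmetric] by (intro mult_left_mono N F) auto
    qed
    also have "\<dots> = (\<Sum>\<^sub>\<infinity>p. cmod (X i p)) * N"
      by (rule infsum_cmult_left')
    also have "\<dots> \<le> M * N"
      by (intro mult_right_mono M N0)
    finally show "(\<Sum>j\<in>F. cmod ((X \<star> Y) i j)) \<le> M * N" .
  qed
qed

text \<open>Fubini: the row bounds of \<open>X\<close> and \<open>Y\<close> make the double sum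
  absolutely convergent, and the entries of \<open>Z\<close> are just a bounded factor.\<close>

lemma imat_mult_assoc:
  assumes X: "rows_bounded X" and Y: "rows_bounded Y" and Z: "rows_bounded Z"
  shows "X \<star> Y \<star> Z = X \<star> (Y \<star> Z)"
proof (intro ext)
  fix i j
  obtain M where M: "\<And>i j. cmod (Z i j) \<le> M"
    using rows_boundedE[OF Z] by metis
  have "(\<lambda>(p, q). cmod (X i p * Y p q)) summable_on UNIV \<times> UNIV"
    by (intro abs_summable_on_rows_bounded rows_bounded_abs_summable X Y)
  then have "(\<lambda>x. M * (\<lambda>(p, q). cmod (X i p * Y p q)) x) summable_on UNIV \<times> UNIV"
    by (rule summable_on_cmult_right)
  then have "(\<lambda>x. norm ((\<lambda>(p, q). X i p * Y p q * Z q j) x)) summable_on UNIV \<times> UNIV"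
    by (rule summable_on_comparison_test)
      (auto simp: norm_mult mult.commute[of M] intro!: mult_left_mono M)
  then have sm: "(\<lambda>(p, q). X i p * Y p q * Z q j) summable_on UNIV \<times> UNIV"
    by (rule abs_summable_summable)
  have "(X \<star> Y \<star> Z) i j = (\<Sum>\<^sub>\<infinity>q. \<Sum>\<^sub>\<infinity>p. X i p * Y p q * Z q j)"
    by (simp only: imat_mult_def infsum_cmult_left'[symmetric])
  also have "\<dots> = (\<Sum>\<^sub>\<infinity>p. \<Sum>\<^sub>\<infinity>q. X i p * Y p q * Z q j)"
    by (rule infsum_swap_banach[symmetric]) (use sm in simp)
  also have "\<dots> = (X \<star> (Y \<star> Z)) i j"
    by (simp only: imat_mult_def infsum_cmult_right'[symmetric] mult.assoc)
  finally show "(X \<star> Y \<star> Z) i j = (X \<star> (Y \<star> Z)) i j" .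
qed

lemma imat_mult_diff_left:
  assumes "rows_bounded X" "rows_bounded Y" "rows_bounded Z"
  shows "(\<lambda>i j. X i j - Y i j) \<star> Z = (\<lambda>i j. (X \<star> Z) i j - (Y \<star> Z) i j)"
  unfolding imat_mult_def left_diff_distrib
  by (intro ext infsum_minus summable_on_imat_mult assms)

lemma imat_mult_diff_right:
  assumes "rows_bounded X" "rows_bounded Y" "rows_bounded Z"
  shows "X \<star> (\<lambda>i j. Y i j - Z i j) = (\<lambda>i j. (X \<star> Y) i j - (X \<star> Z) i j)"
  unfolding imat_mult_def right_diff_distrib
  by (intro ext infsum_minus summable_on_imat_mult assms)

lemma imat_mult_finite:
  assumes "finite A" "\<And>p. p \<notin> A \<Longrightarrow> X i p * Y p j = 0"
  shows "(X \<star> Y) i j = (\<Sum>p\<in>A. X i p * Y p j)"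
  unfolding imat_mult_def
  by (subst infsum_finite[OF assms(1), symmetric], rule infsum_cong_neutral) (use assms in auto)

lemma imat_mult_id_left [simp]: "imat_id \<star> X = X"
proof (intro ext)
  show "(imat_id \<star> X) i j = X i j" for i j
    by (subst imat_mult_finite[where A = "{i}"]) (auto simp: imat_id_def)
qed

lemma imat_mult_id_right [simp]: "X \<star> imat_id = X"
proof (intro ext)
  show "(X \<star> imat_id) i j = X i j" for i j
    by (subst imat_mult_finite[where A = "{j}"]) (auto simp: imat_id_def)
qed

lemma rows_bounded_id: "rows_bounded imat_id"
proof (rule rows_boundedI[where M = 1])
  fix i and F :: "nat set" assume "finite F"
  then show "(\<Sum>j\<in>F. cmod (imat_id i j)) \<le> 1"
    by (simp add: imat_id_def if_distrib cong: if_cong)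
qed

lemma rows_bounded_diff:
  assumes "rows_bounded X" "rows_bounded Y"
  shows "rows_bounded (\<lambda>i j. X i j - Y i j)"
proof -
  obtain M N where M: "\<And>i F. finite F \<Longrightarrow> (\<Sum>j\<in>F. cmod (X i j)) \<le> M"
    and N: "\<And>i F. finite F \<Longrightarrow> (\<Sum>j\<in>F. cmod (Y i j)) \<le> N"
    using assms unfolding rows_bounded_def by metis
  show ?thesis
  proof (rule rows_boundedI[where M = "M + N"])
    fix i and F :: "nat set" assume F: "finite F"
    have "(\<Sum>j\<in>F. cmod (X i j - Y i j)) \<le> (\<Sum>j\<in>F. cmod (X i j) + cmod (Y i j))"
      by (intro sum_mono norm_triangle_ineq4)
    also have "\<dots> \<le> M + N"
      using M[OF F, of i] N[OF F, of i] by (simp add: sum.distrib)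
    finally show "(\<Sum>j\<in>F. cmod (X i j - Y i j)) \<le> M + N" .
  qed
qed

section \<open>Truncation to finite corners\<close>

definition corner :: "nat \<Rightarrow> imat \<Rightarrow> complex mat" where
  "corner n X = Matrix.mat n n (\<lambda>(i, j). X i j)"

definition lower_tri :: "imat \<Rightarrow> bool" where
  "lower_tri X \<longleftrightarrow> (\<forall>i j. i < j \<longrightarrow> X i j = 0)"

definition upper_tri :: "imat \<Rightarrow> bool" where
  "upper_tri X \<longleftrightarrow> (\<forall>i j. j < i \<longrightarrow> X i j = 0)"

lemma corner_carrier [simp]: "corner n X \<in> carrier_mat n n"
  by (simp add: corner_def)

lemma corner_dim [simp]: "dim_row (corner n X) = n" "dim_col (corner n X) = n"
  by (simp_all add: corner_def)

lemma corner_index [simp]: "i < n \<Longrightarrow> j < n \<Longrightarrow> corner n X $$ (i, j) = X i j"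
  by (simp add: corner_def)

lemma corner_mult_index:
  "i < n \<Longrightarrow> j < n \<Longrightarrow> (corner n X * corner n Y) $$ (i, j) = (\<Sum>p<n. X i p * Y p j)"
  by (simp add: scalar_prod_def corner_def atLeast0LessThan)

text \<open>In a row \<open>i < n\<close> a lower triangular \<open>X\<close> has entries only in
  columns below \<open>n\<close>, so the infinite sum never leaves the corner. For general factors
  it would also run through indices beyond \<open>n\<close>.\<close>

lemma corner_mult_lower:
  assumes "lower_tri X"
  shows "corner n (X \<star> Y) = corner n X * corner n Y"
proof (rule eq_matI)
  fix i j assume ij: "i < dim_row (corner n X * corner n Y)" "j < dim_col (corner n X * corner n Y)"
  then have "(X \<star> Y) i j = (\<Sum>p<n. X i p * Y p j)"
    by (intro imat_mult_finite) (use assms in \<open>auto simp: lower_tri_def\<close>)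
  then show "corner n (X \<star> Y) $$ (i, j) = (corner n X * corner n Y) $$ (i, j)"
    using ij by (simp add: corner_mult_index del: index_mult_mat(1))
qed auto

lemma corner_mult_upper:
  assumes "upper_tri Y"
  shows "corner n (X \<star> Y) = corner n X * corner n Y"
proof (rule eq_matI)
  fix i j assume ij: "i < dim_row (corner n X * corner n Y)" "j < dim_col (corner n X * corner n Y)"
  then have "(X \<star> Y) i j = (\<Sum>p<n. X i p * Y p j)"
    by (intro imat_mult_finite) (use assms in \<open>auto simp: upper_tri_def\<close>)
  then show "corner n (X \<star> Y) $$ (i, j) = (corner n X * corner n Y) $$ (i, j)"
    using ij by (simp add: corner_mult_index del: index_mult_mat(1))
qed auto

lemma det_corner_lower:
  assumes "lower_tri X" "\<And>i. X i i = 1"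
  shows "Determinant.det (corner n X) = 1"
  by (subst det_lower_triangular[where n = n])
    (use assms in \<open>auto simp: lower_tri_def prod_list_diag_prod\<close>)

lemma det_corner_upper:
  assumes "upper_tri X" "\<And>i. X i i = 1"
  shows "Determinant.det (corner n X) = 1"
  by (subst det_upper_triangular[where n = n])
    (use assms in \<open>auto simp: upper_tri_def prod_list_diag_prod\<close>)

section \<open>Perturbation of determinants\<close>

text \<open>Expanded, the difference is a polynomial in the \<open>a i\<close> and
  \<open>x i\<close> with nonnegative coefficients, and taking absolute values of its monomials
  gives the right-hand side. The next lemma does the same after removal of the linear terms.\<close>

lemma norm_prod_add_diff_le:
  fixes a x :: "'b \<Rightarrow> complex"
  assumes "finite I"
  shows "cmod ((\<Prod>i\<in>I. a i + x i) - (\<Prod>i\<in>I. a i))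
    \<le> (\<Prod>i\<in>I. cmod (a i) + cmod (x i)) - (\<Prod>i\<in>I. cmod (a i))"
  using assms
proof (induction I rule: finite_induct)
  case (insert k I)
  let ?P = "\<Prod>i\<in>I. a i + x i" and ?A = "\<Prod>i\<in>I. a i"
  have P: "cmod ?P \<le> (\<Prod>i\<in>I. cmod (a i) + cmod (x i))"
    unfolding prod_norm[symmetric] by (intro prod_mono) (auto intro: norm_triangle_ineq)
  have "cmod ((a k + x k) * ?P - a k * ?A) = cmod (a k * (?P - ?A) + x k * ?P)"
    by (simp add: algebra_simps)
  also have "\<dots> \<le> cmod (a k) * cmod (?P - ?A) + cmod (x k) * cmod ?P"
    by (rule order_trans[OF norm_triangle_ineq]) (simp add: norm_mult)
  also have "\<dots> \<le> cmod (a k) * ((\<Prod>i\<in>I. cmod (a i) + cmod (x i)) - (\<Prod>i\<in>I. cmod (a i)))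
      + cmod (x k) * (\<Prod>i\<in>I. cmod (a i) + cmod (x i))"
    by (intro add_mono mult_left_mono insert.IH P) auto
  finally show ?case
    using insert by (simp add: algebra_simps)
qed simp

lemma norm_prod_add_first_order_le:
  fixes a x :: "'b \<Rightarrow> complex"
  assumes "finite I"
  shows "cmod ((\<Prod>i\<in>I. a i + x i) - (\<Prod>i\<in>I. a i) - (\<Sum>r\<in>I. x r * (\<Prod>i\<in>I - {r}. a i)))
    \<le> (\<Prod>i\<in>I. cmod (a i) + cmod (x i)) - (\<Prod>i\<in>I. cmod (a i))
        - (\<Sum>r\<in>I. cmod (x r) * (\<Prod>i\<in>I - {r}. cmod (a i)))"
  using assms
proof (induction I rule: finite_induct)
  case (insert k I)
  let ?P = "\<Prod>i\<in>I. a i + x i" and ?A = "\<Prod>i\<in>I. a i"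
    and ?S = "\<Sum>r\<in>I. x r * (\<Prod>i\<in>I - {r}. a i)"
  let ?P' = "\<Prod>i\<in>I. cmod (a i) + cmod (x i)" and ?A' = "\<Prod>i\<in>I. cmod (a i)"
    and ?S' = "\<Sum>r\<in>I. cmod (x r) * (\<Prod>i\<in>I - {r}. cmod (a i))"
  have "insert k I - {r} = insert k (I - {r})" if "r \<in> I" for r
    using that insert by auto
  then have S: "(\<Sum>r\<in>insert k I. x r * (\<Prod>i\<in>insert k I - {r}. a i)) = x k * ?A + a k * ?S"
    and S': "(\<Sum>r\<in>insert k I. cmod (x r) * (\<Prod>i\<in>insert k I - {r}. cmod (a i)))
      = cmod (x k) * ?A' + cmod (a k) * ?S'"
    using insert by (simp_all add: sum_distrib_left mult.left_commute)
  have "cmod ((a k + x k) * ?P - a k * ?A - (x k * ?A + a k * ?S))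
      = cmod (a k * (?P - ?A - ?S) + x k * (?P - ?A))"
    by (simp add: algebra_simps)
  also have "\<dots> \<le> cmod (a k) * cmod (?P - ?A - ?S) + cmod (x k) * cmod (?P - ?A)"
    by (rule order_trans[OF norm_triangle_ineq]) (simp add: norm_mult)
  also have "\<dots> \<le> cmod (a k) * (?P' - ?A' - ?S') + cmod (x k) * (?P' - ?A')"
    by (intro add_mono mult_left_mono insert.IH norm_prod_add_diff_le insert) auto
  finally show ?case
    unfolding S S' using insert by (simp add: algebra_simps)
qed simp

text \<open>Passing from permutations to all maps turns a Leibniz sum into one that factors as a
  product of row sums. The hypothesis on \<open>restrict\<close> is there because permutations are
  total functions, while members of \<open>PiE\<close> are \<open>undefined\<close> off
  \<open>I\<close>.\<close>

lemma sum_permutations_le_sum_functions: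
  fixes g :: "(nat \<Rightarrow> nat) \<Rightarrow> real"
  assumes "finite I" and g: "\<And>f. g f \<ge> 0" "\<And>f. g (restrict f I) = g f"
  shows "(\<Sum>p\<in>{p. p permutes I}. g p) \<le> (\<Sum>f\<in>I \<rightarrow>\<^sub>E I. g f)"
proof -
  have inj: "inj_on (\<lambda>p. restrict p I) {p. p permutes I}"
  proof (rule inj_onI, rule ext)
    fix p q x
    assume pq: "p \<in> {p. p permutes I}" "q \<in> {p. p permutes I}" "restrict p I = restrict q I"
    show "p x = q x"
    proof (cases "x \<in> I")
      case True
      then show ?thesis using pq(3) by (metis restrict_apply')
    next
      case False
      then show ?thesis using pq by (auto simp: permutes_def)
    qed
  qed
  have "(\<Sum>p\<in>{p. p permutes I}. g p) = (\<Sum>f\<in>(\<lambda>p. restrict p I) ` {p. p permutes I}. g f)"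
    by (subst sum.reindex[OF inj]) (simp add: g)
  also have "\<dots> \<le> (\<Sum>f\<in>I \<rightarrow>\<^sub>E I. g f)"
    by (rule sum_mono2) (use assms in \<open>auto simp: finite_PiE permutes_in_image\<close>)
  finally show ?thesis .
qed

lemma det_corner_def:
  "Determinant.det (corner n X) = (\<Sum>p\<in>{p. p permutes {..<n}}. signof p * (\<Prod>i<n. X i (p i)))"
proof -
  have "(\<Prod>i<n. corner n X $$ (i, p i)) = (\<Prod>i<n. X i (p i))" if "p permutes {..<n}" for p
    using permutes_in_image[OF that] by (intro prod.cong) (auto simp: corner_def)
  then show ?thesis
    unfolding det_def'[OF corner_carrier] atLeast0LessThan by simp
qed

lemma norm_signof: "cmod (signof p * z) = cmod z"
  by (simp add: sign_def norm_mult)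

lemma det_corner_perturb:
  "cmod (Determinant.det (corner n (\<lambda>i j. A i j + E i j)) - Determinant.det (corner n A))
    \<le> (\<Prod>i<n. (\<Sum>j<n. cmod (A i j)) + (\<Sum>j<n. cmod (E i j))) - (\<Prod>i<n. \<Sum>j<n. cmod (A i j))"
proof -
  let ?g = "\<lambda>f. (\<Prod>i<n. cmod (A i (f i)) + cmod (E i (f i))) - (\<Prod>i<n. cmod (A i (f i)))"
  have "cmod (Determinant.det (corner n (\<lambda>i j. A i j + E i j)) - Determinant.det (corner n A))
      = cmod (\<Sum>p\<in>{p. p permutes {..<n}}.
          signof p * ((\<Prod>i<n. A i (p i) + E i (p i)) - (\<Prod>i<n. A i (p i))))"
    by (simp add: det_corner_def right_diff_distrib sum_subtractf)
  also have "\<dots> \<le> (\<Sum>p\<in>{p. p permutes {..<n}}. ?g p)"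
    by (intro order_trans[OF norm_sum] sum_mono)
      (simp only: norm_signof, rule norm_prod_add_diff_le, simp)
  also have "\<dots> \<le> (\<Sum>f\<in>{..<n} \<rightarrow>\<^sub>E {..<n}. ?g f)"
    by (rule sum_permutations_le_sum_functions) (auto intro!: prod_mono)
  also have "\<dots> = (\<Prod>i<n. \<Sum>j<n. cmod (A i j) + cmod (E i j)) - (\<Prod>i<n. \<Sum>j<n. cmod (A i j))"
    by (simp add: sum_subtractf prod_sum_PiE)
  finally show ?thesis
    by (simp add: sum.distrib)
qed

lemma det_corner_id [simp]: "Determinant.det (corner n imat_id) = 1"
  by (rule det_corner_lower) (auto simp: lower_tri_def imat_id_def)

lemma sum_norm_imat_id: "i < n \<Longrightarrow> (\<Sum>j<n. cmod (imat_id i j)) = 1"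
  by (simp add: imat_id_def if_distrib cong: if_cong)

lemma prod_one_plus_le_exp:
  fixes x :: "nat \<Rightarrow> real"
  assumes "\<And>i. i < n \<Longrightarrow> x i \<ge> 0"
  shows "(\<Prod>i<n. 1 + x i) \<le> exp (\<Sum>i<n. x i)"
  unfolding exp_sum[OF finite_lessThan]
  by (intro prod_mono) (use assms exp_ge_add_one_self in \<open>auto intro: add_nonneg_nonneg\<close>)

lemma det_corner_bound:
  "cmod (Determinant.det (corner n (\<lambda>i j. imat_id i j + X i j)))
    \<le> exp (\<Sum>i<n. \<Sum>j<n. cmod (X i j))"
proof -
  have "cmod (Determinant.det (corner n (\<lambda>i j. imat_id i j + X i j)) - 1)
      \<le> (\<Prod>i<n. 1 + (\<Sum>j<n. cmod (X i j))) - 1"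
    using det_corner_perturb[of n imat_id X] by (simp add: sum_norm_imat_id)
  moreover have "(\<Prod>i<n. 1 + (\<Sum>j<n. cmod (X i j))) \<le> exp (\<Sum>i<n. \<Sum>j<n. cmod (X i j))"
    by (intro prod_one_plus_le_exp sum_nonneg) auto
  ultimately show ?thesis
    using norm_triangle_ineq2[of "Determinant.det (corner n (\<lambda>i j. imat_id i j + X i j))" 1]
    by simp
qed

text \<open>The trace is the linear part of the determinant. With \<open>x i\<close> the row sums of
  absolute values, the error is majorised by the product of the \<open>1 + x i\<close> minus its
  constant and linear parts, and that product is at most the exponential of the sum.\<close>

lemma det_corner_first_order:
  "cmod (Determinant.det (corner n (\<lambda>i j. imat_id i j + X i j)) - 1 - (\<Sum>i<n. X i i))
    \<le> exp (\<Sum>i<n. \<Sum>j<n. cmod (X i j)) - 1 - (\<Sum>i<n. \<Sum>j<n. cmod (X i j))"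
proof -
  let ?I = imat_id
  let ?h = "\<lambda>f. (\<Prod>i<n. ?I i (f i) + X i (f i)) - (\<Prod>i<n. ?I i (f i))
    - (\<Sum>r<n. X r (f r) * (\<Prod>i\<in>{..<n} - {r}. ?I i (f i)))"
  let ?g = "\<lambda>f. (\<Prod>i<n. cmod (?I i (f i)) + cmod (X i (f i))) - (\<Prod>i<n. cmod (?I i (f i)))
    - (\<Sum>r<n. cmod (X r (f r)) * (\<Prod>i\<in>{..<n} - {r}. cmod (?I i (f i))))"
  have lin: "(\<Sum>p\<in>{p. p permutes {..<n}}.
      signof p * (\<Sum>r<n. X r (p r) * (\<Prod>i\<in>{..<n} - {r}. ?I i (p i)))) = (\<Sum>r<n. X r r)"
  proof -
    \<comment> \<open>A permutation other than \<open>id\<close> moves at least two points, so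
      deleting the single index \<open>r\<close> still leaves an off-diagonal entry of the identity
      in the product.\<close>
    have z: "(\<Sum>r<n. X r (p r) * (\<Prod>i\<in>{..<n} - {r}. ?I i (p i))) = 0"
      if p: "p permutes {..<n}" "p \<noteq> id" for p
    proof (rule sum.neutral, rule ballI)
      fix r assume r: "r \<in> {..<n}"
      have "\<exists>i\<in>{..<n} - {r}. i \<noteq> p i"
      proof (rule ccontr)
        assume "\<not> ?thesis"
        then have fx: "p i = i" if "i \<noteq> r" for i
          using that permutes_not_in[OF p(1), of i] by (cases "i < n") force+
        moreover have "p r = r"
          using fx permutes_inj[OF p(1)] by (metis injD)
        ultimately show False
          using p(2) by (metis eq_id_iff)
      qed
      then have "(\<Prod>i\<in>{..<n} - {r}. ?I i (p i)) = 0"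
        by (intro prod_zero) (auto simp: imat_id_def)
      then show "X r (p r) * (\<Prod>i\<in>{..<n} - {r}. ?I i (p i)) = 0" by simp
    qed
    have "(\<Sum>p\<in>{p. p permutes {..<n}}.
        signof p * (\<Sum>r<n. X r (p r) * (\<Prod>i\<in>{..<n} - {r}. ?I i (p i))))
      = (\<Sum>p\<in>{id}. signof p * (\<Sum>r<n. X r (p r) * (\<Prod>i\<in>{..<n} - {r}. ?I i (p i))))"
      by (rule sum.mono_neutral_right) (auto simp: finite_permutations permutes_id z)
    then show ?thesis
      by (simp add: imat_id_def sign_id)
  qed
  have "(\<Sum>p\<in>{p. p permutes {..<n}}. signof p * ?h p)
      = Determinant.det (corner n (\<lambda>i j. ?I i j + X i j)) - Determinant.det (corner n ?I) - (\<Sum>r<n. X r r)"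
    by (simp only: right_diff_distrib sum_subtractf lin det_corner_def)
  then have "cmod (Determinant.det (corner n (\<lambda>i j. ?I i j + X i j)) - 1 - (\<Sum>i<n. X i i))
      = cmod (\<Sum>p\<in>{p. p permutes {..<n}}. signof p * ?h p)"
    by simp
  also have "\<dots> \<le> (\<Sum>p\<in>{p. p permutes {..<n}}. ?g p)"
    by (intro order_trans[OF norm_sum] sum_mono)
      (simp only: norm_signof, rule norm_prod_add_first_order_le, simp)
  also have "\<dots> \<le> (\<Sum>f\<in>{..<n} \<rightarrow>\<^sub>E {..<n}. ?g f)"
  proof (rule sum_permutations_le_sum_functions)
    show "?g f \<ge> 0" for f
      by (rule order_trans[OF norm_ge_zero norm_prod_add_first_order_le]) simp
  qed (auto intro!: arg_cong2[where f = minus] sum.cong prod.cong)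
  also have "\<dots> = (\<Prod>i<n. 1 + (\<Sum>j<n. cmod (X i j))) - 1 - (\<Sum>i<n. \<Sum>j<n. cmod (X i j))"
  proof -
    have "(\<Sum>f\<in>{..<n} \<rightarrow>\<^sub>E {..<n}. cmod (X r (f r)) * (\<Prod>i\<in>{..<n} - {r}. cmod (?I i (f i))))
        = (\<Sum>j<n. cmod (X r j))" if r: "r < n" for r
    proof -
      \<comment> \<open>Absorbing the distinguished factor by a case distinction on
        \<open>i = r\<close> makes each summand one product over all rows, so that the sum over maps
        factors.\<close>
      have "(\<Sum>f\<in>{..<n} \<rightarrow>\<^sub>E {..<n}. cmod (X r (f r)) * (\<Prod>i\<in>{..<n} - {r}. cmod (?I i (f i))))
          = (\<Sum>f\<in>{..<n} \<rightarrow>\<^sub>E {..<n}. \<Prod>i<n. if i = r then cmod (X i (f i)) else cmod (?I i (f i)))"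
        by (intro sum.cong refl) (use r in \<open>simp add: prod.remove[of "{..<n}" r]\<close>)
      also have "\<dots> = (\<Prod>i<n. \<Sum>j<n. if i = r then cmod (X i j) else cmod (?I i j))"
        by (simp add: prod_sum_PiE)
      also have "\<dots> = (\<Prod>i<n. if i = r then \<Sum>j<n. cmod (X i j) else 1)"
        by (intro prod.cong) (auto simp: sum_norm_imat_id)
      finally show ?thesis using r by simp
    qed
    then have "(\<Sum>f\<in>{..<n} \<rightarrow>\<^sub>E {..<n}.
        \<Sum>r<n. cmod (X r (f r)) * (\<Prod>i\<in>{..<n} - {r}. cmod (?I i (f i))))
      = (\<Sum>i<n. \<Sum>j<n. cmod (X i j))"
      by (subst sum.swap) simp
    moreover have "(\<Sum>f\<in>{..<n} \<rightarrow>\<^sub>E {..<n}. \<Prod>i<n. cmod (?I i (f i)) + cmod (X i (f i)))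
        = (\<Prod>i<n. 1 + (\<Sum>j<n. cmod (X i j)))"
      by (subst prod_sum_PiE[symmetric]) (auto simp: sum.distrib sum_norm_imat_id)
    moreover have "(\<Sum>f\<in>{..<n} \<rightarrow>\<^sub>E {..<n}. \<Prod>i<n. cmod (?I i (f i))) = 1"
      by (subst prod_sum_PiE[symmetric]) (auto simp: sum_norm_imat_id)
    ultimately show ?thesis
      by (simp only: sum_subtractf)
  qed
  also have "\<dots> \<le> exp (\<Sum>i<n. \<Sum>j<n. cmod (X i j)) - 1 - (\<Sum>i<n. \<Sum>j<n. cmod (X i j))"
    by (intro diff_right_mono prod_one_plus_le_exp sum_nonneg) auto
  finally show ?thesis .
qed

text \<open>Replace one factor at a time. The majorants \<open>1 + u i + e i\<close> are at least 1,
  so a missing factor can always be filled in.\<close>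

lemma prod_add_diff_le_sum:
  fixes x e u :: "'b \<Rightarrow> real"
  assumes "finite I" "\<And>i. i \<in> I \<Longrightarrow> 0 \<le> x i" "\<And>i. i \<in> I \<Longrightarrow> x i \<le> 1 + u i"
    "\<And>i. i \<in> I \<Longrightarrow> 0 \<le> e i" "\<And>i. i \<in> I \<Longrightarrow> 0 \<le> u i"
  shows "(\<Prod>i\<in>I. x i + e i) - (\<Prod>i\<in>I. x i) \<le> (\<Sum>i\<in>I. e i) * (\<Prod>i\<in>I. 1 + u i + e i)"
  using assms
proof (induction I rule: finite_induct)
  case (insert k I)
  let ?Y = "\<Prod>i\<in>I. 1 + u i + e i" and ?s = "\<Sum>i\<in>I. e i"
  have P: "(\<Prod>i\<in>I. x i + e i) \<le> ?Y"
    by (intro prod_mono) (use insert in auto)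
  have k: "0 \<le> x k" "x k \<le> 1 + u k" "0 \<le> e k" "0 \<le> u k" using insert by auto
  have Y: "0 \<le> ?Y" by (intro prod_nonneg) (use insert in auto)
  have s: "0 \<le> ?s" by (intro sum_nonneg) (use insert in auto)
  have IH: "(\<Prod>i\<in>I. x i + e i) - (\<Prod>i\<in>I. x i) \<le> ?s * ?Y"
    using insert by auto
  have "(x k + e k) * (\<Prod>i\<in>I. x i + e i) - x k * (\<Prod>i\<in>I. x i)
      = x k * ((\<Prod>i\<in>I. x i + e i) - (\<Prod>i\<in>I. x i)) + e k * (\<Prod>i\<in>I. x i + e i)"
    by (simp add: algebra_simps)
  also have "\<dots> \<le> x k * (?s * ?Y) + e k * ?Y"
    by (intro add_mono mult_left_mono IH P k)
  also have "\<dots> \<le> (1 + u k + e k) * (?s * ?Y) + e k * ((1 + u k + e k) * ?Y)"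
    by (intro add_mono mult_right_mono mult_left_mono)
       (use k s Y in \<open>auto simp: mult_le_cancel_right1\<close>)
  finally show ?case
    using insert by (simp add: algebra_simps)
qed simp

text \<open>The factor \<open>real n\<close> counts the rows. The hypothesis \<open>ne\<close> lets
  the errors add at most 1 to the exponent, hence \<open>S + 1\<close>, and the bound depends on
  \<open>n\<close> only through \<open>real n * e\<close>.\<close>

lemma det_corner_perturb_le:
  assumes X: "\<And>i. i < n \<Longrightarrow> (\<Sum>j<n. cmod (X i j)) \<le> u i"
    and E: "\<And>i. i < n \<Longrightarrow> (\<Sum>j<n. cmod (E i j)) \<le> e"
    and ne: "real n * e \<le> 1" and u: "(\<Sum>i<n. u i) \<le> S"
  shows "cmod (Determinant.det (corner n (\<lambda>i j. imat_id i j + X i j + E i j))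
      - Determinant.det (corner n (\<lambda>i j. imat_id i j + X i j))) \<le> real n * e * exp (S + 1)"
proof -
  let ?A = "\<lambda>i j. imat_id i j + X i j"
  have e0: "0 \<le> e" if "0 < n"
    using E[OF that] by (meson norm_ge_zero order_trans sum_nonneg)
  have u0: "0 \<le> u i" if "i < n" for i
    using X[OF that] by (meson norm_ge_zero order_trans sum_nonneg)
  have A: "(\<Sum>j<n. cmod (?A i j)) \<le> 1 + u i" if "i < n" for i
  proof -
    have "(\<Sum>j<n. cmod (?A i j)) \<le> (\<Sum>j<n. cmod (imat_id i j) + cmod (X i j))"
      by (intro sum_mono norm_triangle_ineq)
    then show ?thesis
      using X[OF that] by (simp add: sum.distrib sum_norm_imat_id[OF that])
  qed
  have "cmod (Determinant.det (corner n (\<lambda>i j. ?A i j + E i j)) - Determinant.det (corner n ?A))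
      \<le> (\<Prod>i<n. (\<Sum>j<n. cmod (?A i j)) + (\<Sum>j<n. cmod (E i j))) - (\<Prod>i<n. \<Sum>j<n. cmod (?A i j))"
    by (rule det_corner_perturb)
  also have "\<dots> \<le> (\<Prod>i<n. (\<Sum>j<n. cmod (?A i j)) + e) - (\<Prod>i<n. \<Sum>j<n. cmod (?A i j))"
    by (intro diff_right_mono prod_mono) (auto intro!: add_nonneg_nonneg sum_nonneg E)
  also have "\<dots> \<le> (\<Sum>i<n. e) * (\<Prod>i<n. 1 + u i + e)"
    by (rule prod_add_diff_le_sum) (use A u0 e0 in \<open>auto intro: sum_nonneg\<close>)
  also have "(\<Prod>i<n. 1 + u i + e) \<le> exp (\<Sum>i<n. u i + e)"
    using prod_one_plus_le_exp[of n "\<lambda>i. u i + e"] u0 e0 by (simp add: add.assoc)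
  also have "(\<Sum>i<n. u i + e) \<le> S + 1"
    using u ne by (simp add: sum.distrib)
  finally show ?thesis
    using e0 by (cases "n = 0") (auto simp: mult_left_mono)
qed

section \<open>Toeplitz and Hankel matrices\<close>

lemma infsum_eq_suminf_norm:
  fixes f :: "nat \<Rightarrow> complex"
  assumes "summable (\<lambda>n. cmod (f n))"
  shows "(\<Sum>\<^sub>\<infinity>n. f n) = (\<Sum>n. f n)"
  using norm_summable_imp_has_sum[OF assms summable_sums[OF summable_norm_cancel[OF assms]]]
  by (rule infsumI)

lemma norm_infsum_geometric_le:
  fixes f :: "nat \<Rightarrow> complex"
  assumes r: "0 \<le> r" "r < 1" and f: "\<And>p. n \<le> p \<Longrightarrow> cmod (f p) \<le> B * r ^ p" "\<And>p. p < n \<Longrightarrow> f p = 0"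
  shows "summable (\<lambda>p. cmod (f p))" "cmod (\<Sum>\<^sub>\<infinity>p. f p) \<le> B * r ^ n / (1 - r)"
proof -
  let ?g = "\<lambda>p. if p < n then 0 else B * r ^ p"
  have "(\<lambda>p. B * r ^ n * r ^ p) sums (B * r ^ n * (1 / (1 - r)))"
    by (intro sums_mult geometric_sums) (use r in auto)
  then have "(\<lambda>p. ?g (p + n)) sums (B * r ^ n / (1 - r))"
    by (simp add: power_add mult_ac)
  then have g: "?g sums (B * r ^ n / (1 - r))"
    by (subst (asm) sums_zero_iff_shift) auto
  have fg: "cmod (f p) \<le> ?g p" for p
    using f by (cases "p < n") auto
  show s: "summable (\<lambda>p. cmod (f p))"
    by (rule summable_comparison_test'[OF sums_summable[OF g]]) (use fg in auto)
  have "cmod (\<Sum>\<^sub>\<infinity>p. f p) \<le> (\<Sum>p. cmod (f p))"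
    unfolding infsum_eq_suminf_norm[OF s] by (rule summable_norm[OF s])
  also have "\<dots> \<le> (\<Sum>p. ?g p)"
    by (rule suminf_le[OF fg s sums_summable[OF g]])
  finally show "cmod (\<Sum>\<^sub>\<infinity>p. f p) \<le> B * r ^ n / (1 - r)"
    using sums_unique[OF g] by simp
qed

definition upper_toeplitz :: "complex fps \<Rightarrow> imat" where
  "upper_toeplitz a = (\<lambda>i j. if i \<le> j then fps_nth a (j - i) else 0)"

definition lower_toeplitz :: "complex fps \<Rightarrow> imat" where
  "lower_toeplitz b = (\<lambda>i j. if j \<le> i then fps_nth b (i - j) else 0)"

text \<open>The product of the Hankel matrices of \<open>b\<close> and \<open>a\<close>. The shift
  by one leaves out the constant coefficients.\<close>

definition hankel :: "complex fps \<Rightarrow> complex fps \<Rightarrow> imat" where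
  "hankel a b = (\<lambda>i j. \<Sum>\<^sub>\<infinity>q. fps_nth b (Suc (i + q)) * fps_nth a (Suc (j + q)))"

definition geo_bounded :: "real \<Rightarrow> real \<Rightarrow> complex fps \<Rightarrow> bool" where
  "geo_bounded r M a \<longleftrightarrow> (\<forall>k. cmod (fps_nth a k) \<le> M * r ^ k)"

lemma geo_boundedD: "geo_bounded r M a \<Longrightarrow> cmod (fps_nth a k) \<le> M * r ^ k"
  by (simp add: geo_bounded_def)

lemma geo_bounded_nonneg: "geo_bounded r M a \<Longrightarrow> 0 \<le> M"
  using order_trans[OF norm_ge_zero geo_boundedD[of r M a 0]] by simp

lemma upper_tri_toeplitz [simp]: "upper_tri (upper_toeplitz a)"
  by (simp add: upper_tri_def upper_toeplitz_def)

lemma lower_tri_toeplitz [simp]: "lower_tri (lower_toeplitz a)"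
  by (simp add: lower_tri_def lower_toeplitz_def)

lemma upper_toeplitz_one [simp]: "upper_toeplitz 1 = imat_id"
  by (auto simp: upper_toeplitz_def imat_id_def fun_eq_iff)

lemma lower_toeplitz_one [simp]: "lower_toeplitz 1 = imat_id"
  by (auto simp: lower_toeplitz_def imat_id_def fun_eq_iff)

lemma upper_toeplitz_mult: "upper_toeplitz a \<star> upper_toeplitz b = upper_toeplitz (a * b)"
proof (intro ext)
  fix i j
  show "(upper_toeplitz a \<star> upper_toeplitz b) i j = upper_toeplitz (a * b) i j"
  proof (cases "i \<le> j")
    case True
    have "(upper_toeplitz a \<star> upper_toeplitz b) i j
        = (\<Sum>p\<in>{i..j}. upper_toeplitz a i p * upper_toeplitz b p j)"
      by (rule imat_mult_finite) (auto simp: upper_toeplitz_def)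
    also have "\<dots> = (\<Sum>k\<in>{0..j - i}. fps_nth a k * fps_nth b (j - i - k))"
      by (rule sum.reindex_bij_witness[where i = "\<lambda>k. k + i" and j = "\<lambda>p. p - i"])
        (use True in \<open>auto simp: upper_toeplitz_def\<close>)
    finally show ?thesis
      using True by (simp add: upper_toeplitz_def fps_mult_nth)
  next
    case False
    have "(upper_toeplitz a \<star> upper_toeplitz b) i j
        = (\<Sum>p\<in>{}. upper_toeplitz a i p * upper_toeplitz b p j)"
      by (rule imat_mult_finite) (use False in \<open>auto simp: upper_toeplitz_def\<close>)
    then show ?thesis using False by (simp add: upper_toeplitz_def)
  qed
qed

lemma lower_toeplitz_mult: "lower_toeplitz a \<star> lower_toeplitz b = lower_toeplitz (a * b)"
proof (intro ext)
  fix i j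
  show "(lower_toeplitz a \<star> lower_toeplitz b) i j = lower_toeplitz (a * b) i j"
  proof (cases "j \<le> i")
    case True
    have "(lower_toeplitz a \<star> lower_toeplitz b) i j
        = (\<Sum>p\<in>{j..i}. lower_toeplitz a i p * lower_toeplitz b p j)"
      by (rule imat_mult_finite) (auto simp: lower_toeplitz_def)
    also have "\<dots> = (\<Sum>k\<in>{0..i - j}. fps_nth a k * fps_nth b (i - j - k))"
      by (rule sum.reindex_bij_witness[where i = "\<lambda>k. i - k" and j = "\<lambda>p. i - p"])
        (use True in \<open>auto simp: lower_toeplitz_def\<close>)
    finally show ?thesis
      using True by (simp add: lower_toeplitz_def fps_mult_nth)
  next
    case False
    have "(lower_toeplitz a \<star> lower_toeplitz b) i j
        = (\<Sum>p\<in>{}. lower_toeplitz a i p * lower_toeplitz b p j)"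
      by (rule imat_mult_finite) (use False in \<open>auto simp: lower_toeplitz_def\<close>)
    then show ?thesis using False by (simp add: lower_toeplitz_def)
  qed
qed

lemma sum_geometric_le:
  assumes "0 \<le> r" "r < (1 :: real)" "finite A" "inj_on f A"
  shows "(\<Sum>x\<in>A. r ^ f x) \<le> 1 / (1 - r)"
proof -
  have "(\<Sum>x\<in>A. r ^ f x) = (\<Sum>n\<in>f ` A. r ^ n)"
    using assms by (simp add: sum.reindex)
  also have "\<dots> \<le> (\<Sum>n. r ^ n)"
    by (rule sum_le_suminf) (use assms in \<open>auto intro: summable_geometric\<close>)
  also have "\<dots> = 1 / (1 - r)"
    by (rule suminf_geometric) (use assms in auto)
  finally show ?thesis .
qed

lemma rows_bounded_upper_toeplitz:
  assumes "0 \<le> r" "r < 1" "geo_bounded r M a"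
  shows "rows_bounded (upper_toeplitz a)"
proof (rule rows_boundedI)
  fix i F assume F: "finite (F :: nat set)"
  have "(\<Sum>j\<in>F. cmod (upper_toeplitz a i j)) = (\<Sum>j\<in>F \<inter> {i..}. cmod (fps_nth a (j - i)))"
    by (rule sum.mono_neutral_cong_right) (use F in \<open>auto simp: upper_toeplitz_def\<close>)
  also have "\<dots> \<le> (\<Sum>j\<in>F \<inter> {i..}. M * r ^ (j - i))"
    by (intro sum_mono geo_boundedD assms)
  also have "\<dots> = M * (\<Sum>j\<in>F \<inter> {i..}. r ^ (j - i))"
    by (rule sum_distrib_left[symmetric])
  also have "\<dots> \<le> M * (1 / (1 - r))"
    by (intro mult_left_mono sum_geometric_le geo_bounded_nonneg[OF assms(3)])
      (use assms F in \<open>auto simp: inj_on_def\<close>)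
  finally show "(\<Sum>j\<in>F. cmod (upper_toeplitz a i j)) \<le> M * (1 / (1 - r))" .
qed

lemma rows_bounded_lower_toeplitz:
  assumes "0 \<le> r" "r < 1" "geo_bounded r M a"
  shows "rows_bounded (lower_toeplitz a)"
proof (rule rows_boundedI)
  fix i F assume F: "finite (F :: nat set)"
  have "(\<Sum>j\<in>F. cmod (lower_toeplitz a i j)) = (\<Sum>j\<in>F \<inter> {..i}. cmod (fps_nth a (i - j)))"
    by (rule sum.mono_neutral_cong_right) (use F in \<open>auto simp: lower_toeplitz_def\<close>)
  also have "\<dots> \<le> (\<Sum>j\<in>F \<inter> {..i}. M * r ^ (i - j))"
    by (intro sum_mono geo_boundedD assms)
  also have "\<dots> = M * (\<Sum>j\<in>F \<inter> {..i}. r ^ (i - j))"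
    by (rule sum_distrib_left[symmetric])
  also have "\<dots> \<le> M * (1 / (1 - r))"
    by (intro mult_left_mono sum_geometric_le geo_bounded_nonneg[OF assms(3)])
      (use assms F in \<open>auto simp: inj_on_def\<close>)
  finally show "(\<Sum>j\<in>F. cmod (lower_toeplitz a i j)) \<le> M * (1 / (1 - r))" .
qed

text \<open>Only coefficients of positive index are constrained: for \<open>exp (s a)\<close> these
  are of order \<open>s\<close>, whereas the constant one is 1. This is what makes the Hankel
  product of order \<open>s\<^sup>2\<close> later on.\<close>

lemma norm_hankel_le:
  assumes r: "0 \<le> r" "r < 1"
    and a: "\<And>k. cmod (fps_nth a (Suc k)) \<le> M * r ^ Suc k"
    and b: "\<And>k. cmod (fps_nth b (Suc k)) \<le> N * r ^ Suc k"
    and "0 \<le> M" "0 \<le> N"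
  shows "summable (\<lambda>q. cmod (fps_nth b (Suc (i + q)) * fps_nth a (Suc (j + q))))"
    "cmod (hankel a b i j) \<le> M * N / (1 - r) * r ^ (i + j)"
proof -
  have 1: "cmod (fps_nth b (Suc (i + q)) * fps_nth a (Suc (j + q))) \<le> (M * N * r ^ (i + j)) * r ^ q" for q
  proof -
    have "cmod (fps_nth b (Suc (i + q)) * fps_nth a (Suc (j + q)))
        \<le> (N * r ^ Suc (i + q)) * (M * r ^ Suc (j + q))"
      unfolding norm_mult by (intro mult_mono a b) (use assms in auto)
    also have "\<dots> = (M * N * r ^ (i + j) * r ^ q) * r ^ (q + 2)"
      by (simp add: power_add power2_eq_square mult_ac)
    also have "\<dots> \<le> (M * N * r ^ (i + j) * r ^ q) * 1"
      by (intro mult_left_mono power_le_one) (use assms in auto)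
    finally show ?thesis by simp
  qed
  show "summable (\<lambda>q. cmod (fps_nth b (Suc (i + q)) * fps_nth a (Suc (j + q))))"
    by (rule norm_infsum_geometric_le(1)[OF r, where n = 0]) (use 1 in auto)
  show "cmod (hankel a b i j) \<le> M * N / (1 - r) * r ^ (i + j)"
    unfolding hankel_def
    using norm_infsum_geometric_le(2)[OF r, where n = 0, OF 1] by simp
qed

lemma rows_bounded_decay:
  assumes r: "0 \<le> r" "r < 1" and X: "\<And>i j. cmod (X i j) \<le> M * r ^ (i + j)"
  shows "rows_bounded X"
proof (rule rows_boundedI)
  fix i F assume F: "finite (F :: nat set)"
  have M: "0 \<le> M" using order_trans[OF norm_ge_zero X[of 0 0]] by simp
  have "(\<Sum>j\<in>F. cmod (X i j)) \<le> (\<Sum>j\<in>F. M * r ^ j)"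
  proof (intro sum_mono order_trans[OF X] mult_left_mono M)
    show "r ^ (i + j) \<le> r ^ j" for j
      using r by (intro power_decreasing) auto
  qed
  also have "\<dots> = M * (\<Sum>j\<in>F. r ^ j)"
    by (rule sum_distrib_left[symmetric])
  also have "\<dots> \<le> M * (1 / (1 - r))"
    by (intro mult_left_mono sum_geometric_le M r F) auto
  finally show "(\<Sum>j\<in>F. cmod (X i j)) \<le> M * (1 / (1 - r))" .
qed

lemma norm_upper_toeplitz_mult_le:
  assumes r: "0 \<le> r" "r < 1" and a: "geo_bounded r M a" and X: "\<And>i j. cmod (X i j) \<le> x * r ^ (i + j)"
  shows "cmod ((upper_toeplitz a \<star> X) i j) \<le> M * x / (1 - r) * r ^ (i + j)"
proof -
  have M: "0 \<le> M" using geo_bounded_nonneg[OF a] .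
  have x: "0 \<le> x" using order_trans[OF norm_ge_zero X[of 0 0]] by simp
  have "cmod (upper_toeplitz a i p * X p j) \<le> (M * x * r ^ j) * r ^ p" if "i \<le> p" for p
  proof -
    have "cmod (upper_toeplitz a i p * X p j) \<le> (M * r ^ (p - i)) * (x * r ^ (p + j))"
      unfolding norm_mult
      by (intro mult_mono X) (use that M r geo_boundedD[OF a] in \<open>auto simp: upper_toeplitz_def\<close>)
    also have "\<dots> = (M * x * r ^ j * r ^ p) * r ^ (p - i)"
      by (simp add: power_add mult_ac)
    also have "\<dots> \<le> (M * x * r ^ j * r ^ p) * 1"
      by (intro mult_left_mono power_le_one) (use r M x in auto)
    finally show ?thesis by simp
  qed
  from norm_infsum_geometric_le(2)[OF r this, of i]
  show ?thesis
    unfolding imat_mult_def by (simp add: upper_toeplitz_def power_add mult_ac)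
qed

text \<open>Both factors decay at the same rate, so each of the \<open>Suc i\<close> terms of the
  convolution has full size \<open>r ^ (i + j)\<close>. The resulting factor \<open>Suc i\<close> is
  harmless, as \<open>Suc i * r ^ i\<close> is still summable.\<close>

lemma norm_lower_toeplitz_mult_le:
  assumes r: "0 \<le> r" "r < 1" and b: "geo_bounded r M b" and X: "\<And>i j. cmod (X i j) \<le> x * r ^ (i + j)"
  shows "cmod ((lower_toeplitz b \<star> X) i j) \<le> M * x * real (Suc i) * r ^ (i + j)"
proof -
  have M: "0 \<le> M" using geo_bounded_nonneg[OF b] .
  have x: "0 \<le> x" using order_trans[OF norm_ge_zero X[of 0 0]] by simp
  have "(lower_toeplitz b \<star> X) i j = (\<Sum>p\<le>i. lower_toeplitz b i p * X p j)"
    by (rule imat_mult_finite) (auto simp: lower_toeplitz_def)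
  also have "cmod \<dots> \<le> (\<Sum>p\<le>i. (M * r ^ (i - p)) * (x * r ^ (p + j)))"
    by (intro order_trans[OF norm_sum] sum_mono)
      (auto simp: norm_mult lower_toeplitz_def intro!: mult_mono X geo_boundedD[OF b] mult_nonneg_nonneg zero_le_power M x r)
  also have "\<dots> = (\<Sum>p\<le>i. M * x * r ^ (i + j))"
  proof (intro sum.cong refl)
    fix p assume "p \<in> {..i}"
    then have "r ^ (i + j) = r ^ (i - p) * r ^ (p + j)"
      by (simp add: power_add[symmetric])
    then show "(M * r ^ (i - p)) * (x * r ^ (p + j)) = M * x * r ^ (i + j)"
      by (simp add: mult_ac)
  qed
  finally show ?thesis by (simp add: mult_ac)
qed

text \<open>Both products sum the same sequence along a diagonal: the product on the left stops at index
  \<open>min i j\<close>, and the Hankel matrix collects the remaining tail.\<close>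

lemma lower_upper_toeplitz_commutator:
  assumes r: "0 \<le> r" "r < 1" and a: "geo_bounded r M a" and b: "geo_bounded r N b"
  shows "lower_toeplitz b \<star> upper_toeplitz a
    = (\<lambda>i j. (upper_toeplitz a \<star> lower_toeplitz b) i j - hankel a b i j)"
proof (intro ext)
  fix i j
  \<comment> \<open>Truncated subtraction makes one of the offsets \<open>j - i\<close> and
    \<open>i - j\<close> vanish, so one formula serves both sides of the diagonal.\<close>
  define g where "g = (\<lambda>t. fps_nth a (t + (j - i)) * fps_nth b (t + (i - j)))"
  note M = geo_bounded_nonneg[OF a] and N = geo_bounded_nonneg[OF b]
  let ?f = "\<lambda>p. upper_toeplitz a i p * lower_toeplitz b p j"
  have f: "?f p = (if p < max i j then 0 else g (p - max i j))" for p
    by (auto simp: upper_toeplitz_def lower_toeplitz_def g_def max_def)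
  have "cmod (g t) \<le> (M * N) * r ^ t" for t
  proof -
    have "cmod (g t) \<le> (M * r ^ (t + (j - i))) * (N * r ^ (t + (i - j)))"
      unfolding g_def norm_mult by (intro mult_mono geo_boundedD[OF a] geo_boundedD[OF b]) (use r M in auto)
    also have "\<dots> = (M * N * r ^ t) * r ^ ((j - i) + t + (i - j))"
      by (simp add: power_add mult_ac)
    also have "\<dots> \<le> (M * N * r ^ t) * 1"
      by (intro mult_left_mono power_le_one) (use r M N in auto)
    finally show ?thesis by simp
  qed
  then have gs: "summable (\<lambda>t. cmod (g t))"
    by (intro norm_infsum_geometric_le(1)[OF r, where n = 0]) auto
  then have gsums: "g sums suminf g"
    by (rule summable_sums[OF summable_norm_cancel])
  have "(\<lambda>p. ?f (p + max i j)) sums suminf g" unfolding f using gsums by simp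
  then have "?f sums suminf g"
    by (subst (asm) sums_zero_iff_shift) (auto simp: f)
  moreover have fs: "summable (\<lambda>p. cmod (?f p))"
    using gs by (subst summable_iff_shift[symmetric, of _ "max i j"]) (simp add: f)
  ultimately have UL: "(upper_toeplitz a \<star> lower_toeplitz b) i j = suminf g"
    unfolding imat_mult_def infsum_eq_suminf_norm[OF fs] by (simp add: sums_iff)
  have "(lower_toeplitz b \<star> upper_toeplitz a) i j
      = (\<Sum>q\<le>min i j. lower_toeplitz b i q * upper_toeplitz a q j)"
    by (rule imat_mult_finite) (auto simp: lower_toeplitz_def upper_toeplitz_def)
  also have "\<dots> = (\<Sum>t<Suc (min i j). g t)"
    by (rule sum.reindex_bij_witness[where i = "\<lambda>t. min i j - t" and j = "\<lambda>q. min i j - q"])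
      (auto simp: lower_toeplitz_def upper_toeplitz_def g_def min_def)
  finally have LU: "(lower_toeplitz b \<star> upper_toeplitz a) i j = (\<Sum>t<Suc (min i j). g t)" .
  have h: "fps_nth b (Suc (i + q)) * fps_nth a (Suc (j + q)) = g (q + Suc (min i j))" for q
    by (auto simp: g_def min_def add_ac)
  have "hankel a b i j = (\<Sum>q. g (q + Suc (min i j)))"
    unfolding hankel_def h
    by (rule infsum_eq_suminf_norm) (use gs summable_iff_shift[of "\<lambda>t. cmod (g t)"] in blast)
  then show "(lower_toeplitz b \<star> upper_toeplitz a) i j
    = (upper_toeplitz a \<star> lower_toeplitz b) i j - hankel a b i j"
    unfolding UL LU using suminf_split_initial_segment[OF sums_summable[OF gsums], of "Suc (min i j)"]
    by simp
qed

section \<open>Multiplicativity of Toeplitz determinants\<close>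

text \<open>For \<open>0 < r < 1\<close> this says that \<open>a\<close> and its inverse are
  analytic on a disc larger than the unit disc, as for a Wiener-Hopf factor. The constant term is
  normalised so that the triangular Toeplitz matrices are unit triangular.\<close>

definition wiener :: "real \<Rightarrow> complex fps \<Rightarrow> bool" where
  "wiener r a \<longleftrightarrow> fps_nth a 0 = 1 \<and> (\<exists>M. geo_bounded r M a) \<and> (\<exists>M. geo_bounded r M (inverse a))"

definition tdet :: "nat \<Rightarrow> complex fps \<Rightarrow> complex fps \<Rightarrow> complex" where
  "tdet n a b = Determinant.det (corner n (upper_toeplitz a \<star> lower_toeplitz b))"

definition toeplitz_comm :: "complex fps \<Rightarrow> complex fps \<Rightarrow> imat" where
  "toeplitz_comm a b = lower_toeplitz (inverse b) \<star>
     (upper_toeplitz a \<star> (lower_toeplitz b \<star> upper_toeplitz (inverse a)))"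

text \<open>Write \<open>U\<close> and \<open>V\<close> for the upper and lower Toeplitz matrices of
  \<open>a\<close> and \<open>b\<close>, and \<open>H\<close> for the Hankel product of
  \<open>inverse a\<close> and \<open>b\<close>. The relation \<open>V U^-1 = U^-1 V - H\<close>
  turns the commutator into \<open>V^-1 U (U^-1 V - H) = 1 - V^-1 U H\<close>.\<close>

definition toeplitz_rem :: "complex fps \<Rightarrow> complex fps \<Rightarrow> imat" where
  "toeplitz_rem a b = (\<lambda>i j. - (lower_toeplitz (inverse b) \<star>
     (upper_toeplitz a \<star> hankel (inverse a) b)) i j)"

lemma toeplitz_diag [simp]: "upper_toeplitz a i i = fps_nth a 0" "lower_toeplitz a i i = fps_nth a 0"
  by (simp_all add: upper_toeplitz_def lower_toeplitz_def)

lemma tdet_commute: "tdet n a b = tdet n b a"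
proof -
  have "corner n (upper_toeplitz b \<star> lower_toeplitz a)
      = transpose_mat (corner n (upper_toeplitz a \<star> lower_toeplitz b))"
    by (rule eq_matI)
      (auto simp: corner_def imat_mult_def upper_toeplitz_def lower_toeplitz_def mult.commute
        intro!: infsum_cong)
  then show ?thesis
    unfolding tdet_def by (simp add: det_transpose[OF corner_carrier])
qed

lemma sum_Suc_geometric_le:
  assumes "0 \<le> r" "r < (1 :: real)"
  shows "(\<Sum>i<n. real (Suc i) * r ^ i) \<le> 1 / (1 - r)\<^sup>2"
proof -
  have s: "(\<lambda>n. real (Suc n) * r ^ n) sums (1 / (1 - r)\<^sup>2)"
    using geometric_deriv_sums[of r] assms by simp
  have "(\<Sum>i<n. real (Suc i) * r ^ i) \<le> (\<Sum>i. real (Suc i) * r ^ i)"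
    by (rule sum_le_suminf) (use assms sums_summable[OF s] in auto)
  then show ?thesis using sums_unique[OF s] by simp
qed

lemma sum_row_decay_le:
  assumes r: "0 \<le> r" "r < 1" and X: "\<And>i j. cmod (X i j) \<le> C * real (Suc i) * r ^ (i + j)"
  shows "(\<Sum>j<n. cmod (X i j)) \<le> C / (1 - r) * (real (Suc i) * r ^ i)"
proof -
  have C: "0 \<le> C" using order_trans[OF norm_ge_zero X[of 0 0]] by simp
  have "(\<Sum>j<n. cmod (X i j)) \<le> (\<Sum>j<n. C * real (Suc i) * r ^ i * r ^ j)"
    by (intro sum_mono order_trans[OF X]) (simp add: power_add mult_ac)
  also have "\<dots> = C * real (Suc i) * r ^ i * (\<Sum>j<n. r ^ j)"
    by (rule sum_distrib_left[symmetric])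
  also have "\<dots> \<le> C * real (Suc i) * r ^ i * (1 / (1 - r))"
    by (intro mult_left_mono sum_geometric_le mult_nonneg_nonneg C) (use r in auto)
  finally show ?thesis by (simp add: mult_ac)
qed

lemma sum_rows_decay_le:
  assumes r: "0 \<le> r" "r < 1" and C: "0 \<le> C"
  shows "(\<Sum>i<n. C / (1 - r) * (real (Suc i) * r ^ i)) \<le> C / (1 - r) ^ 3"
proof -
  have "(\<Sum>i<n. C / (1 - r) * (real (Suc i) * r ^ i)) = C / (1 - r) * (\<Sum>i<n. real (Suc i) * r ^ i)"
    by (rule sum_distrib_left[symmetric])
  also have "\<dots> \<le> C / (1 - r) * (1 / (1 - r)\<^sup>2)"
    by (intro mult_left_mono sum_Suc_geometric_le r) (use r C in auto)
  finally show ?thesis by (simp add: power2_eq_square power3_eq_cube mult_ac)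
qed

lemma det_mult3:
  assumes "A \<in> carrier_mat n n" "B \<in> carrier_mat n n" "C \<in> carrier_mat n n"
  shows "Determinant.det (A * (B * C))
    = Determinant.det A * (Determinant.det B * Determinant.det C)"
  using assms by (simp add: det_mult[of _ n] mult_carrier_mat[of _ n n _ n])

context
  fixes r :: real
  assumes r: "0 \<le> r" "r < 1"
begin

lemma wiener_rows_bounded:
  assumes "wiener r a"
  shows "rows_bounded (upper_toeplitz a)" "rows_bounded (upper_toeplitz (inverse a))"
    "rows_bounded (lower_toeplitz a)" "rows_bounded (lower_toeplitz (inverse a))"
  using assms rows_bounded_upper_toeplitz[OF r] rows_bounded_lower_toeplitz[OF r]
  unfolding wiener_def by blast+

lemma wiener_inverse:
  assumes "wiener r a"
  shows "a * inverse a = 1" "inverse a * a = 1"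
  using assms by (simp_all add: wiener_def inverse_mult_eq_1 inverse_mult_eq_1')

text \<open>The lower triangular inverse stands on the left and the upper triangular one on the
  right, exactly where truncation is multiplicative, and both corners have determinant 1.\<close>

lemma det_corner_toeplitz_comm:
  assumes a: "wiener r a" and b: "wiener r b"
  shows "Determinant.det (corner n (toeplitz_comm a b)) = tdet n a b"
proof -
  note rb = wiener_rows_bounded[OF a] wiener_rows_bounded[OF b]
  have "corner n (toeplitz_comm a b) = corner n (lower_toeplitz (inverse b)) *
      (corner n (upper_toeplitz a \<star> lower_toeplitz b) * corner n (upper_toeplitz (inverse a)))"
    unfolding toeplitz_comm_def imat_mult_assoc[OF rb(1,7,2), symmetric]
    by (simp add: corner_mult_lower corner_mult_upper)
  also have "Determinant.det \<dots> = Determinant.det (corner n (lower_toeplitz (inverse b))) *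
      (tdet n a b * Determinant.det (corner n (upper_toeplitz (inverse a))))"
    unfolding tdet_def by (rule det_mult3[of _ n]) simp_all
  also have "Determinant.det (corner n (lower_toeplitz (inverse b))) = 1"
    by (rule det_corner_lower) (use b in \<open>auto simp: wiener_def\<close>)
  also have "Determinant.det (corner n (upper_toeplitz (inverse a))) = 1"
    by (rule det_corner_upper) (use a in \<open>auto simp: wiener_def\<close>)
  finally show ?thesis by simp
qed

lemma wiener_hankel_rows_bounded:
  assumes a: "wiener r a" and b: "wiener r b"
  shows "rows_bounded (hankel (inverse a) b)"
proof -
  obtain M N where "geo_bounded r M (inverse a)" "geo_bounded r N b"
    using a b unfolding wiener_def by blast
  then have "cmod (hankel (inverse a) b i j) \<le> M * N / (1 - r) * r ^ (i + j)" for i j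
    by (intro norm_hankel_le(2)[OF r] geo_boundedD) (auto intro: geo_bounded_nonneg)
  then show ?thesis
    by (rule rows_bounded_decay[OF r])
qed

lemma toeplitz_comm_eq:
  assumes a: "wiener r a" and b: "wiener r b"
  shows "toeplitz_comm a b = (\<lambda>i j. imat_id i j + toeplitz_rem a b i j)"
proof -
  note rb = wiener_rows_bounded[OF a] wiener_rows_bounded[OF b] wiener_hankel_rows_bounded[OF a b]
    rows_bounded_mult rows_bounded_id
  obtain M N where MN: "geo_bounded r M (inverse a)" "geo_bounded r N b"
    using a b unfolding wiener_def by blast
  have "toeplitz_comm a b = lower_toeplitz (inverse b) \<star> (upper_toeplitz a \<star>
      (\<lambda>i j. (upper_toeplitz (inverse a) \<star> lower_toeplitz b) i j - hankel (inverse a) b i j))"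
    unfolding toeplitz_comm_def lower_upper_toeplitz_commutator[OF r MN] ..
  also have "upper_toeplitz a \<star>
      (\<lambda>i j. (upper_toeplitz (inverse a) \<star> lower_toeplitz b) i j - hankel (inverse a) b i j)
    = (\<lambda>i j. (upper_toeplitz a \<star> (upper_toeplitz (inverse a) \<star> lower_toeplitz b)) i j
        - (upper_toeplitz a \<star> hankel (inverse a) b) i j)"
    by (rule imat_mult_diff_right) (intro rb)+
  also have "upper_toeplitz a \<star> (upper_toeplitz (inverse a) \<star> lower_toeplitz b) = lower_toeplitz b"
    by (simp add: imat_mult_assoc[symmetric] rb upper_toeplitz_mult wiener_inverse[OF a])
  also have "lower_toeplitz (inverse b) \<star>
      (\<lambda>i j. lower_toeplitz b i j - (upper_toeplitz a \<star> hankel (inverse a) b) i j)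
    = (\<lambda>i j. (lower_toeplitz (inverse b) \<star> lower_toeplitz b) i j
        - (lower_toeplitz (inverse b) \<star> (upper_toeplitz a \<star> hankel (inverse a) b)) i j)"
    by (rule imat_mult_diff_right) (intro rb)+
  also have "lower_toeplitz (inverse b) \<star> lower_toeplitz b = imat_id"
    by (simp add: lower_toeplitz_mult wiener_inverse[OF b])
  finally show ?thesis
    by (simp add: toeplitz_rem_def)
qed

lemma norm_toeplitz_rem_le:
  assumes "geo_bounded r A a" "geo_bounded r B (inverse b)"
    and a': "\<And>k. cmod (fps_nth (inverse a) (Suc k)) \<le> M * r ^ Suc k"
    and b: "\<And>k. cmod (fps_nth b (Suc k)) \<le> N * r ^ Suc k"
    and "0 \<le> M" "0 \<le> N"
  shows "cmod (toeplitz_rem a b i j)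
    \<le> B * (A * (M * N / (1 - r)) / (1 - r)) * real (Suc i) * r ^ (i + j)"
  unfolding toeplitz_rem_def norm_minus_cancel
  by (intro norm_lower_toeplitz_mult_le[OF r] norm_upper_toeplitz_mult_le[OF r] norm_hankel_le(2)[OF r] assms)

lemma wiener_toeplitz_rem_bound:
  assumes a: "wiener r a" and b: "wiener r b"
  obtains C where "0 \<le> C" "\<And>i j. cmod (toeplitz_rem a b i j) \<le> C * real (Suc i) * r ^ (i + j)"
proof -
  obtain A M B N where geo: "geo_bounded r A a" "geo_bounded r M (inverse a)"
      "geo_bounded r N b" "geo_bounded r B (inverse b)"
    using a b unfolding wiener_def by blast
  let ?C = "B * (A * (M * N / (1 - r)) / (1 - r))"
  have "cmod (toeplitz_rem a b i j) \<le> ?C * real (Suc i) * r ^ (i + j)" for i j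
    by (rule norm_toeplitz_rem_le)
      (intro geo geo_boundedD[OF geo(2)] geo_boundedD[OF geo(3)] geo_bounded_nonneg[OF geo(2)]
        geo_bounded_nonneg[OF geo(3)])+
  moreover have "0 \<le> ?C"
    using r geo[THEN geo_bounded_nonneg] by simp
  ultimately show thesis using that by blast
qed

lemma toeplitz_comm_rows_bounded:
  assumes "wiener r a" "wiener r b"
  shows "rows_bounded (toeplitz_comm a b)"
  unfolding toeplitz_comm_def
  by (intro rows_bounded_mult wiener_rows_bounded assms)

text \<open>The remainder is absolutely summable over the whole quadrant, so the bound is
  independent of \<open>n\<close>. It keeps null sequences null when they are multiplied by
  determinants.\<close>

lemma tdet_bounded:
  assumes a: "wiener r a" and b: "wiener r b"
  shows "\<exists>B. \<forall>n. cmod (tdet n a b) \<le> B"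
proof -
  obtain C where C: "0 \<le> C" "\<And>i j. cmod (toeplitz_rem a b i j) \<le> C * real (Suc i) * r ^ (i + j)"
    using wiener_toeplitz_rem_bound[OF a b] by blast
  have "cmod (tdet n a b) \<le> exp (C / (1 - r) ^ 3)" for n
  proof -
    have "cmod (tdet n a b) \<le> exp (\<Sum>i<n. \<Sum>j<n. cmod (toeplitz_rem a b i j))"
      unfolding det_corner_toeplitz_comm[OF a b, symmetric] toeplitz_comm_eq[OF a b]
      by (rule det_corner_bound)
    also have "(\<Sum>i<n. \<Sum>j<n. cmod (toeplitz_rem a b i j))
        \<le> (\<Sum>i<n. C / (1 - r) * (real (Suc i) * r ^ i))"
      by (intro sum_mono sum_row_decay_le[OF r] C)
    also have "\<dots> \<le> C / (1 - r) ^ 3"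
      by (rule sum_rows_decay_le[OF r C(1)])
    finally show ?thesis by simp
  qed
  then show ?thesis by blast
qed

text \<open>With \<open>V\<close> and \<open>V'\<close> belonging to \<open>b\<close> and
  \<open>c\<close>, first \<open>V V^-1\<close> and then \<open>U^-1 U\<close> cancel on the
  right-hand side, which leaves \<open>V^-1 V'^-1 U V' V U^-1\<close>. Lower triangular Toeplitz
  matrices commute, so this is the commutator for \<open>b * c\<close>.\<close>

lemma toeplitz_comm_mult:
  assumes a: "wiener r a" and b: "wiener r b" and c: "wiener r c"
  shows "toeplitz_comm a (b * c)
    = lower_toeplitz (inverse b) \<star> (toeplitz_comm a c \<star> (lower_toeplitz b \<star> toeplitz_comm a b))"
proof -
  note rb = wiener_rows_bounded[OF a] wiener_rows_bounded[OF b] wiener_rows_bounded[OF c] rows_bounded_mult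
  have U: "upper_toeplitz (inverse a) \<star> (upper_toeplitz a \<star> X) = X" if "rows_bounded X" for X
    by (simp add: imat_mult_assoc[symmetric] rb that upper_toeplitz_mult wiener_inverse[OF a])
  have L: "lower_toeplitz b \<star> (lower_toeplitz (inverse b) \<star> X) = X" if "rows_bounded X" for X
    by (simp add: imat_mult_assoc[symmetric] rb that lower_toeplitz_mult wiener_inverse[OF b])
  have KG: "toeplitz_comm a c \<star> (lower_toeplitz b \<star> toeplitz_comm a b)
      = lower_toeplitz (inverse c) \<star> (upper_toeplitz a \<star> (lower_toeplitz c \<star>
          (lower_toeplitz b \<star> upper_toeplitz (inverse a))))"
    by (simp add: toeplitz_comm_def imat_mult_assoc rb U L)
  have "lower_toeplitz (inverse b) \<star> (toeplitz_comm a c \<star> (lower_toeplitz b \<star> toeplitz_comm a b))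
      = lower_toeplitz (inverse b) \<star> lower_toeplitz (inverse c)
      \<star> (upper_toeplitz a \<star> (lower_toeplitz c \<star> lower_toeplitz b \<star> upper_toeplitz (inverse a)))"
    unfolding KG by (simp add: imat_mult_assoc rb)
  also have "\<dots> = toeplitz_comm a (b * c)"
    unfolding toeplitz_comm_def lower_toeplitz_mult fps_inverse_mult mult.commute[of c b] ..
  finally show ?thesis ..
qed

text \<open>If truncation were multiplicative in the middle of \<open>toeplitz_comm_mult\<close>,
  equality would hold. The defect comes from the rows of \<open>G\<close> with index at least
  \<open>n\<close>, which the first \<open>n\<close> rows of \<open>K\<close> reach only through
  entries of order \<open>r ^ n\<close>.\<close>

lemma tdet_mult_tendsto:
  assumes a: "wiener r a" and b: "wiener r b" and c: "wiener r c" and bc: "wiener r (b * c)"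
  shows "(\<lambda>n. tdet n a (b * c) - tdet n a b * tdet n a c) \<longlonglongrightarrow> 0"
proof -
  define G where "G = lower_toeplitz b \<star> toeplitz_comm a b"
  define K where "K = toeplitz_comm a c"
  define Lb where "Lb = lower_toeplitz (inverse b)"
  \<comment> \<open>\<open>G1\<close> keeps the first \<open>n\<close> rows of \<open>G\<close>, so
    that the corner of its product with \<open>K\<close> is the product of the corners.
    \<open>G2\<close> is the rest and produces the error \<open>F\<close>.\<close>
  define G1 where "G1 = (\<lambda>n i j. if i < n then G i j else 0)"
  define G2 where "G2 = (\<lambda>n i j. if i < n then 0 else G i j)"
  define F where "F = (\<lambda>n. Lb \<star> (K \<star> G2 n))"
  have rbG: "rows_bounded G"
    unfolding G_def by (intro rows_bounded_mult wiener_rows_bounded b toeplitz_comm_rows_bounded a)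
  have rbK: "rows_bounded K"
    unfolding K_def by (intro toeplitz_comm_rows_bounded a c)
  have rbL: "rows_bounded Lb"
    unfolding Lb_def by (intro wiener_rows_bounded b)
  obtain NG where NG: "0 \<le> NG" "\<And>i j. cmod (G i j) \<le> NG"
    using rows_boundedE[OF rbG] by metis
  obtain M where M: "geo_bounded r M (inverse b)"
    using b unfolding wiener_def by blast
  have M0: "0 \<le> M" using geo_bounded_nonneg[OF M] .
  obtain C where C: "0 \<le> C" "\<And>i j. cmod (toeplitz_rem a c i j) \<le> C * real (Suc i) * r ^ (i + j)"
    using wiener_toeplitz_rem_bound[OF a c] by blast
  obtain C' where C': "0 \<le> C'" "\<And>i j. cmod (toeplitz_rem a (b * c) i j) \<le> C' * real (Suc i) * r ^ (i + j)"
    using wiener_toeplitz_rem_bound[OF a bc] by blast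
  have rbG2: "rows_bounded (G2 n)" for n
  proof -
    obtain N where N: "\<And>i F. finite F \<Longrightarrow> (\<Sum>j\<in>F. cmod (G i j)) \<le> N"
      using rbG unfolding rows_bounded_def by blast
    show ?thesis
    proof (rule rows_boundedI)
      show "(\<Sum>j\<in>F. cmod (G2 n i j)) \<le> N" if "finite F" for i F
        using N[OF that, of i] N[of "{}" i] by (cases "i < n") (auto simp: G2_def)
    qed
  qed
  have G1_eq: "G1 n = (\<lambda>i j. G i j - G2 n i j)" for n
    by (auto simp: G1_def G2_def fun_eq_iff)
  have rbG1: "rows_bounded (G1 n)" for n
    unfolding G1_eq by (intro rows_bounded_diff rbG rbG2)
  have split: "Lb \<star> (K \<star> G1 n) = (\<lambda>i j. toeplitz_comm a (b * c) i j - F n i j)" for n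
  proof -
    have "K \<star> G1 n = (\<lambda>i j. (K \<star> G) i j - (K \<star> G2 n) i j)"
      unfolding G1_eq by (rule imat_mult_diff_right[OF rbK rbG rbG2])
    then have "Lb \<star> (K \<star> G1 n) = (\<lambda>i j. (Lb \<star> (K \<star> G)) i j - (Lb \<star> (K \<star> G2 n)) i j)"
      using imat_mult_diff_right[OF rbL rows_bounded_mult[OF rbK rbG] rows_bounded_mult[OF rbK rbG2]]
      by simp
    then show ?thesis
      unfolding toeplitz_comm_mult[OF a b c] F_def G_def K_def Lb_def .
  qed
  have det1: "Determinant.det (corner n (Lb \<star> (K \<star> G1 n))) = tdet n a b * tdet n a c" for n
  proof -
    have "corner n (K \<star> G1 n) = corner n K * corner n G"
    proof (rule eq_matI)
      fix i j assume ij: "i < dim_row (corner n K * corner n G)" "j < dim_col (corner n K * corner n G)"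
      have "(K \<star> G1 n) i j = (\<Sum>p<n. K i p * G1 n p j)"
        by (rule imat_mult_finite) (auto simp: G1_def)
      also have "\<dots> = (\<Sum>p<n. K i p * G p j)"
        by (simp add: G1_def)
      finally show "corner n (K \<star> G1 n) $$ (i, j) = (corner n K * corner n G) $$ (i, j)"
        using ij by (simp add: corner_mult_index del: index_mult_mat(1))
    qed auto
    then have "corner n (Lb \<star> (K \<star> G1 n)) = corner n Lb *
        (corner n K * (corner n (lower_toeplitz b) * corner n (toeplitz_comm a b)))"
      by (simp add: corner_mult_lower Lb_def G_def)
    then have "Determinant.det (corner n (Lb \<star> (K \<star> G1 n))) = Determinant.det (corner n Lb) *
        (tdet n a c * (Determinant.det (corner n (lower_toeplitz b)) * tdet n a b))"
      by (simp add: det_mult[of _ n] mult_carrier_mat[of _ n n _ n] K_def det_corner_toeplitz_comm a b c)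
    moreover have "Determinant.det (corner n Lb) = 1"
      unfolding Lb_def by (rule det_corner_lower) (use b in \<open>auto simp: wiener_def\<close>)
    moreover have "Determinant.det (corner n (lower_toeplitz b)) = 1"
      by (rule det_corner_lower) (use b in \<open>auto simp: wiener_def\<close>)
    ultimately show ?thesis by simp
  qed
  \<comment> \<open>A bound for \<open>Suc i * r ^ i\<close> at all \<open>i\<close>: one term of a
    nonnegative series is at most its sum.\<close>
  define W where "W = 1 / (1 - r)\<^sup>2"
  have W: "real (Suc i) * r ^ i \<le> W" for i
  proof -
    have "real (Suc i) * r ^ i \<le> (\<Sum>k<Suc i. real (Suc k) * r ^ k)"
      using r by (simp add: sum_nonneg)
    then show ?thesis
      using sum_Suc_geometric_le[OF r, of "Suc i"] unfolding W_def by linarith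
  qed
  have W0: "0 \<le> W" unfolding W_def by simp
  \<comment> \<open>Since \<open>i < n \<le> p\<close> for the rows that matter, the identity part
    of \<open>K\<close> does not meet \<open>G2\<close>, and only the decaying remainder
    counts.\<close>
  have KG2: "cmod ((K \<star> G2 n) i j) \<le> C * W * NG / (1 - r) * r ^ n" if "i < n" for i j n
  proof -
    have "cmod (K i p * G2 n p j) \<le> (C * W * NG) * r ^ p" if p: "n \<le> p" for p
    proof -
      have "cmod (K i p) = cmod (toeplitz_rem a c i p)"
        unfolding K_def toeplitz_comm_eq[OF a c] using p \<open>i < n\<close> by (simp add: imat_id_def)
      also have "\<dots> \<le> C * (real (Suc i) * r ^ i) * r ^ p"
        using C(2)[of i p] by (simp add: power_add mult_ac)
      also have "\<dots> \<le> C * W * r ^ p"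
        by (intro mult_right_mono mult_left_mono W C) (use r in auto)
      finally have "cmod (K i p) * cmod (G2 n p j) \<le> (C * W * r ^ p) * NG"
        by (rule mult_mono) (use r C W0 NG p in \<open>auto simp: G2_def\<close>)
      then show ?thesis by (simp add: norm_mult mult_ac)
    qed
    then have "cmod (\<Sum>\<^sub>\<infinity>p. K i p * G2 n p j) \<le> C * W * NG * r ^ n / (1 - r)"
      by (rule norm_infsum_geometric_le(2)[OF r]) (auto simp: G2_def)
    then show ?thesis by (simp add: imat_mult_def)
  qed
  define D where "D = M / (1 - r) * (C * W * NG / (1 - r))"
  have F: "cmod (F n i j) \<le> D * r ^ n" if "i < n" for i j n
  proof -
    have "F n i j = (\<Sum>p\<le>i. Lb i p * (K \<star> G2 n) p j)"
      unfolding F_def by (rule imat_mult_finite) (auto simp: Lb_def lower_toeplitz_def)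
    also have "cmod \<dots> \<le> (\<Sum>p\<le>i. (M * r ^ (i - p)) * (C * W * NG / (1 - r) * r ^ n))"
      by (intro order_trans[OF norm_sum] sum_mono, unfold norm_mult, intro mult_mono KG2)
        (use that r M0 geo_boundedD[OF M] in \<open>auto simp: Lb_def lower_toeplitz_def\<close>)
    also have "\<dots> = M * (\<Sum>p\<le>i. r ^ (i - p)) * (C * W * NG / (1 - r) * r ^ n)"
      by (simp only: sum_distrib_left sum_distrib_right)
    also have "\<dots> \<le> M * (1 / (1 - r)) * (C * W * NG / (1 - r) * r ^ n)"
      by (intro mult_right_mono mult_left_mono sum_geometric_le r M0)
        (use r C W0 NG in \<open>auto simp: inj_on_def\<close>)
    finally show ?thesis by (simp add: D_def)
  qed
  have D0: "0 \<le> D" unfolding D_def using r C W0 NG M0 by auto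
  define S where "S = C' / (1 - r) ^ 3"
  have bound: "cmod (tdet n a (b * c) - tdet n a b * tdet n a c) \<le> (real n * (real n * (D * r ^ n))) * exp (S + 1)"
    if small: "real n * (real n * (D * r ^ n)) \<le> 1" for n
  proof -
    have "cmod (Determinant.det (corner n (\<lambda>i j. imat_id i j + toeplitz_rem a (b * c) i j + (- F n i j)))
        - Determinant.det (corner n (\<lambda>i j. imat_id i j + toeplitz_rem a (b * c) i j)))
      \<le> real n * (real n * (D * r ^ n)) * exp (S + 1)"
    proof (rule det_corner_perturb_le)
      fix i assume i: "i < n"
      show "(\<Sum>j<n. cmod (toeplitz_rem a (b * c) i j)) \<le> C' / (1 - r) * (real (Suc i) * r ^ i)"
        by (rule sum_row_decay_le[OF r C'(2)])
      have "(\<Sum>j<n. cmod (- F n i j)) \<le> (\<Sum>j<n. D * r ^ n)"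
        using F[OF i] by (intro sum_mono) simp
      then show "(\<Sum>j<n. cmod (- F n i j)) \<le> real n * (D * r ^ n)"
        by simp
    next
      show "(\<Sum>i<n. C' / (1 - r) * (real (Suc i) * r ^ i)) \<le> S"
        unfolding S_def by (rule sum_rows_decay_le[OF r C'(1)])
    qed (fact small)
    moreover have "(\<lambda>i j. imat_id i j + toeplitz_rem a (b * c) i j + (- F n i j)) = Lb \<star> (K \<star> G1 n)"
      unfolding split toeplitz_comm_eq[OF a bc] by simp
    ultimately show ?thesis
      by (simp add: det1 toeplitz_comm_eq[OF a bc, symmetric] det_corner_toeplitz_comm[OF a bc] norm_minus_commute)
  qed
  have lim: "(\<lambda>n. real n * (real n * (D * r ^ n))) \<longlonglongrightarrow> 0"
  proof -
    \<comment> \<open>\<open>n\<^sup>2 * r ^ n\<close> is the square of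
      \<open>n * sqrt r ^ n\<close>, a standard null sequence.\<close>
    have "(\<lambda>n. of_nat n * sqrt r ^ n) \<longlonglongrightarrow> 0"
      by (rule powser_times_n_limit_0) (use r in auto)
    then have "(\<lambda>n. D * ((real n * sqrt r ^ n) * (real n * sqrt r ^ n))) \<longlonglongrightarrow> D * (0 * 0)"
      by (intro tendsto_mult tendsto_const) auto
    moreover have "D * ((real n * sqrt r ^ n) * (real n * sqrt r ^ n)) = real n * (real n * (D * r ^ n))" for n
    proof -
      have "sqrt r ^ n * sqrt r ^ n = r ^ n"
        using r by (simp add: power_mult_distrib[symmetric])
      then show ?thesis by (simp add: mult_ac)
    qed
    ultimately show ?thesis by simp
  qed
  have "(\<lambda>n. (real n * (real n * (D * r ^ n))) * exp (S + 1)) \<longlonglongrightarrow> 0"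
    using tendsto_mult_right[OF lim, of "exp (S + 1)"] by simp
  moreover have "\<forall>\<^sub>F n in sequentially. real n * (real n * (D * r ^ n)) \<le> 1"
    using order_tendstoD(2)[OF lim, of 1] by (auto elim: eventually_mono)
  then have "\<forall>\<^sub>F n in sequentially. norm (tdet n a (b * c) - tdet n a b * tdet n a c)
      \<le> (real n * (real n * (D * r ^ n))) * exp (S + 1)"
    by (rule eventually_mono) (rule bound)
  ultimately show ?thesis
    by (rule Lim_null_comparison[rotated])
qed

end

section \<open>The limit along exponential families\<close>

text \<open>Models the power series \<open>A s\<close> of \<open>exp (s a)\<close>, where \<open>a\<close> vanishes at 0 and \<open>c k\<close> is the coefficient of
  index \<open>Suc k\<close> of \<open>a\<close>.\<close>

definition exp_family :: "real \<Rightarrow> real \<Rightarrow> (nat \<Rightarrow> complex) \<Rightarrow> (real \<Rightarrow> complex fps) \<Rightarrow> bool" where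
  "exp_family r M c A \<longleftrightarrow>
     (\<forall>s t. A (s + t) = A s * A t) \<and> A 0 = 1 \<and> (\<forall>s. fps_nth (A s) 0 = 1) \<and>
     (\<forall>s k. \<bar>s\<bar> \<le> 1 \<longrightarrow> cmod (fps_nth (A s) k) \<le> M * r ^ k) \<and>
     (\<forall>s k. \<bar>s\<bar> \<le> 1 \<longrightarrow> cmod (fps_nth (A s) (Suc k)) \<le> M * \<bar>s\<bar> * r ^ Suc k) \<and>
     (\<forall>s k. \<bar>s\<bar> \<le> 1 \<longrightarrow> cmod (fps_nth (A s) (Suc k) - of_real s * c k) \<le> M * s\<^sup>2 * r ^ Suc k)"

lemma exp_familyD:
  assumes "exp_family r M c A"
  shows "A (s + t) = A s * A t" "A 0 = 1" "fps_nth (A s) 0 = 1"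
    "\<bar>s\<bar> \<le> 1 \<Longrightarrow> geo_bounded r M (A s)"
    "\<bar>s\<bar> \<le> 1 \<Longrightarrow> cmod (fps_nth (A s) (Suc k)) \<le> M * \<bar>s\<bar> * r ^ Suc k"
    "\<bar>s\<bar> \<le> 1 \<Longrightarrow> cmod (fps_nth (A s) (Suc k) - of_real s * c k) \<le> M * s\<^sup>2 * r ^ Suc k"
  using assms unfolding exp_family_def geo_bounded_def by blast+

lemma exp_family_inverse:
  assumes "exp_family r M c A"
  shows "inverse (A s) = A (- s)"
proof -
  have "A s * A (- s) = 1"
    using exp_familyD(1)[OF assms, of s "- s"] exp_familyD(2)[OF assms] by simp
  moreover have "inverse (A s) * A s = 1"
    using exp_familyD(3)[OF assms, of s] by (intro inverse_mult_eq_1) simp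
  ultimately show ?thesis
    by (metis mult.assoc mult.left_neutral mult.right_neutral)
qed

lemma exp_family_wiener:
  assumes "exp_family r M c A" "\<bar>s\<bar> \<le> 1"
  shows "wiener r (A s)"
  unfolding wiener_def exp_family_inverse[OF assms(1)]
  using exp_familyD(3)[OF assms(1)] exp_familyD(4)[OF assms(1)] assms(2) by (metis abs_minus_cancel)

lemma exp_family_nonneg:
  assumes "exp_family r M c A"
  shows "0 \<le> M"
  using exp_familyD(4)[OF assms, of 0] geo_bounded_nonneg by simp

text \<open>At \<open>s = 1\<close> both the coefficient of \<open>A 1\<close> and its distance from
  \<open>c k\<close> are bounded by \<open>M * r ^ Suc k\<close>, hence the 2.\<close>

lemma exp_family_coeff_le:
  assumes "exp_family r M c A"
  shows "cmod (c k) \<le> 2 * M * r ^ Suc k"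
proof -
  have "cmod (c k) \<le> cmod (fps_nth (A 1) (Suc k)) + cmod (fps_nth (A 1) (Suc k) - of_real 1 * c k)"
    using norm_triangle_ineq4[of "fps_nth (A 1) (Suc k)" "fps_nth (A 1) (Suc k) - of_real 1 * c k"] by simp
  also have "\<dots> \<le> M * r ^ Suc k + M * r ^ Suc k"
    using exp_familyD(5,6)[OF assms, of 1 k] by (intro add_mono) simp_all
  finally show ?thesis by simp
qed

text \<open>The exponent is built up in steps of \<open>1 / m\<close>, each of which adds a null
  sequence and multiplies the earlier error by a bounded factor; as \<open>m\<close> is fixed, the
  total is null. All intermediate exponents lie in the unit interval, where
  \<open>exp_family\<close> provides its bounds.\<close>

lemma tdet_power_tendsto:
  assumes r: "0 \<le> r" "r < 1" and a: "wiener r a" and B: "exp_family r M c B" and m: "0 < m"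
  shows "(\<lambda>n. tdet n a (B 1) - tdet n a (B (1 / real m)) ^ m) \<longlonglongrightarrow> 0"
proof -
  let ?b = "B (1 / real m)"
  have w: "wiener r (B (real k / real m))" if "k \<le> m" for k
    by (rule exp_family_wiener[OF B]) (use that m in simp)
  have w1: "wiener r ?b"
    by (rule exp_family_wiener[OF B]) (use m in simp)
  obtain N where N: "\<And>n. cmod (tdet n a ?b) \<le> N"
    using tdet_bounded[OF r a w1] by blast
  have "(\<lambda>n. tdet n a (B (real k / real m)) - tdet n a ?b ^ k) \<longlonglongrightarrow> 0" if "k \<le> m" for k
    using that
  proof (induction k)
    case 0
    have "tdet n a 1 = 1" for n
    proof -
      have "Determinant.det (corner n (upper_toeplitz a)) = 1"
        by (rule det_corner_upper) (use a in \<open>auto simp: wiener_def\<close>)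
      then show ?thesis by (simp add: tdet_def)
    qed
    then show ?case by (simp add: exp_familyD(2)[OF B])
  next
    case (Suc k)
    let ?bk = "B (real k / real m)"
    have eq: "B (real (Suc k) / real m) = ?bk * ?b"
      by (simp add: exp_familyD(1)[OF B, symmetric] add_divide_distrib add.commute)
    have "(\<lambda>n. (tdet n a (?bk * ?b) - tdet n a ?bk * tdet n a ?b)
        + (tdet n a ?bk - tdet n a ?b ^ k) * tdet n a ?b) \<longlonglongrightarrow> 0 + 0"
    proof (intro tendsto_add)
      show "(\<lambda>n. tdet n a (?bk * ?b) - tdet n a ?bk * tdet n a ?b) \<longlonglongrightarrow> 0"
        using tdet_mult_tendsto[OF r a w w1] w[OF Suc.prems] Suc.prems unfolding eq by simp
      have "(\<lambda>n. tdet n a ?bk - tdet n a ?b ^ k) \<longlonglongrightarrow> 0"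
        using Suc by simp
      then show "(\<lambda>n. (tdet n a ?bk - tdet n a ?b ^ k) * tdet n a ?b) \<longlonglongrightarrow> 0"
        by (rule lim_null_mult_right_bounded[where B = N]) (simp add: N)
    qed
    then show ?case unfolding eq by (simp add: algebra_simps)
  qed
  from this[of m] show ?thesis using m by simp
qed

lemma power_double: "(x :: real) ^ (2 * n) = x ^ n * x ^ n" "x ^ (n * 2) = x ^ n * x ^ n"
  by (simp_all add: power_add[symmetric] mult_2 mult_2_right)

lemma norm_power_diff_le:
  fixes z w :: complex
  assumes "cmod z \<le> R" "cmod w \<le> R" "1 \<le> R"
  shows "cmod (z ^ n - w ^ n) \<le> real n * R ^ n * cmod (z - w)"
proof (induction n)
  case (Suc n)
  have "cmod (z ^ Suc n - w ^ Suc n) = cmod (z * (z ^ n - w ^ n) + (z - w) * w ^ n)"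
    by (simp add: algebra_simps)
  also have "\<dots> \<le> cmod z * cmod (z ^ n - w ^ n) + cmod (z - w) * cmod w ^ n"
    by (rule order_trans[OF norm_triangle_ineq]) (simp add: norm_mult norm_power)
  also have "\<dots> \<le> R * (real n * R ^ n * cmod (z - w)) + cmod (z - w) * R ^ Suc n"
  proof (intro add_mono mult_mono Suc.IH assms)
    have "cmod w ^ n \<le> R ^ n" using assms by (intro power_mono) auto
    also have "R ^ n \<le> R ^ Suc n" using assms by (intro power_increasing) auto
    finally show "cmod w ^ n \<le> R ^ Suc n" .
  qed (use assms in auto)
  finally show ?case by (simp add: algebra_simps)
qed simp

text \<open>Shift the exponential series by two and compare \<open>fact (n + 2)\<close> with
  \<open>fact n\<close>. The type covers both the complex exponents and the real majorants.\<close>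

lemma norm_exp_first_order_le:
  fixes z :: "'a :: {real_normed_field, banach}"
  shows "norm (exp z - 1 - z) \<le> (norm z)\<^sup>2 * exp (norm z)"
proof -
  have s: "(\<lambda>n. z ^ (n + 2) /\<^sub>R fact (n + 2)) sums (exp z - 1 - z)"
    using sums_iff_shift[of "\<lambda>n. z ^ n /\<^sub>R fact n" 2 "exp z - 1 - z"] exp_converges[of z]
    by (simp add: numeral_2_eq_2 algebra_simps)
  have le: "norm (z ^ (n + 2) /\<^sub>R fact (n + 2)) \<le> (norm z)\<^sup>2 * (norm z ^ n /\<^sub>R fact n)" for n
  proof -
    have "norm z ^ (n + 2) / fact (n + 2) \<le> norm z ^ (n + 2) / fact n"
      by (intro divide_left_mono fact_mono) auto
    moreover have "norm (z ^ (n + 2) /\<^sub>R fact (n + 2)) = norm z ^ (n + 2) / fact (n + 2)"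
      by (simp add: norm_power divide_inverse mult.commute del: fact_Suc add_2_eq_Suc')
    moreover have "(norm z)\<^sup>2 * (norm z ^ n /\<^sub>R fact n) = norm z ^ (n + 2) / fact n"
      by (simp add: power_add divide_inverse mult_ac del: add_2_eq_Suc')
    ultimately show ?thesis by simp
  qed
  have e: "(\<lambda>n. (norm z)\<^sup>2 * (norm z ^ n /\<^sub>R fact n)) sums ((norm z)\<^sup>2 * exp (norm z))"
    by (intro sums_mult exp_converges)
  have "norm (exp z - 1 - z) \<le> (\<Sum>n. (norm z)\<^sup>2 * (norm z ^ n /\<^sub>R fact n))"
    unfolding sums_unique[OF s] by (rule norm_suminf_le[OF le sums_summable[OF e]])
  then show ?thesis using sums_unique[OF e] by simp
qed

section \<open>Second-order expansion for small exponents and passage to the limit\<close>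

context
  fixes r M :: real and c d :: "nat \<Rightarrow> complex" and A B :: "real \<Rightarrow> complex fps"
  assumes r: "0 \<le> r" "r < 1" and A: "exp_family r M c A" and B: "exp_family r M d B"
begin

text \<open>The \<open>i\<close>-th diagonal entry of the product of the Hankel matrices of
  \<open>a\<close> and \<open>b\<close>. Its partial sums are the \<open>c\<^sub>n\<close> of the
  overview.\<close>

definition diag_sum :: "nat \<Rightarrow> complex" where
  "diag_sum i = (\<Sum>\<^sub>\<infinity>q. c (i + q) * d (i + q))"

lemma norm_coeff_product_le: "cmod (c (i + q) * d (i + q)) \<le> (4 * M\<^sup>2 * r ^ (2 * i)) * r ^ q"
proof -
  have "cmod (c (i + q) * d (i + q)) \<le> (2 * M * r ^ Suc (i + q)) * (2 * M * r ^ Suc (i + q))"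
    unfolding norm_mult
    by (intro mult_mono exp_family_coeff_le[OF A] exp_family_coeff_le[OF B])
      (use r exp_family_nonneg[OF A] in auto)
  also have "\<dots> = (4 * M\<^sup>2 * r ^ (2 * i) * r ^ q) * r ^ (q + 2)"
    by (simp add: power_add power2_eq_square power_double mult_ac)
  also have "\<dots> \<le> (4 * M\<^sup>2 * r ^ (2 * i) * r ^ q) * 1"
    by (intro mult_left_mono power_le_one) (use r in auto)
  finally show ?thesis by simp
qed

lemma diag_sum_summable: "summable (\<lambda>q. cmod (c (i + q) * d (i + q)))"
  by (rule norm_infsum_geometric_le(1)[OF r, where n = 0]) (use norm_coeff_product_le in auto)

lemma norm_diag_sum_le: "cmod (diag_sum i) \<le> 4 * M\<^sup>2 / (1 - r) * r ^ i"
proof -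
  have "cmod (diag_sum i) \<le> 4 * M\<^sup>2 * r ^ (2 * i) / (1 - r)"
    unfolding diag_sum_def using norm_infsum_geometric_le(2)[OF r, where n = 0, OF norm_coeff_product_le] by simp
  also have "\<dots> \<le> 4 * M\<^sup>2 * r ^ i / (1 - r)"
    by (intro divide_right_mono mult_left_mono power_decreasing) (use r in auto)
  finally show ?thesis by simp
qed

text \<open>The product \<open>c k * d k\<close> occurs in \<open>diag_sum i\<close> exactly for
  \<open>i \<le> k\<close>, thus \<open>Suc k\<close> times among \<open>i < n\<close> when
  \<open>k < n\<close>, and \<open>n\<close> times otherwise. The weight in the limit originates
  here.\<close>

lemma sum_diag_sum: "(\<Sum>i<n. diag_sum i) = of_nat n * diag_sum n + (\<Sum>i<n. of_nat (Suc i) * (c i * d i))"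
proof (induction n)
  case (Suc n)
  have "diag_sum n = diag_sum (Suc n) + c n * d n"
    unfolding diag_sum_def infsum_eq_suminf_norm[OF diag_sum_summable]
    using suminf_split_head[OF summable_norm_cancel[OF diag_sum_summable[of n]]] by simp
  then show ?case using Suc by (simp add: algebra_simps)
qed simp

lemma norm_sum_diag_sum_le: "cmod (\<Sum>i<n. diag_sum i) \<le> 4 * M\<^sup>2 / (1 - r)\<^sup>2"
proof -
  have "cmod (\<Sum>i<n. diag_sum i) \<le> (\<Sum>i<n. 4 * M\<^sup>2 / (1 - r) * r ^ i)"
    by (intro order_trans[OF norm_sum] sum_mono norm_diag_sum_le)
  also have "\<dots> = 4 * M\<^sup>2 / (1 - r) * (\<Sum>i<n. r ^ i)"
    by (rule sum_distrib_left[symmetric])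
  also have "\<dots> \<le> 4 * M\<^sup>2 / (1 - r) * (1 / (1 - r))"
    by (intro mult_left_mono sum_geometric_le) (use r in auto)
  finally show ?thesis by (simp add: power2_eq_square)
qed

lemma summable_Suc_mult: "summable (\<lambda>i. of_nat (Suc i) * (c i * d i))"
proof (rule summable_comparison_test')
  show "summable (\<lambda>i. 4 * M\<^sup>2 * (real (Suc i) * r ^ i))"
    using geometric_deriv_sums[of r] r by (intro summable_mult) (auto simp: sums_iff)
  show "norm (of_nat (Suc n) * (c n * d n)) \<le> 4 * M\<^sup>2 * (real (Suc n) * r ^ n)" for n
    using mult_left_mono[OF norm_coeff_product_le[of 0 n], of "real (Suc n)"]
    by (simp add: norm_mult mult_ac del: of_nat_Suc)
qed

lemma sum_diag_sum_tendsto: "(\<lambda>n. \<Sum>i<n. diag_sum i) \<longlonglongrightarrow> (\<Sum>i. of_nat (Suc i) * (c i * d i))"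
proof -
  have "(\<lambda>n. of_nat n * diag_sum n) \<longlonglongrightarrow> 0"
  proof (rule Lim_null_comparison)
    show "\<forall>\<^sub>F n in sequentially. norm (of_nat n * diag_sum n) \<le> 4 * M\<^sup>2 / (1 - r) * (of_nat n * r ^ n)"
      using mult_left_mono[OF norm_diag_sum_le] by (auto simp: norm_mult mult_ac)
    have "(\<lambda>n. 4 * M\<^sup>2 / (1 - r) * (of_nat n * r ^ n)) \<longlonglongrightarrow> 4 * M\<^sup>2 / (1 - r) * 0"
      by (intro tendsto_mult_left powser_times_n_limit_0) (use r in simp)
    then show "(\<lambda>n. 4 * M\<^sup>2 / (1 - r) * (of_nat n * r ^ n)) \<longlonglongrightarrow> 0" by simp
  qed
  then have "(\<lambda>n. of_nat n * diag_sum n + (\<Sum>i<n. of_nat (Suc i) * (c i * d i)))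
      \<longlonglongrightarrow> 0 + (\<Sum>i. of_nat (Suc i) * (c i * d i))"
    by (intro tendsto_add summable_LIMSEQ summable_Suc_mult)
  then show ?thesis by (simp add: sum_diag_sum)
qed

text \<open>Each of the two Hankel factors contributes one power of \<open>s\<close>. The fourth
  power of \<open>M\<close> comes from these two and the two outer Toeplitz matrices.\<close>

lemma toeplitz_rem_le:
  assumes s: "0 \<le> s" "s \<le> 1"
  shows "cmod (toeplitz_rem (A s) (B s) i j) \<le> M ^ 4 / (1 - r)\<^sup>2 * s\<^sup>2 * real (Suc i) * r ^ (i + j)"
proof -
  have "cmod (toeplitz_rem (A s) (B s) i j)
      \<le> M * (M * ((M * s) * (M * s) / (1 - r)) / (1 - r)) * real (Suc i) * r ^ (i + j)"
    by (rule norm_toeplitz_rem_le[OF r], unfold exp_family_inverse[OF A] exp_family_inverse[OF B])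
      (use exp_familyD(4)[OF A, of s] exp_familyD(4)[OF B, of "- s"] exp_familyD(5)[OF A, of "- s"]
        exp_familyD(5)[OF B, of s] exp_family_nonneg[OF A] s in auto)
  then show ?thesis
    using s by (simp add: power2_eq_square power4_eq_xxxx mult_ac)
qed

text \<open>With \<open>U\<close> and \<open>V\<close> belonging to \<open>A s\<close> and
  \<open>B s\<close>, the sum equals \<open>- (V^-1 - 1) U H - (U - 1) H\<close>. The two
  differences have no constant coefficient and are of order \<open>s\<close>, while \<open>H\<close>
  is of order \<open>s\<^sup>2\<close>.\<close>

lemma toeplitz_rem_hankel:
  assumes s: "0 \<le> s" "s \<le> 1"
  shows "cmod (toeplitz_rem (A s) (B s) i j + hankel (A (- s)) (B s) i j)
    \<le> (M ^ 4 / (1 - r)\<^sup>2 + M ^ 3 / (1 - r)\<^sup>2) * s ^ 3 * real (Suc i) * r ^ (i + j)"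
proof -
  define H where "H = hankel (A (- s)) (B s)"
  define Y where "Y = upper_toeplitz (A s) \<star> H"
  let ?h = "M * s * (M * s) / (1 - r)"
  have M: "0 \<le> M" by (rule exp_family_nonneg[OF A])
  have s': "\<bar>s\<bar> \<le> 1" "\<bar>- s\<bar> \<le> 1" using s by auto
  have H: "cmod (H i j) \<le> ?h * r ^ (i + j)" for i j
    unfolding H_def
    by (rule norm_hankel_le(2)[OF r])
      (use exp_familyD(5)[OF A s'(2)] exp_familyD(5)[OF B s'(1)] s M in auto)
  have Y: "cmod (Y i j) \<le> M * ?h / (1 - r) * r ^ (i + j)" for i j
    unfolding Y_def by (rule norm_upper_toeplitz_mult_le[OF r exp_familyD(4)[OF A s'(1)] H])
  have rbH: "rows_bounded H" and rbY: "rows_bounded Y"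
    by (rule rows_bounded_decay[OF r H], rule rows_bounded_decay[OF r Y])
  have g1: "geo_bounded r (M * s) (A s - 1)" "geo_bounded r (M * s) (B (- s) - 1)"
  proof -
    have "cmod (fps_nth (A s - 1) k) \<le> M * s * r ^ k" for k
      using exp_familyD(5)[OF A s'(1), of "k - 1"] exp_familyD(3)[OF A, of s] s M by (cases k) auto
    moreover have "cmod (fps_nth (B (- s) - 1) k) \<le> M * s * r ^ k" for k
      using exp_familyD(5)[OF B s'(2), of "k - 1"] exp_familyD(3)[OF B, of "- s"] s M by (cases k) auto
    ultimately show "geo_bounded r (M * s) (A s - 1)" "geo_bounded r (M * s) (B (- s) - 1)"
      by (simp_all add: geo_bounded_def)
  qed
  have "upper_toeplitz (A s - 1) = (\<lambda>i j. upper_toeplitz (A s) i j - imat_id i j)"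
    by (auto simp: upper_toeplitz_def imat_id_def fun_eq_iff)
  then have Y1: "(upper_toeplitz (A s - 1) \<star> H) i j = Y i j - H i j" for i j
    using imat_mult_diff_left[OF rows_bounded_upper_toeplitz[OF r exp_familyD(4)[OF A s'(1)]] rows_bounded_id rbH]
    by (simp add: Y_def)
  have "lower_toeplitz (B (- s) - 1) = (\<lambda>i j. lower_toeplitz (B (- s)) i j - imat_id i j)"
    by (auto simp: lower_toeplitz_def imat_id_def fun_eq_iff)
  then have L1: "(lower_toeplitz (B (- s) - 1) \<star> Y) i j = (lower_toeplitz (B (- s)) \<star> Y) i j - Y i j" for i j
    using imat_mult_diff_left[OF rows_bounded_lower_toeplitz[OF r exp_familyD(4)[OF B s'(2)]] rows_bounded_id rbY]
    by simp
  have "toeplitz_rem (A s) (B s) i j + H i j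
      = - ((lower_toeplitz (B (- s) - 1) \<star> Y) i j + (upper_toeplitz (A s - 1) \<star> H) i j)"
    unfolding L1 Y1
    by (simp add: toeplitz_rem_def exp_family_inverse[OF A] exp_family_inverse[OF B] Y_def H_def)
  then have "cmod (toeplitz_rem (A s) (B s) i j + H i j)
      \<le> cmod ((lower_toeplitz (B (- s) - 1) \<star> Y) i j) + cmod ((upper_toeplitz (A s - 1) \<star> H) i j)"
    by (simp only: norm_minus_cancel norm_triangle_ineq)
  also have "\<dots> \<le> M * s * (M * ?h / (1 - r)) * real (Suc i) * r ^ (i + j) + M * s * ?h / (1 - r) * r ^ (i + j)"
    by (intro add_mono norm_lower_toeplitz_mult_le[OF r g1(2) Y] norm_upper_toeplitz_mult_le[OF r g1(1) H])
  also have "M * s * ?h / (1 - r) * r ^ (i + j) \<le> M * s * ?h / (1 - r) * r ^ (i + j) * real (Suc i)"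
    using mult_left_mono[of 1 "real (Suc i)" "M * s * ?h / (1 - r) * r ^ (i + j)"] M s r by simp
  also have "M * s * (M * ?h / (1 - r)) * real (Suc i) * r ^ (i + j)
      + M * s * ?h / (1 - r) * r ^ (i + j) * real (Suc i)
    = (M ^ 4 / (1 - r)\<^sup>2 + M ^ 3 / (1 - r)\<^sup>2) * s ^ 3 * real (Suc i) * r ^ (i + j)"
    by (simp add: power2_eq_square power3_eq_cube power4_eq_xxxx algebra_simps)
  finally show ?thesis by (simp add: H_def)
qed

text \<open>To first order the coefficients of \<open>A (- s)\<close> and \<open>B s\<close> are
  \<open>- s * c k\<close> and \<open>s * d k\<close>, whence the plus sign.\<close>

lemma hankel_diag_sum_approx:
  assumes s: "0 \<le> s" "s \<le> 1"
  shows "cmod (hankel (A (- s)) (B s) i i + of_real (s\<^sup>2) * diag_sum i) \<le> 3 * M\<^sup>2 / (1 - r) * s ^ 3 * r ^ (2 * i)"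
proof -
  have M: "0 \<le> M" by (rule exp_family_nonneg[OF A])
  have s': "\<bar>s\<bar> \<le> 1" "\<bar>- s\<bar> \<le> 1" using s by auto
  let ?u = "\<lambda>q. fps_nth (B s) (Suc (i + q)) * fps_nth (A (- s)) (Suc (i + q))"
  let ?v = "\<lambda>q. c (i + q) * d (i + q)"
  have le: "cmod (?u q + of_real (s\<^sup>2) * ?v q) \<le> (3 * M\<^sup>2 * s ^ 3 * r ^ (2 * i)) * r ^ q" for q
  proof -
    let ?k = "i + q"
    let ?a = "fps_nth (A (- s)) (Suc ?k)" and ?b = "fps_nth (B s) (Suc ?k)"
    \<comment> \<open>One coefficient is linearised at a time. The two summands are bounded by
      multiples 1 and 2 of \<open>M\<^sup>2 * s ^ 3\<close>, hence the constant 3.\<close>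
    have "?u q + of_real (s\<^sup>2) * ?v q
        = ?b * (?a - of_real (- s) * c ?k) - of_real s * c ?k * (?b - of_real s * d ?k)"
      by (simp add: algebra_simps power2_eq_square)
    also have "cmod \<dots> \<le> cmod ?b * cmod (?a - of_real (- s) * c ?k)
        + s * cmod (c ?k) * cmod (?b - of_real s * d ?k)"
      using s by (intro order_trans[OF norm_triangle_ineq4]) (simp add: norm_mult)
    also have "\<dots> \<le> (M * \<bar>s\<bar> * r ^ Suc ?k) * (M * (- s)\<^sup>2 * r ^ Suc ?k)
        + s * (2 * M * r ^ Suc ?k) * (M * s\<^sup>2 * r ^ Suc ?k)"
      by (intro add_mono mult_mono exp_familyD(5)[OF B s'(1)] exp_familyD(6)[OF A s'(2)]
          exp_familyD(6)[OF B s'(1)] exp_family_coeff_le[OF A] mult_nonneg_nonneg M s)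
        (use r in auto)
    also have "\<dots> = (3 * M\<^sup>2 * s ^ 3 * r ^ (2 * i) * r ^ q) * r ^ (q + 2)"
      using s by (simp add: power_add power2_eq_square power3_eq_cube power_double mult_ac)
    also have "\<dots> \<le> (3 * M\<^sup>2 * s ^ 3 * r ^ (2 * i) * r ^ q) * 1"
      by (intro mult_left_mono power_le_one) (use r s in auto)
    finally show ?thesis by simp
  qed
  have su: "summable (\<lambda>q. cmod (?u q))"
    by (rule norm_hankel_le(1)[OF r, where M = "M * s" and N = "M * s"])
      (use exp_familyD(5)[OF A s'(2)] exp_familyD(5)[OF B s'(1)] M s in auto)
  have "hankel (A (- s)) (B s) i i + of_real (s\<^sup>2) * diag_sum i = (\<Sum>q. ?u q + of_real (s\<^sup>2) * ?v q)"
    unfolding hankel_def diag_sum_def infsum_eq_suminf_norm[OF diag_sum_summable] infsum_eq_suminf_norm[OF su]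
    by (subst suminf_add[symmetric])
      (intro summable_norm_cancel[OF su] summable_mult summable_norm_cancel[OF diag_sum_summable]
        arg_cong2[where f = "(+)"] refl suminf_mult[symmetric])+
  also have "\<dots> = (\<Sum>\<^sub>\<infinity>q. ?u q + of_real (s\<^sup>2) * ?v q)"
    by (rule infsum_eq_suminf_norm[symmetric], rule norm_infsum_geometric_le(1)[OF r, where n = 0])
      (use le in auto)
  also have "cmod \<dots> \<le> 3 * M\<^sup>2 * s ^ 3 * r ^ (2 * i) / (1 - r)"
    using norm_infsum_geometric_le(2)[OF r, where n = 0, OF le] by simp
  finally show ?thesis by (simp add: mult_ac)
qed

text \<open>The trace of the remainder supplies the second-order term. The second bound is what
  keeps \<open>m\<^sup>2\<close>-th powers bounded when \<open>s = 1 / m\<close>.\<close>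

lemma tdet_small:
  obtains C where "0 \<le> C"
    "\<And>s n. 0 \<le> s \<Longrightarrow> s \<le> 1 \<Longrightarrow> cmod (tdet n (A s) (B s) - 1 - of_real (s\<^sup>2) * (\<Sum>i<n. diag_sum i)) \<le> C * s ^ 3"
    "\<And>s n. 0 \<le> s \<Longrightarrow> s \<le> 1 \<Longrightarrow> cmod (tdet n (A s) (B s)) \<le> exp (C * s\<^sup>2)"
proof -
  have M: "0 \<le> M" by (rule exp_family_nonneg[OF A])
  define C1 where "C1 = M ^ 4 / (1 - r)\<^sup>2"
  define C2 where "C2 = C1 / (1 - r) ^ 3"
  define C3 where "C3 = C1 + M ^ 3 / (1 - r)\<^sup>2 + 3 * M\<^sup>2 / (1 - r)"
  define C4 where "C4 = C3 / (1 - r)\<^sup>2"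
  have C: "0 \<le> C1" "0 \<le> C2" "0 \<le> C3" "0 \<le> C4"
    using M r by (auto simp: C1_def C2_def C3_def C4_def)
  have main: "cmod (tdet n (A s) (B s) - 1 - of_real (s\<^sup>2) * (\<Sum>i<n. diag_sum i)) \<le> (C2\<^sup>2 * exp C2 + C4) * s ^ 3"
      "cmod (tdet n (A s) (B s)) \<le> exp (C2 * s\<^sup>2)"
    if s: "0 \<le> s" "s \<le> 1" for s n
  proof -
    have w: "wiener r (A s)" "wiener r (B s)"
      using s by (auto intro: exp_family_wiener[OF A] exp_family_wiener[OF B])
    let ?D = "toeplitz_rem (A s) (B s)"
    define x where "x = (\<Sum>i<n. \<Sum>j<n. cmod (?D i j))"
    have x0: "0 \<le> x" unfolding x_def by (intro sum_nonneg) auto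
    have D: "cmod (?D i j) \<le> C1 * s\<^sup>2 * real (Suc i) * r ^ (i + j)" for i j
      using toeplitz_rem_le[OF s] unfolding C1_def by simp
    have "x \<le> (\<Sum>i<n. C1 * s\<^sup>2 / (1 - r) * (real (Suc i) * r ^ i))"
      unfolding x_def by (intro sum_mono sum_row_decay_le[OF r] D)
    also have "\<dots> \<le> C1 * s\<^sup>2 / (1 - r) ^ 3"
      by (rule sum_rows_decay_le[OF r]) (use C in simp)
    finally have x: "x \<le> C2 * s\<^sup>2" by (simp add: C2_def)
    have td: "tdet n (A s) (B s) = Determinant.det (corner n (\<lambda>i j. imat_id i j + ?D i j))"
      by (simp add: det_corner_toeplitz_comm[OF r w, symmetric] toeplitz_comm_eq[OF r w])
    show "cmod (tdet n (A s) (B s)) \<le> exp (C2 * s\<^sup>2)"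
      using det_corner_bound[of n ?D] x unfolding td x_def[symmetric] by (meson exp_le_cancel_iff order_trans)
    have s2: "s\<^sup>2 \<le> 1" using s by (simp add: power_le_one)
    have xC: "x \<le> C2"
      using x mult_left_mono[OF s2 C(2)] by simp
    have 1: "cmod (tdet n (A s) (B s) - 1 - (\<Sum>i<n. ?D i i)) \<le> C2\<^sup>2 * exp C2 * s ^ 3"
    proof -
      have "cmod (tdet n (A s) (B s) - 1 - (\<Sum>i<n. ?D i i)) \<le> exp x - 1 - x"
        unfolding td x_def by (rule det_corner_first_order)
      also have "\<dots> \<le> x\<^sup>2 * exp x"
        using norm_exp_first_order_le[of x] x0 by simp
      also have "\<dots> \<le> (C2 * s\<^sup>2)\<^sup>2 * exp C2"
        by (intro mult_mono power_mono) (use x x0 xC in auto)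
      also have "\<dots> = C2\<^sup>2 * exp C2 * s ^ 3 * s"
        by (simp add: power2_eq_square power3_eq_cube mult_ac)
      also have "\<dots> \<le> C2\<^sup>2 * exp C2 * s ^ 3 * 1"
        by (intro mult_left_mono) (use s C in auto)
      finally show ?thesis by simp
    qed
    have 2: "cmod ((\<Sum>i<n. ?D i i) - of_real (s\<^sup>2) * (\<Sum>i<n. diag_sum i)) \<le> C4 * s ^ 3"
    proof -
      have row: "cmod (?D i i - of_real (s\<^sup>2) * diag_sum i) \<le> C3 * s ^ 3 * (real (Suc i) * r ^ i)" for i
      proof -
        let ?H = "hankel (A (- s)) (B s) i i"
        have "?D i i - of_real (s\<^sup>2) * diag_sum i = (?D i i + ?H) - (?H + of_real (s\<^sup>2) * diag_sum i)"
          by simp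
        also have "cmod \<dots> \<le> cmod (?D i i + ?H) + cmod (?H + of_real (s\<^sup>2) * diag_sum i)"
          by (rule norm_triangle_ineq4)
        also have "\<dots> \<le> (C1 + M ^ 3 / (1 - r)\<^sup>2) * s ^ 3 * real (Suc i) * r ^ (i + i)
            + 3 * M\<^sup>2 / (1 - r) * s ^ 3 * r ^ (2 * i)"
          unfolding C1_def by (intro add_mono toeplitz_rem_hankel hankel_diag_sum_approx s)
        also have "\<dots> \<le> (C1 + M ^ 3 / (1 - r)\<^sup>2) * s ^ 3 * real (Suc i) * r ^ i
            + 3 * M\<^sup>2 / (1 - r) * s ^ 3 * (real (Suc i) * r ^ i)"
        proof (intro add_mono mult_left_mono)
          show "r ^ (i + i) \<le> r ^ i" using r by (intro power_decreasing) auto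
          have "r ^ (2 * i) \<le> 1 * r ^ i" using r by (auto intro: power_decreasing)
          also have "\<dots> \<le> real (Suc i) * r ^ i" using r by (intro mult_right_mono) auto
          finally show "r ^ (2 * i) \<le> real (Suc i) * r ^ i" .
        qed (use s C M r in auto)
        also have "\<dots> = C3 * s ^ 3 * (real (Suc i) * r ^ i)"
          by (simp add: C3_def algebra_simps)
        finally show ?thesis .
      qed
      have "(\<Sum>i<n. ?D i i) - of_real (s\<^sup>2) * (\<Sum>i<n. diag_sum i) = (\<Sum>i<n. ?D i i - of_real (s\<^sup>2) * diag_sum i)"
        by (simp add: sum_subtractf sum_distrib_left)
      also have "cmod \<dots> \<le> (\<Sum>i<n. C3 * s ^ 3 * (real (Suc i) * r ^ i))"
        by (intro order_trans[OF norm_sum] sum_mono row)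
      also have "\<dots> = C3 * s ^ 3 * (\<Sum>i<n. real (Suc i) * r ^ i)"
        by (rule sum_distrib_left[symmetric])
      also have "\<dots> \<le> C3 * s ^ 3 * (1 / (1 - r)\<^sup>2)"
        by (intro mult_left_mono sum_Suc_geometric_le r) (use C s in auto)
      finally show ?thesis by (simp add: C4_def)
    qed
    show "cmod (tdet n (A s) (B s) - 1 - of_real (s\<^sup>2) * (\<Sum>i<n. diag_sum i)) \<le> (C2\<^sup>2 * exp C2 + C4) * s ^ 3"
      using norm_triangle_le[OF add_mono[OF 1 2]] by (simp add: distrib_right algebra_simps)
  qed
  define C where "C = C2\<^sup>2 * exp C2 + C4 + C2"
  show thesis
  proof
    show "0 \<le> C" using C by (simp add: C_def)
    fix s :: real and n assume s: "0 \<le> s" "s \<le> 1"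
    show "cmod (tdet n (A s) (B s) - 1 - of_real (s\<^sup>2) * (\<Sum>i<n. diag_sum i)) \<le> C * s ^ 3"
      by (rule order_trans[OF main(1)[OF s] mult_right_mono]) (use C s in \<open>auto simp: C_def\<close>)
    have "C2 * s\<^sup>2 \<le> C * s\<^sup>2" by (rule mult_right_mono) (use C in \<open>auto simp: C_def\<close>)
    then show "cmod (tdet n (A s) (B s)) \<le> exp (C * s\<^sup>2)"
      using main(2)[OF s, of n] by (meson exp_le_cancel_iff order_trans)
  qed
qed

text \<open>Both bases have modulus at most \<open>exp ((C + E) / m\<^sup>2)\<close>, so raising to
  the power costs only a factor \<open>exp (C + E)\<close>. The remaining factor
  \<open>m\<^sup>2\<close> from the difference of powers meets a distance of order
  \<open>m^-3\<close> between the bases.\<close>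

lemma tdet_root_power:
  obtains C where "0 \<le> C" "\<And>m n. 0 < m \<Longrightarrow>
    cmod (tdet n (A (1 / real m)) (B (1 / real m)) ^ (m * m) - exp (\<Sum>i<n. diag_sum i)) \<le> C / real m"
proof -
  obtain C where C: "0 \<le> C"
    "\<And>s n. 0 \<le> s \<Longrightarrow> s \<le> 1 \<Longrightarrow> cmod (tdet n (A s) (B s) - 1 - of_real (s\<^sup>2) * (\<Sum>i<n. diag_sum i)) \<le> C * s ^ 3"
    "\<And>s n. 0 \<le> s \<Longrightarrow> s \<le> 1 \<Longrightarrow> cmod (tdet n (A s) (B s)) \<le> exp (C * s\<^sup>2)"
    using tdet_small by blast
  define E where "E = 4 * M\<^sup>2 / (1 - r)\<^sup>2"
  have E: "0 \<le> E" using r by (simp add: E_def)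
  define K where "K = exp (C + E) * (C + E\<^sup>2 * exp E)"
  show thesis
  proof
    show "0 \<le> K" using C E by (simp add: K_def)
    fix m n :: nat assume m: "0 < m"
    let ?s = "1 / real m" and ?h = "\<Sum>i<n. diag_sum i"
    let ?z = "tdet n (A ?s) (B ?s)" and ?w = "exp (of_real (?s\<^sup>2) * ?h)"
    have s: "0 \<le> ?s" "?s \<le> 1" using m by auto
    have h: "cmod ?h \<le> E" unfolding E_def by (rule norm_sum_diag_sum_le)
    have y: "cmod (of_real (?s\<^sup>2) * ?h) \<le> E * ?s\<^sup>2"
      using mult_left_mono[OF h, of "?s\<^sup>2"] by (simp add: norm_mult norm_power norm_divide mult.commute)
    have s2: "?s\<^sup>2 \<le> 1" by (rule power_le_one[OF s])
    have yE: "E * ?s\<^sup>2 \<le> E" using mult_left_mono[OF s2 E] by simp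
    have zw: "cmod (?z - ?w) \<le> (C + E\<^sup>2 * exp E) * ?s ^ 3"
    proof -
      have "cmod (?w - 1 - of_real (?s\<^sup>2) * ?h) \<le> (cmod (of_real (?s\<^sup>2) * ?h))\<^sup>2 * exp (cmod (of_real (?s\<^sup>2) * ?h))"
        by (rule norm_exp_first_order_le)
      also have "\<dots> \<le> (E * ?s\<^sup>2)\<^sup>2 * exp E"
        by (rule mult_mono[OF power_mono[OF y norm_ge_zero]]) (use order_trans[OF y yE] in auto)
      also have "\<dots> = E\<^sup>2 * exp E * ?s ^ 3 * ?s"
        by (simp add: power2_eq_square power3_eq_cube mult_ac)
      also have "\<dots> \<le> E\<^sup>2 * exp E * ?s ^ 3 * 1"
        by (intro mult_left_mono) (use s in auto)
      finally have "cmod (?w - 1 - of_real (?s\<^sup>2) * ?h) \<le> E\<^sup>2 * exp E * ?s ^ 3" by simp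
      moreover have "cmod (?z - ?w) \<le> cmod (?z - 1 - of_real (?s\<^sup>2) * ?h) + cmod (?w - 1 - of_real (?s\<^sup>2) * ?h)"
        using norm_triangle_ineq4[of "?z - 1 - of_real (?s\<^sup>2) * ?h" "?w - 1 - of_real (?s\<^sup>2) * ?h"] by simp
      ultimately show ?thesis
        using C(2)[OF s, of n] by (simp only: distrib_right)
    qed
    have z: "cmod ?z \<le> exp ((C + E) * ?s\<^sup>2)"
    proof -
      have "C * ?s\<^sup>2 \<le> (C + E) * ?s\<^sup>2" by (rule mult_right_mono) (use E in auto)
      then show ?thesis using C(3)[OF s, of n] by (meson exp_le_cancel_iff order_trans)
    qed
    have w: "cmod ?w \<le> exp ((C + E) * ?s\<^sup>2)"
    proof -
      have "cmod ?w \<le> exp (cmod (of_real (?s\<^sup>2) * ?h))" by (rule norm_exp)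
      moreover have "E * ?s\<^sup>2 \<le> (C + E) * ?s\<^sup>2" by (rule mult_right_mono) (use C in auto)
      ultimately show ?thesis using y by (meson exp_le_cancel_iff order_trans)
    qed
    have mm: "real (m * m) * ?s\<^sup>2 = 1" using m by (simp add: power2_eq_square)
    have "cmod (?z ^ (m * m) - ?w ^ (m * m)) \<le> real (m * m) * exp ((C + E) * ?s\<^sup>2) ^ (m * m) * cmod (?z - ?w)"
      by (rule norm_power_diff_le[OF z w]) (use C E in simp)
    also have "exp ((C + E) * ?s\<^sup>2) ^ (m * m) = exp ((C + E) * (real (m * m) * ?s\<^sup>2))"
      by (simp only: exp_of_nat_mult[symmetric] mult_ac)
    also have "?w ^ (m * m) = exp ?h"
    proof -
      have "?w ^ (m * m) = exp (of_real (real (m * m) * ?s\<^sup>2) * ?h)"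
        by (simp only: exp_of_nat_mult[symmetric] of_real_mult of_real_of_nat_eq mult.assoc)
      then show ?thesis unfolding mm by simp
    qed
    also have "real (m * m) * exp ((C + E) * (real (m * m) * ?s\<^sup>2)) * cmod (?z - ?w)
        \<le> real (m * m) * exp (C + E) * ((C + E\<^sup>2 * exp E) * ?s ^ 3)"
      unfolding mm mult_1_right by (intro mult_left_mono zw mult_nonneg_nonneg) auto
    also have "\<dots> = K / real m"
      using m by (simp add: K_def power3_eq_cube)
    finally show "cmod (?z ^ (m * m) - exp ?h) \<le> K / real m" .
  qed
qed

lemma power_diff_tendsto_zero:
  fixes f g :: "nat \<Rightarrow> complex"
  assumes "(\<lambda>n. f n - g n) \<longlonglongrightarrow> 0" "\<And>n. cmod (f n) \<le> R" "\<And>n. cmod (g n) \<le> R"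
  shows "(\<lambda>n. f n ^ k - g n ^ k) \<longlonglongrightarrow> 0"
proof (rule Lim_null_comparison)
  show "\<forall>\<^sub>F n in sequentially. norm (f n ^ k - g n ^ k) \<le> real k * max 1 R ^ k * cmod (f n - g n)"
    by (intro always_eventually allI norm_power_diff_le) (use assms in \<open>auto simp: le_max_iff_disj\<close>)
  show "(\<lambda>n. real k * max 1 R ^ k * cmod (f n - g n)) \<longlonglongrightarrow> 0"
    using tendsto_mult_left[OF tendsto_norm_zero[OF assms(1)], of "real k * max 1 R ^ k"] by simp
qed

theorem tdet_tendsto:
  "(\<lambda>n. tdet n (A 1) (B 1)) \<longlonglongrightarrow> exp (\<Sum>i. of_nat (Suc i) * (c i * d i))"
proof -
  let ?S = "\<Sum>i. of_nat (Suc i) * (c i * d i)"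
  obtain C where C: "0 \<le> C" "\<And>m n. 0 < m \<Longrightarrow>
    cmod (tdet n (A (1 / real m)) (B (1 / real m)) ^ (m * m) - exp (\<Sum>i<n. diag_sum i)) \<le> C / real m"
    using tdet_root_power by blast
  have roots: "(\<lambda>n. tdet n (A 1) (B 1) - tdet n (A (1 / real m)) (B (1 / real m)) ^ (m * m)) \<longlonglongrightarrow> 0"
    if m: "0 < m" for m
  proof -
    let ?a = "A (1 / real m)" and ?b = "B (1 / real m)"
    have w: "wiener r (A 1)" "wiener r ?a" "wiener r ?b"
      using m by (auto intro: exp_family_wiener[OF A] exp_family_wiener[OF B])
    have 1: "(\<lambda>n. tdet n (A 1) (B 1) - tdet n (A 1) ?b ^ m) \<longlonglongrightarrow> 0"
      by (rule tdet_power_tendsto[OF r w(1) B m])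
    \<comment> \<open>The other symbol is split in the same way, with the two arguments exchanged by
      \<open>tdet_commute\<close>.\<close>
    have 2: "(\<lambda>n. tdet n (A 1) ?b - tdet n ?a ?b ^ m) \<longlonglongrightarrow> 0"
      using tdet_power_tendsto[OF r w(3) A m] by (simp add: tdet_commute[of _ ?b])
    obtain N1 N2 where N: "\<And>n. cmod (tdet n (A 1) ?b) \<le> N1" "\<And>n. cmod (tdet n ?a ?b) \<le> N2"
      using tdet_bounded[OF r w(1,3)] tdet_bounded[OF r w(2,3)] by blast
    have N2: "cmod (tdet n ?a ?b ^ m) \<le> N2 ^ m" for n
      unfolding norm_power by (intro power_mono N) auto
    have "(\<lambda>n. tdet n (A 1) ?b ^ m - (tdet n ?a ?b ^ m) ^ m) \<longlonglongrightarrow> 0"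
      by (rule power_diff_tendsto_zero[OF 2, where R = "max N1 (N2 ^ m)"])
        (use N N2 in \<open>auto simp: le_max_iff_disj\<close>)
    from tendsto_add[OF 1 this] show ?thesis
      by (simp add: power_mult[symmetric])
  qed
  have eh: "(\<lambda>n. exp (\<Sum>i<n. diag_sum i) - exp ?S) \<longlonglongrightarrow> 0"
    using tendsto_diff[OF tendsto_exp[OF sum_diag_sum_tendsto] tendsto_const[of "exp ?S"]] by simp
  show ?thesis
  proof (rule LIMSEQ_I)
    fix e :: real assume e: "0 < e"
    \<comment> \<open>\<open>m\<close> is fixed before \<open>n1\<close> and \<open>n2\<close>: the
      error \<open>C / m\<close> is uniform in \<open>n\<close>, whereas the speed of convergence in
      \<open>roots\<close> depends on \<open>m\<close>.\<close>
    obtain m :: nat where m: "real m > 3 * C / e" "0 < m"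
      by (metis gr0I less_trans of_nat_0_less_iff reals_Archimedean2 not_less_iff_gr_or_eq max_less_iff_conj)
    then have Cm: "C / real m < e / 3"
      using e by (simp add: field_simps)
    obtain n1 where n1: "\<And>n. n \<ge> n1 \<Longrightarrow>
        cmod (tdet n (A 1) (B 1) - tdet n (A (1 / real m)) (B (1 / real m)) ^ (m * m)) < e / 3"
      using LIMSEQ_D[OF roots[OF m(2)], of "e / 3"] e by auto
    obtain n2 where n2: "\<And>n. n \<ge> n2 \<Longrightarrow> cmod (exp (\<Sum>i<n. diag_sum i) - exp ?S) < e / 3"
      using LIMSEQ_D[OF eh, of "e / 3"] e by auto
    have "cmod (tdet n (A 1) (B 1) - exp ?S) < e" if n: "n \<ge> max n1 n2" for n
    proof -
      let ?x = "tdet n (A 1) (B 1)" and ?y = "tdet n (A (1 / real m)) (B (1 / real m)) ^ (m * m)"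
        and ?z = "exp (\<Sum>i<n. diag_sum i)"
      have "cmod (?x - exp ?S) \<le> cmod (?x - ?y) + cmod (?y - ?z) + cmod (?z - exp ?S)"
        by (rule norm_triangle_le_diff norm_diff_triangle_le order_refl | assumption)+
      moreover have "cmod (?x - ?y) < e / 3" "cmod (?z - exp ?S) < e / 3"
        using n1[of n] n2[of n] n by simp_all
      ultimately show ?thesis
        using C(2)[OF m(2), of n] Cm by linarith
    qed
    then show "\<exists>no. \<forall>n\<ge>no. norm (tdet n (A 1) (B 1) - exp ?S) < e" by blast
  qed
qed

end

section \<open>Laurent decomposition\<close>

text \<open>Differentiation under the integral for a merely continuous density. Both sides of the
  circle matter: the inside for the outer circle of an annulus, the outside for the inner
  one.\<close>

lemma cauchy_transform_holomorphic:
  assumes "continuous_on (sphere 0 r) F" "0 < r"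
  shows "(\<lambda>z. contour_integral (circlepath 0 r) (\<lambda>w. F w / (w - z))) holomorphic_on (- sphere 0 r)"
proof -
  have [simp]: "path_image (circlepath 0 r) = sphere 0 r"
    using assms by simp
  have "(\<lambda>z. contour_integral (circlepath 0 r) (\<lambda>w. F w / (w - z))) field_differentiable (at z)"
    if z: "z \<in> - sphere 0 r" for z
  proof -
    have int: "((\<lambda>u. F u / (u - w) ^ 1) has_contour_integral
        contour_integral (circlepath 0 r) (\<lambda>u. F u / (u - w))) (circlepath 0 r)"
      if "w \<in> UNIV - path_image (circlepath 0 r)" for w
      using that assms
      by (auto intro!: has_contour_integral_integral contour_integrable_continuous_circlepath continuous_intros)
    \<comment> \<open>Here \<open>k = 1\<close> selects the kernel \<open>1 / (u - z)\<close>, and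
      \<open>2 * pi * r\<close> is the speed of the parametrised circle.\<close>
    have "\<exists>D. ((\<lambda>z. contour_integral (circlepath 0 r) (\<lambda>w. F w / (w - z))) has_field_derivative D) (at z)"
      by (rule exI, rule Cauchy_next_derivative(2)[where f' = F and k = 1 and S = UNIV and B = "2 * pi * r", OF _ _ int])
        (use assms z in \<open>auto simp: vector_derivative_circlepath norm_mult\<close>)
    then show ?thesis by (simp add: field_differentiable_def)
  qed
  then show ?thesis
    by (intro holomorphic_onI) (auto intro: field_differentiable_at_within)
qed

text \<open>The difference quotient \<open>g\<close> has a removable singularity at
  \<open>z\<close>, so its integrals over the two homotopic circles agree. The integral of
  \<open>1 / (w - z)\<close> is \<open>2 pi i\<close> over the outer circle and 0 over the inner
  one, which does not surround \<open>z\<close>.\<close>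

lemma cauchy_formula_annulus:
  assumes S: "open S" "F holomorphic_on S" and "0 < p" "p < R" "{z. p \<le> cmod z \<and> cmod z \<le> R} \<subseteq> S"
    and z: "p < cmod z" "cmod z < R"
  shows "2 * of_real pi * \<i> * F z = contour_integral (circlepath 0 R) (\<lambda>w. F w / (w - z))
    - contour_integral (circlepath 0 p) (\<lambda>w. F w / (w - z))"
proof -
  define g where "g = (\<lambda>w. if w = z then deriv F z else (F w - F z) / (w - z))"
  have zS: "z \<in> S" using assms by force
  have "g holomorphic_on S"
    unfolding g_def using pole_lemma[OF S(2), of z] zS S(1) by (simp add: interior_open)
  moreover have "homotopic_loops S (circlepath 0 p) (circlepath 0 R)"
  proof (rule homotopic_loops_linear)
    fix t :: real
    \<comment> \<open>Along the straight homotopy the argument is fixed and the modulus is a convex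
      combination of \<open>p\<close> and \<open>R\<close>.\<close>
    show "closed_segment (circlepath 0 p t) (circlepath 0 R t) \<subseteq> S"
    proof
      fix x assume "x \<in> closed_segment (circlepath 0 p t) (circlepath 0 R t)"
      then obtain u where u: "0 \<le> u" "u \<le> 1"
        "x = (1 - u) *\<^sub>R circlepath 0 p t + u *\<^sub>R circlepath 0 R t"
        by (auto simp: in_segment)
      have "x = of_real ((1 - u) * p + u * R) * exp (2 * of_real pi * \<i> * of_real t)"
        by (simp add: u(3) circlepath scaleR_conv_of_real algebra_simps)
      then have "cmod x = \<bar>(1 - u) * p + u * R\<bar>"
        by (simp only: norm_mult norm_of_real) (simp add: norm_exp_eq_Re)
      moreover have "p \<le> (1 - u) * p + u * R"
        using u assms mult_left_mono[of p R u] by (simp add: algebra_simps)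
      moreover have "(1 - u) * p + u * R \<le> R"
        using u assms mult_left_mono[of p R "1 - u"] by (simp add: algebra_simps)
      ultimately show "x \<in> S" using assms by auto
    qed
  qed auto
  ultimately have eq: "contour_integral (circlepath 0 p) g = contour_integral (circlepath 0 R) g"
    using S(1) by (intro Cauchy_theorem_homotopic_loops[of S]) auto
  have int: "contour_integral (circlepath 0 q) g
      = contour_integral (circlepath 0 q) (\<lambda>w. F w / (w - z))
        - F z * contour_integral (circlepath 0 q) (\<lambda>w. 1 / (w - z))"
    if q: "q = p \<or> q = R" for q
  proof -
    have q0: "0 < q" "sphere 0 q \<subseteq> S" "z \<notin> sphere 0 q"
      using q assms by auto
    have F: "continuous_on (sphere 0 q) F"
      using holomorphic_on_imp_continuous_on[OF S(2)] continuous_on_subset q0 by blast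
    have i1: "(\<lambda>w. F w / (w - z)) contour_integrable_on circlepath 0 q"
      by (rule contour_integrable_continuous_circlepath) (use q0 F in \<open>auto intro!: continuous_intros\<close>)
    have i2: "(\<lambda>w. 1 / (w - z)) contour_integrable_on circlepath 0 q"
      by (rule contour_integrable_continuous_circlepath) (use q0 F in \<open>auto intro!: continuous_intros\<close>)
    have "contour_integral (circlepath 0 q) g
        = contour_integral (circlepath 0 q) (\<lambda>w. F w / (w - z) - F z * (1 / (w - z)))"
      by (rule contour_integral_cong) (use q0 in \<open>auto simp: g_def diff_divide_distrib\<close>)
    also have "\<dots> = contour_integral (circlepath 0 q) (\<lambda>w. F w / (w - z))
        - contour_integral (circlepath 0 q) (\<lambda>w. F z * (1 / (w - z)))"
      by (rule contour_integral_diff[OF i1 contour_integrable_lmul[OF i2]])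
    also have "contour_integral (circlepath 0 q) (\<lambda>w. F z * (1 / (w - z)))
        = F z * contour_integral (circlepath 0 q) (\<lambda>w. 1 / (w - z))"
      by (rule contour_integral_lmul[OF i2])
    finally show ?thesis .
  qed
  have "contour_integral (circlepath 0 R) (\<lambda>w. 1 / (w - z)) = 2 * of_real pi * \<i> * 1"
    by (rule contour_integral_unique, rule Cauchy_integral_circlepath_simple) (use z in auto)
  moreover have "contour_integral (circlepath 0 p) (\<lambda>w. 1 / (w - z)) = 0"
    by (rule contour_integral_unique, rule Cauchy_theorem_disc_simple[where a = 0 and e = "cmod z"])
      (use z assms in \<open>auto intro!: holomorphic_intros\<close>)
  ultimately show ?thesis
    using eq int[of p] int[of R] by (simp add: algebra_simps)
qed

text \<open>The Cauchy integral over the outer circle gives \<open>P\<close>. The inner one is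
  holomorphic outside a disc and vanishes at infinity, so it becomes \<open>Q\<close> in the
  variable \<open>inverse z\<close>; with \<open>Q 0 = 0\<close>, the whole constant term belongs to
  \<open>P\<close>.\<close>

lemma laurent_decomposition:
  assumes U: "open U" "sphere 0 1 \<subseteq> U" "F holomorphic_on U"
  obtains R P Q where "1 < R" "P holomorphic_on ball 0 R" "Q holomorphic_on ball 0 R" "Q 0 = 0"
    "\<And>z. cmod z = 1 \<Longrightarrow> F z = P z + Q (inverse z)"
proof -
  obtain e0 where e0: "0 < e0" "(\<Union>x\<in>sphere 0 1. ball x e0) \<subseteq> U"
    using compact_subset_open_imp_ball_epsilon_subset[OF compact_sphere U(1,2)] by blast
  define e where "e = min e0 (1/2) / 2"
  define p where "p = 1 - e"
  define R where "R = 1 + e"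
  have e: "0 < e" "e < e0" "e < 1/2" using e0 by (auto simp: e_def)
  have pR: "0 < p" "p < 1" "1 < R" using e by (auto simp: p_def R_def)
  have ann: "{z. p \<le> cmod z \<and> cmod z \<le> R} \<subseteq> U"
  proof
    fix z assume z: "z \<in> {z. p \<le> cmod z \<and> cmod z \<le> R}"
    then have z0: "z \<noteq> 0" using pR by auto
    have "dist (z / of_real (cmod z)) z = cmod (of_real (1 - cmod z) * (z / of_real (cmod z)))"
      using z0 by (simp add: dist_norm field_simps)
    also have "\<dots> = \<bar>1 - cmod z\<bar>"
      using z0 by (simp only: norm_mult norm_of_real norm_divide) simp
    also have "\<dots> < e0" using z e by (auto simp: p_def R_def)
    finally have "z \<in> ball (z / of_real (cmod z)) e0" by simp
    moreover have "z / of_real (cmod z) \<in> sphere 0 1" using z0 by (simp add: norm_divide)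
    ultimately show "z \<in> U" using e0 by blast
  qed
  define T where "T = (\<lambda>r z. contour_integral (circlepath 0 r) (\<lambda>w. F w / (w - z)))"
  have cont: "continuous_on (sphere 0 q) F" if "p \<le> q" "q \<le> R" for q
    by (rule continuous_on_subset[OF holomorphic_on_imp_continuous_on[OF U(3)]]) (use ann that in auto)
  have contp: "continuous_on (sphere 0 p) F" and contR: "continuous_on (sphere 0 R) F"
    using cont pR by auto
  have TR: "T R holomorphic_on (- sphere 0 R)" and Tp: "T p holomorphic_on (- sphere 0 p)"
    unfolding T_def using cauchy_transform_holomorphic[OF contp] cauchy_transform_holomorphic[OF contR] pR
    by auto
  define P where "P = (\<lambda>z. T R z / (2 * of_real pi * \<i>))"
  define Q where "Q = (\<lambda>u. if u = 0 then 0 else - T p (inverse u) / (2 * of_real pi * \<i>))"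
  \<comment> \<open>For \<open>cmod u < inverse p\<close> and \<open>u \<noteq> 0\<close>, the point
    \<open>inverse u\<close> lies outside the circle of radius \<open>p\<close>.\<close>
  define R' where "R' = min R (inverse p)"
  have R': "1 < R'" "R' \<le> R" "R' \<le> inverse p"
    using pR by (auto simp: R'_def one_less_inverse_iff)
  have P: "P holomorphic_on ball 0 R'"
    unfolding P_def by (intro holomorphic_intros holomorphic_on_subset[OF TR]) (use R' in auto)
  have Qz: "(Q \<longlongrightarrow> Q 0) (at 0 within ball 0 R')"
  proof -
    obtain B where B: "\<And>w. w \<in> sphere 0 p \<Longrightarrow> cmod (F w) \<le> B" "0 \<le> B"
    proof -
      have "bounded (F ` sphere 0 p)"
        by (intro compact_imp_bounded compact_continuous_image contp compact_sphere)
      then obtain B where "0 < B" "\<forall>x\<in>F ` sphere 0 p. norm x \<le> B" unfolding bounded_pos by blast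
      then show thesis using that[of B] by force
    qed
    \<comment> \<open>If \<open>inverse u\<close> is at more than twice the radius \<open>p\<close>,
      it keeps a distance of at least \<open>cmod (inverse u) / 2\<close> from the circle. Thus
      \<open>Q u\<close> is of order \<open>cmod u\<close>, and the singularity at 0 is
      removable.\<close>
    have bnd: "cmod (Q u) \<le> 2 * B * p * cmod u" if u: "0 < cmod u" "cmod u < inverse (2 * p)" for u
    proof -
      have iu: "2 * p < cmod (inverse u)"
      proof -
        have "cmod (inverse u) = inverse (cmod u)" by (simp add: norm_inverse)
        moreover have "2 * p * cmod u < 2 * p * inverse (2 * p)"
          using u pR by (intro mult_strict_left_mono) auto
        then have "2 * p * cmod u < 1" using pR by (simp only: right_inverse)
        then have "2 * p < 1 / cmod u" using u by (simp only: pos_less_divide_eq)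
        ultimately show ?thesis by (simp only: inverse_eq_divide)
      qed
      have "cmod (T p (inverse u)) \<le> (2 * B * cmod u) * (2 * pi * p)"
        unfolding T_def
      proof (rule has_contour_integral_bound_circlepath)
        show "((\<lambda>w. F w / (w - inverse u)) has_contour_integral
            contour_integral (circlepath 0 p) (\<lambda>w. F w / (w - inverse u))) (circlepath 0 p)"
          by (rule has_contour_integral_integral, rule contour_integrable_continuous_circlepath)
            (use contp pR iu in \<open>auto intro!: continuous_intros\<close>)
        fix w assume w: "cmod (w - 0) = p"
        have "cmod (inverse u) / 2 \<le> cmod (w - inverse u)"
          using norm_triangle_ineq2[of "inverse u" w] iu w by (simp add: norm_minus_commute)
        then have "cmod (F w) / cmod (w - inverse u) \<le> B / (cmod (inverse u) / 2)"
          by (intro frac_le B) (use w u in \<open>auto simp: norm_inverse\<close>)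
        also have "\<dots> = 2 * B * cmod u"
        proof -
          have "B / (inverse x / 2) = 2 * B * x" if "0 < x" for x :: real
            using that by (simp add: field_simps)
          from this[OF u(1)] show ?thesis by (simp only: norm_inverse)
        qed
        finally show "cmod (F w / (w - inverse u)) \<le> 2 * B * cmod u"
          by (simp add: norm_divide)
      qed (use B pR in auto)
      then have "cmod (T p (inverse u)) / (2 * pi) \<le> 2 * B * p * cmod u"
        by (simp add: field_simps)
      then show ?thesis
        using u by (auto simp: Q_def norm_divide norm_mult)
    qed
    have "(Q \<longlongrightarrow> 0) (at 0)"
    proof (rule Lim_null_comparison)
      show "\<forall>\<^sub>F u in at 0. norm (Q u) \<le> 2 * B * p * cmod u"
        unfolding eventually_at
        by (rule exI[of _ "inverse (2 * p)"]) (use bnd pR in auto)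
      show "((\<lambda>u. 2 * B * p * cmod u) \<longlongrightarrow> 0) (at 0)"
        by (auto intro!: tendsto_eq_intros)
    qed
    moreover have "Q 0 = 0" by (simp add: Q_def)
    ultimately show ?thesis
      by (metis tendsto_within_subset subset_UNIV)
  qed
  have "Q holomorphic_on ball 0 R' - {0}"
  proof -
    have "(\<lambda>u. - T p (inverse u) / (2 * of_real pi * \<i>)) holomorphic_on ball 0 R' - {0}"
    proof -
      have "(T p \<circ> inverse) holomorphic_on ball 0 R' - {0}"
      proof (rule holomorphic_on_compose_gen[OF _ Tp])
        show "inverse holomorphic_on ball 0 R' - {0 :: complex}"
          by (intro holomorphic_intros) auto
        have inv: "cmod (inverse u) \<noteq> p" if "u \<noteq> 0" "cmod u < R'" for u
        proof
          assume "cmod (inverse u) = p"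
          then have "cmod u = inverse p" using that by (auto simp: norm_inverse)
          then show False using that R' by simp
        qed
        show "inverse ` (ball 0 R' - {0 :: complex}) \<subseteq> - sphere 0 p"
        proof
          fix v assume "v \<in> inverse ` (ball 0 R' - {0 :: complex})"
          then obtain u where u: "v = inverse u" "u \<in> ball 0 R'" "u \<noteq> 0" by blast
          have "cmod v \<noteq> p"
            unfolding u(1) by (rule inv) (use u(2,3) in simp_all)
          then show "v \<in> - sphere 0 p" by simp
        qed
      qed
      then show ?thesis by (intro holomorphic_intros) (auto simp: o_def)
    qed
    then show ?thesis
      by (rule holomorphic_transform) (auto simp: Q_def)
  qed
  then have Q: "Q holomorphic_on ball 0 R'"
  proof (rule no_isolated_singularity'[rotated])
    show "(Q \<longlongrightarrow> Q z) (at z within ball 0 R')" if "z \<in> {0}" for z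
      using that Qz by (simp only: singleton_iff)
  qed simp_all
  show thesis
  proof (rule that[OF R'(1) P Q])
    show "Q 0 = 0" by (simp add: Q_def)
    fix z :: complex assume z: "cmod z = 1"
    have "2 * of_real pi * \<i> * F z = T R z - T p z"
      unfolding T_def by (rule cauchy_formula_annulus[OF U(1,3) _ _ ann]) (use pR z in auto)
    then have "F z = (T R z - T p z) / (2 * of_real pi * \<i>)"
      by (simp add: field_simps)
    moreover have "z \<noteq> 0" using z by auto
    ultimately show "F z = P z + Q (inverse z)"
      by (simp add: P_def Q_def diff_divide_distrib)
  qed
qed

section \<open>Taylor coefficients of exponentials\<close>

lemma fps_expansion_nth_le:
  assumes f: "f holomorphic_on ball 0 R" and R: "0 < R'" "R' < R"
    and B: "\<And>z. cmod z = R' \<Longrightarrow> cmod (f z) \<le> B"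
  shows "cmod (fps_nth (fps_expansion f 0) k) \<le> B * (1 / R') ^ k"
proof -
  have "cmod ((deriv ^^ k) f 0) \<le> fact k * B / R' ^ k"
  proof (rule Cauchy_inequality)
    show "f holomorphic_on ball 0 R'"
      by (rule holomorphic_on_subset[OF f]) (use R in auto)
    show "continuous_on (cball 0 R') f"
      by (rule continuous_on_subset[OF holomorphic_on_imp_continuous_on[OF f]]) (use R in auto)
  qed (use R B in auto)
  then have "cmod ((deriv ^^ k) f 0) / fact k \<le> fact k * B / R' ^ k / fact k"
    by (rule divide_right_mono) simp
  then show ?thesis
    by (simp add: fps_expansion_def norm_divide power_one_over)
qed

lemma fps_expansion_holomorphic:
  assumes "f holomorphic_on ball 0 R" "0 < R"
  shows "f has_fps_expansion fps_expansion f 0"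
  by (rule has_fps_expansion_fps_expansion[of "ball 0 R"]) (use assms in auto)

lemma fps_expansion_sums:
  assumes f: "f holomorphic_on ball 0 R" and z: "cmod z < R"
  shows "(\<lambda>k. fps_nth (fps_expansion f 0) k * z ^ k) sums f z"
  using holomorphic_power_series[OF f, of z] z by (simp add: fps_expansion_def)

text \<open>Cauchy estimates on the circle of radius \<open>R'\<close>, for
  \<open>exp (s a)\<close>, \<open>exp (s a) - 1\<close> and \<open>exp (s a) - 1 - s a\<close>. The
  constant is a common majorant of \<open>exp B\<close>, \<open>B + B\<^sup>2 * exp B\<close> and
  \<open>B\<^sup>2 * exp B\<close>, which bound these functions up to the respective power of
  \<open>s\<close>.\<close>

lemma exp_family_expansion:
  assumes a: "a holomorphic_on ball 0 R" "a 0 = 0" and R: "1 < R'" "R' < R"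
    and B: "\<And>z. cmod z = R' \<Longrightarrow> cmod (a z) \<le> B"
  shows "exp_family (1 / R') (exp B * (1 + B)\<^sup>2) (\<lambda>k. fps_nth (fps_expansion a 0) (Suc k))
    (\<lambda>s. fps_expansion (\<lambda>z. exp (of_real s * a z)) 0)"
proof -
  let ?A = "\<lambda>s. fps_expansion (\<lambda>z. exp (of_real s * a z)) 0"
  let ?M = "exp B * (1 + B)\<^sup>2"
  have R0: "0 < R" "0 < R'" using R by auto
  have B0: "0 \<le> B"
  proof -
    have "0 \<le> cmod (a (of_real R'))" by simp
    also have "\<dots> \<le> B" using R by (intro B) simp
    finally show ?thesis .
  qed
  have hol: "(\<lambda>z. exp (of_real s * a z)) holomorphic_on ball 0 R" for s
    using a by (intro holomorphic_intros)
  note exps = fps_expansion_holomorphic[OF hol R0(1)]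
  have sum: "?A (s + t) = ?A s * ?A t" for s t
  proof (rule fps_expansion_eqI)
    have "(\<lambda>z. exp (of_real s * a z) * exp (of_real t * a z)) has_fps_expansion ?A s * ?A t"
      by (intro has_fps_expansion_mult exps)
    then show "(\<lambda>z. exp (of_real (s + t) * a z)) has_fps_expansion ?A s * ?A t"
      by (simp add: exp_add[symmetric] distrib_right)
  qed
  have zero: "?A 0 = 1"
    by (rule fps_expansion_eqI) simp
  have nth0: "fps_nth (?A s) 0 = 1" for s
    using a by (simp add: fps_expansion_def)
  have small: "cmod (of_real s * a z) \<le> \<bar>s\<bar> * B" "\<bar>s\<bar> * B \<le> B" if "\<bar>s\<bar> \<le> 1" "cmod z = R'" for s z
    using B[OF that(2)] that B0 mult_right_mono[of "\<bar>s\<bar>" 1 B] by (auto simp: norm_mult intro: mult_left_mono)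
  have b0: "cmod (fps_nth (?A s) k) \<le> ?M * (1 / R') ^ k" if s: "\<bar>s\<bar> \<le> 1" for s k
  proof (rule fps_expansion_nth_le[OF hol R0(2) R(2)])
    fix z assume z: "cmod z = R'"
    have "cmod (exp (of_real s * a z)) \<le> exp (cmod (of_real s * a z))" by (rule norm_exp)
    also have "\<dots> \<le> exp B" using small[OF s z] by simp
    also have "\<dots> \<le> ?M" using B0 by (simp add: one_le_power)
    finally show "cmod (exp (of_real s * a z)) \<le> ?M" .
  qed
  have MB: "B + B\<^sup>2 * exp B \<le> ?M" "B\<^sup>2 * exp B \<le> ?M"
  proof -
    have "B * 1 \<le> B * exp B" using B0 by (intro mult_left_mono) auto
    moreover have "?M = exp B + 2 * (B * exp B) + B\<^sup>2 * exp B" by (simp add: power2_eq_square algebra_simps)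
    ultimately show "B + B\<^sup>2 * exp B \<le> ?M" "B\<^sup>2 * exp B \<le> ?M"
      using B0 by (auto intro: add_increasing)
  qed
  have second: "cmod (exp (of_real s * a z) - 1 - of_real s * a z) \<le> s\<^sup>2 * (B\<^sup>2 * exp B)"
    if s: "\<bar>s\<bar> \<le> 1" and z: "cmod z = R'" for s z
  proof -
    have "cmod (exp (of_real s * a z) - 1 - of_real s * a z)
        \<le> (cmod (of_real s * a z))\<^sup>2 * exp (cmod (of_real s * a z))"
      by (rule norm_exp_first_order_le)
    also have "\<dots> \<le> (\<bar>s\<bar> * B)\<^sup>2 * exp B"
      using small[OF s z] by (intro mult_mono power_mono) auto
    finally show ?thesis by (simp add: power_mult_distrib mult_ac)
  qed
  have b1: "cmod (fps_nth (?A s) (Suc k)) \<le> ?M * \<bar>s\<bar> * (1 / R') ^ Suc k" if s: "\<bar>s\<bar> \<le> 1" for s k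
  proof -
    have "fps_expansion (\<lambda>z. exp (of_real s * a z) - 1) 0 = ?A s - 1"
      by (rule fps_expansion_eqI) (intro has_fps_expansion_diff exps has_fps_expansion_1)
    moreover have "cmod (fps_nth (fps_expansion (\<lambda>z. exp (of_real s * a z) - 1) 0) (Suc k))
        \<le> ?M * \<bar>s\<bar> * (1 / R') ^ Suc k"
    proof (rule fps_expansion_nth_le[OF _ R0(2) R(2)])
      show "(\<lambda>z. exp (of_real s * a z) - 1) holomorphic_on ball 0 R"
        using a by (intro holomorphic_intros)
      fix z assume z: "cmod z = R'"
      have "cmod (exp (of_real s * a z) - 1)
          \<le> cmod (exp (of_real s * a z) - 1 - of_real s * a z) + cmod (of_real s * a z)"
        using norm_triangle_ineq[of "exp (of_real s * a z) - 1 - of_real s * a z" "of_real s * a z"] by simp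
      also have "\<dots> \<le> s\<^sup>2 * (B\<^sup>2 * exp B) + \<bar>s\<bar> * B"
        by (intro add_mono second small s z)
      also have "s\<^sup>2 * (B\<^sup>2 * exp B) \<le> \<bar>s\<bar> * (B\<^sup>2 * exp B)"
      proof (rule mult_right_mono)
        show "s\<^sup>2 \<le> \<bar>s\<bar>"
          using mult_left_mono[OF s, of "\<bar>s\<bar>"] by (simp add: power2_eq_square)
      qed simp
      also have "\<bar>s\<bar> * (B\<^sup>2 * exp B) + \<bar>s\<bar> * B = \<bar>s\<bar> * (B + B\<^sup>2 * exp B)"
        by (simp add: algebra_simps)
      also have "\<dots> \<le> \<bar>s\<bar> * ?M" by (intro mult_left_mono MB) simp
      finally show "cmod (exp (of_real s * a z) - 1) \<le> ?M * \<bar>s\<bar>" by (simp add: mult.commute)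
    qed
    ultimately show ?thesis by simp
  qed
  have b2: "cmod (fps_nth (?A s) (Suc k) - of_real s * fps_nth (fps_expansion a 0) (Suc k))
      \<le> ?M * s\<^sup>2 * (1 / R') ^ Suc k" if s: "\<bar>s\<bar> \<le> 1" for s k
  proof -
    have "fps_expansion (\<lambda>z. exp (of_real s * a z) - 1 - of_real s * a z) 0
        = ?A s - 1 - fps_const (of_real s) * fps_expansion a 0"
      by (rule fps_expansion_eqI)
        (intro has_fps_expansion_diff exps has_fps_expansion_1 has_fps_expansion_cmult_left
          fps_expansion_holomorphic[OF a(1) R0(1)])
    moreover have "cmod (fps_nth (fps_expansion (\<lambda>z. exp (of_real s * a z) - 1 - of_real s * a z) 0) (Suc k))
        \<le> ?M * s\<^sup>2 * (1 / R') ^ Suc k"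
    proof (rule fps_expansion_nth_le[OF _ R0(2) R(2)])
      show "(\<lambda>z. exp (of_real s * a z) - 1 - of_real s * a z) holomorphic_on ball 0 R"
        using a by (intro holomorphic_intros)
      fix z assume z: "cmod z = R'"
      have "s\<^sup>2 * (B\<^sup>2 * exp B) \<le> s\<^sup>2 * ?M" by (intro mult_left_mono MB) simp
      then show "cmod (exp (of_real s * a z) - 1 - of_real s * a z) \<le> ?M * s\<^sup>2"
        using second[OF s z] by (simp add: mult.commute)
    qed
    ultimately show ?thesis by simp
  qed
  show ?thesis
    unfolding exp_family_def using sum zero nth0 b0 b1 b2 by blast
qed

section \<open>Fourier coefficients and moments\<close>

text \<open>The common form of Fourier coefficients and moments. The gauge integral gives direct
  access to the fundamental theorem of calculus and to integration of uniform limits.\<close>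

definition circle_mean :: "(real \<Rightarrow> complex) \<Rightarrow> complex" where
  "circle_mean f = integral {0..2 * pi} f / of_real (2 * pi)"

lemma circle_mean_cis: "circle_mean (\<lambda>t. cis (of_int n * t)) = (if n = 0 then 1 else 0)"
proof (cases "n = 0")
  case True
  then show ?thesis by (simp add: circle_mean_def scaleR_conv_of_real)
next
  case False
  let ?c = "\<i> * of_int n"
  have c: "?c \<noteq> 0" using False by simp
  have eq: "cis (of_int n * t) = exp (?c * of_real t)" for t
    by (simp add: cis_conv_exp mult_ac)
  have "((\<lambda>t. exp (?c * of_real t)) has_integral exp (?c * of_real (2 * pi)) / ?c - exp (?c * of_real 0) / ?c) {0..2 * pi}"
  proof (rule fundamental_theorem_of_calculus)
    fix t :: real
    have "((\<lambda>z. exp (?c * z) / ?c) has_field_derivative exp (?c * of_real t)) (at (of_real t))"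
      using c by (auto intro!: derivative_eq_intros)
    then show "((\<lambda>t. exp (?c * of_real t) / ?c) has_vector_derivative exp (?c * of_real t)) (at t within {0..2 * pi})"
      by (rule has_vector_derivative_real_field)
  qed simp
  moreover have "exp (?c * of_real (2 * pi)) = 1"
    using exp_eq_1[of "?c * of_real (2 * pi)"] by auto
  ultimately have "integral {0..2 * pi} (\<lambda>t. exp (?c * of_real t)) = 0"
    by (simp add: integral_unique)
  then show ?thesis
    using False by (simp add: circle_mean_def eq)
qed

text \<open>\<open>u\<close> stands for \<open>cis t\<close> or \<open>cis (- t)\<close> and
  \<open>h\<close> for the part that is not expanded. Geometric decay gives uniform convergence,
  hence termwise integration.\<close>

lemma circle_mean_series:
  fixes h u :: "real \<Rightarrow> complex"
  assumes h: "continuous_on {0..2 * pi} h" and u: "continuous_on {0..2 * pi} u" "\<And>t. cmod (u t) \<le> 1"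
    and p: "geo_bounded r M p" and r: "0 \<le> r" "r < 1"
  shows "(\<lambda>k. fps_nth p k * circle_mean (\<lambda>t. h t * u t ^ k))
    sums circle_mean (\<lambda>t. h t * (\<Sum>k. fps_nth p k * u t ^ k))"
proof -
  note M = geo_bounded_nonneg[OF p]
  obtain H where H: "0 \<le> H" "\<And>t. t \<in> {0..2 * pi} \<Longrightarrow> cmod (h t) \<le> H"
  proof -
    have "bounded (h ` {0..2 * pi})"
      by (intro compact_imp_bounded compact_continuous_image h) simp
    then obtain H where "0 < H" "\<forall>x\<in>h ` {0..2 * pi}. norm x \<le> H" unfolding bounded_pos by blast
    then show thesis using that[of H] by force
  qed
  have pu: "cmod (fps_nth p k * u t ^ k) \<le> M * r ^ k" for k t
  proof -
    have "cmod (fps_nth p k) * cmod (u t ^ k) \<le> (M * r ^ k) * 1"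
      by (intro mult_mono geo_boundedD[OF p]) (use M r u(2) in \<open>auto simp: norm_power intro: power_le_one\<close>)
    then show ?thesis by (simp add: norm_mult)
  qed
  have sg: "summable (\<lambda>k. M * r ^ k)"
    using r by (intro summable_mult summable_geometric) auto
  have su: "summable (\<lambda>k. fps_nth p k * u t ^ k)" for t
    by (rule summable_comparison_test'[OF sg pu])
  have "uniform_limit {0..2 * pi} (\<lambda>n t. \<Sum>k<n. h t * (fps_nth p k * u t ^ k))
      (\<lambda>t. \<Sum>k. h t * (fps_nth p k * u t ^ k)) sequentially"
  proof (rule Weierstrass_m_test)
    show "cmod (h t * (fps_nth p k * u t ^ k)) \<le> H * (M * r ^ k)" if "t \<in> {0..2 * pi}" for k t
      unfolding norm_mult[of "h t"] by (intro mult_mono H pu) (use that H in auto)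
    show "summable (\<lambda>k. H * (M * r ^ k))"
      by (intro summable_mult sg)
  qed
  then obtain I J where IJ:
      "\<And>n. ((\<lambda>t. \<Sum>k<n. h t * (fps_nth p k * u t ^ k)) has_integral I n) {0..2 * pi}"
      "((\<lambda>t. \<Sum>k. h t * (fps_nth p k * u t ^ k)) has_integral J) {0..2 * pi}"
      "I \<longlonglongrightarrow> J"
    by (rule uniform_limit_integral) (auto intro!: continuous_intros h u)
  have I: "I n = (\<Sum>k<n. fps_nth p k * integral {0..2 * pi} (\<lambda>t. h t * u t ^ k))" for n
  proof -
    have "I n = integral {0..2 * pi} (\<lambda>t. \<Sum>k<n. fps_nth p k * (h t * u t ^ k))"
      using integral_unique[OF IJ(1)[of n]] by (simp add: mult_ac)
    also have "\<dots> = (\<Sum>k<n. integral {0..2 * pi} (\<lambda>t. fps_nth p k * (h t * u t ^ k)))"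
      by (rule integral_sum) (auto intro!: integrable_continuous_interval continuous_intros h u)
    finally show ?thesis by simp
  qed
  have "J = integral {0..2 * pi} (\<lambda>t. h t * (\<Sum>k. fps_nth p k * u t ^ k))"
    using integral_unique[OF IJ(2)] by (simp add: suminf_mult[OF su])
  then have "(\<lambda>k. fps_nth p k * integral {0..2 * pi} (\<lambda>t. h t * u t ^ k))
      sums integral {0..2 * pi} (\<lambda>t. h t * (\<Sum>k. fps_nth p k * u t ^ k))"
    using IJ(3) unfolding sums_def I by simp
  then show ?thesis
    unfolding circle_mean_def times_divide_eq_right by (rule sums_divide)
qed

lemma circle_mean_power_series:
  assumes p: "geo_bounded r M p" and r: "0 \<le> r" "r < 1"
  shows "circle_mean (\<lambda>t. cis (of_int n * t) * (\<Sum>k. fps_nth p k * cis t ^ k)) = (if n \<le> 0 then fps_nth p (nat (- n)) else 0)"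
    "circle_mean (\<lambda>t. cis (of_int n * t) * (\<Sum>k. fps_nth p k * cis (- t) ^ k)) = (if 0 \<le> n then fps_nth p (nat n) else 0)"
proof -
  have 1: "cis (of_int n * t) * cis t ^ k = cis (of_int (n + int k) * t)" for t k
    unfolding Complex.DeMoivre cis_mult by (simp add: algebra_simps)
  have 2: "cis (of_int n * t) * cis (- t) ^ k = cis (of_int (n - int k) * t)" for t k
    unfolding Complex.DeMoivre cis_mult by (simp add: algebra_simps)
  have "(\<lambda>k. fps_nth p k * circle_mean (\<lambda>t. cis (of_int n * t) * cis t ^ k))
      sums circle_mean (\<lambda>t. cis (of_int n * t) * (\<Sum>k. fps_nth p k * cis t ^ k))"
    by (rule circle_mean_series[OF _ _ _ p r]) (auto intro!: continuous_intros)
  then have s1: "(\<lambda>k. fps_nth p k * (if n + int k = 0 then 1 else 0))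
      sums circle_mean (\<lambda>t. cis (of_int n * t) * (\<Sum>k. fps_nth p k * cis t ^ k))"
    unfolding 1 circle_mean_cis .
  have g1: "(\<lambda>k. if k = nat (- n) then if n \<le> 0 then fps_nth p k else 0 else 0)
      sums (if n \<le> 0 then fps_nth p (nat (- n)) else 0)"
    by (rule sums_single)
  have e1: "(\<lambda>k. fps_nth p k * (if n + int k = 0 then 1 else 0))
      = (\<lambda>k. if k = nat (- n) then if n \<le> 0 then fps_nth p k else 0 else 0)"
    by (auto simp: fun_eq_iff)
  show "circle_mean (\<lambda>t. cis (of_int n * t) * (\<Sum>k. fps_nth p k * cis t ^ k))
      = (if n \<le> 0 then fps_nth p (nat (- n)) else 0)"
    by (rule sums_unique2[OF s1[unfolded e1] g1])
  have "(\<lambda>k. fps_nth p k * circle_mean (\<lambda>t. cis (of_int n * t) * cis (- t) ^ k))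
      sums circle_mean (\<lambda>t. cis (of_int n * t) * (\<Sum>k. fps_nth p k * cis (- t) ^ k))"
    by (rule circle_mean_series[OF _ _ _ p r]) (auto intro!: continuous_intros)
  then have s2: "(\<lambda>k. fps_nth p k * (if n - int k = 0 then 1 else 0))
      sums circle_mean (\<lambda>t. cis (of_int n * t) * (\<Sum>k. fps_nth p k * cis (- t) ^ k))"
    unfolding 2 circle_mean_cis .
  have g2: "(\<lambda>k. if k = nat n then if 0 \<le> n then fps_nth p k else 0 else 0)
      sums (if 0 \<le> n then fps_nth p (nat n) else 0)"
    by (rule sums_single)
  have e2: "(\<lambda>k. fps_nth p k * (if n - int k = 0 then 1 else 0))
      = (\<lambda>k. if k = nat n then if 0 \<le> n then fps_nth p k else 0 else 0)"
    by (auto simp: fun_eq_iff)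
  show "circle_mean (\<lambda>t. cis (of_int n * t) * (\<Sum>k. fps_nth p k * cis (- t) ^ k))
      = (if 0 \<le> n then fps_nth p (nat n) else 0)"
    by (rule sums_unique2[OF s2[unfolded e2] g2])
qed

text \<open>Only the series of \<open>p\<close> is expanded. Against its \<open>k\<close>-th term
  the integral picks out a single coefficient of \<open>q\<close>, and the sum over \<open>k\<close>
  is the matrix product with summation index \<open>k + i\<close>, because row \<open>i\<close> of
  the upper triangular factor starts in column \<open>i\<close>.\<close>

lemma circle_mean_laurent:
  assumes p: "geo_bounded r M p" and q: "geo_bounded r N q" and r: "0 \<le> r" "r < 1"
  shows "circle_mean (\<lambda>t. cis (of_int (int i - int j) * t) *
      ((\<Sum>k. fps_nth p k * cis t ^ k) * (\<Sum>k. fps_nth q k * cis (- t) ^ k)))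
    = (upper_toeplitz p \<star> lower_toeplitz q) i j"
proof -
  note M = geo_bounded_nonneg[OF p] and N = geo_bounded_nonneg[OF q]
  let ?Q = "\<lambda>t. \<Sum>k. fps_nth q k * cis (- t) ^ k"
  have "uniform_limit {0..2 * pi} (\<lambda>n t. \<Sum>k<n. fps_nth q k * cis (- t) ^ k) ?Q sequentially"
  proof (rule Weierstrass_m_test)
    show "cmod (fps_nth q k * cis (- t) ^ k) \<le> N * r ^ k" for k t
      using geo_boundedD[OF q] by (simp add: norm_mult norm_power)
    show "summable (\<lambda>k. N * r ^ k)"
      using r by (intro summable_mult summable_geometric) auto
  qed
  then have Q: "continuous_on {0..2 * pi} ?Q"
    by (rule uniform_limit_theorem[rotated]) (auto intro!: always_eventually continuous_intros)
  have "(\<lambda>k. fps_nth p k * circle_mean (\<lambda>t. (cis (of_int (int i - int j) * t) * ?Q t) * cis t ^ k))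
      sums circle_mean (\<lambda>t. (cis (of_int (int i - int j) * t) * ?Q t) * (\<Sum>k. fps_nth p k * cis t ^ k))"
    by (rule circle_mean_series[OF _ _ _ p r]) (auto intro!: continuous_intros Q)
  moreover have "(\<lambda>t. (cis (of_int (int i - int j) * t) * ?Q t) * cis t ^ k)
      = (\<lambda>t. cis (of_int (int i - int j + int k) * t) * ?Q t)" for k
  proof
    show "(cis (of_int (int i - int j) * t) * ?Q t) * cis t ^ k = cis (of_int (int i - int j + int k) * t) * ?Q t" for t
    proof -
      have "cis (of_int (int i - int j) * t) * cis t ^ k = cis (of_int (int i - int j + int k) * t)"
        unfolding Complex.DeMoivre cis_mult by (simp add: algebra_simps)
      moreover have "(cis (of_int (int i - int j) * t) * ?Q t) * cis t ^ k
          = (cis (of_int (int i - int j) * t) * cis t ^ k) * ?Q t"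
        by (simp only: mult_ac)
      ultimately show ?thesis by (simp only:)
    qed
  qed
  moreover have "circle_mean (\<lambda>t. cis (of_int (int i - int j + int k) * t) * ?Q t)
      = lower_toeplitz q (k + i) j" for k
    using circle_mean_power_series(2)[OF q r, of "int i - int j + int k"]
    by (auto simp: lower_toeplitz_def nat_diff_distrib' intro!: arg_cong[where f = "fps_nth q"])
  ultimately have "(\<lambda>k. upper_toeplitz p i (k + i) * lower_toeplitz q (k + i) j)
      sums circle_mean (\<lambda>t. (cis (of_int (int i - int j) * t) * ?Q t) * (\<Sum>k. fps_nth p k * cis t ^ k))"
    by (simp add: upper_toeplitz_def)
  then have "(\<lambda>k. upper_toeplitz p i k * lower_toeplitz q k j)
      sums circle_mean (\<lambda>t. (cis (of_int (int i - int j) * t) * ?Q t) * (\<Sum>k. fps_nth p k * cis t ^ k))"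
    by (subst (asm) sums_zero_iff_shift) (auto simp: upper_toeplitz_def)
  moreover have "(\<lambda>k. upper_toeplitz p i k * lower_toeplitz q k j) summable_on UNIV"
    by (rule summable_on_imat_mult[OF rows_bounded_upper_toeplitz[OF r p] rows_bounded_lower_toeplitz[OF r q]])
  ultimately show ?thesis
    unfolding imat_mult_def
    using sums_unique2[OF _ has_sum_imp_sums[OF has_sum_infsum]] by (simp add: mult_ac)
qed

section \<open>From Lebesgue integrals to circle means\<close>

lemma fourier_coeff_eq_circle_mean:
  assumes "continuous_on (sphere 0 1) L"
  shows "fourier_coeff L k = circle_mean (\<lambda>t. cis (of_int (- k) * t) * of_real (L (cis t)))"
proof -
  have "continuous_on {0..2 * pi} (\<lambda>t. L (cis t))"
    by (rule continuous_on_compose2[OF assms]) (auto intro!: continuous_intros)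
  then have "set_integrable lborel {0..2 * pi} (\<lambda>t. exp (- \<i> * of_int k * of_real t) * of_real (L (cis t)))"
    by (intro borel_integrable_atLeastAtMost') (auto intro!: continuous_intros)
  then have "(CLBINT t:{0..2 * pi}. exp (- \<i> * of_int k * of_real t) * of_real (L (cis t)))
      = integral {0..2 * pi} (\<lambda>t. exp (- \<i> * of_int k * of_real t) * of_real (L (cis t)))"
    by (rule set_borel_integral_eq_integral(2))
  then show ?thesis
    by (simp add: fourier_coeff_def circle_mean_def cis_conv_exp mult_ac)
qed

lemma integral_circle_measure:
  fixes f :: "complex \<Rightarrow> complex"
  assumes f: "continuous_on (sphere 0 1) f"
  shows "integral\<^sup>L circle_measure f = circle_mean (\<lambda>t. f (cis t))"
proof -
  have fm: "f \<in> borel_measurable (restrict_space borel (sphere 0 1))"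
    by (rule borel_measurable_continuous_on_restrict[OF f])
  have cm: "cis \<in> measurable lborel (restrict_space borel (sphere 0 1))"
    by (rule measurable_restrict_space2)
      (auto intro!: borel_measurable_continuous_onI continuous_intros)
  have fc: "(\<lambda>t. f (cis t)) \<in> borel_measurable lborel"
    using measurable_compose[OF cm fm] .
  have cont: "continuous_on {0..2 * pi} (\<lambda>t. f (cis t))"
    by (rule continuous_on_compose2[OF f]) (auto intro!: continuous_intros)
  have um: "uniform_measure lborel {0..<2 * pi}
      = density lborel (\<lambda>t. ennreal (indicator {0..<2 * pi} t / (2 * pi)))"
    unfolding uniform_measure_def
    by (rule density_cong) (auto simp: divide_ennreal[symmetric] ennreal_indicator)
  have "integral\<^sup>L circle_measure f = (\<integral>t. f (cis t) \<partial>uniform_measure lborel {0..<2 * pi})"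
    unfolding circle_measure_def by (rule integral_distr[OF _ fm]) (use cm in simp)
  also have "\<dots> = (\<integral>t. (indicator {0..<2 * pi} t / (2 * pi)) *\<^sub>R f (cis t) \<partial>lborel)"
    unfolding um by (rule integral_density[OF fc]) auto
  also have "\<dots> = (\<integral>t. (indicator {0..2 * pi} t *\<^sub>R f (cis t)) / of_real (2 * pi) \<partial>lborel)"
  proof (rule integral_cong_AE)
    show "AE t in lborel. (indicator {0..<2 * pi} t / (2 * pi)) *\<^sub>R f (cis t)
        = (indicator {0..2 * pi} t *\<^sub>R f (cis t)) / of_real (2 * pi)"
      \<comment> \<open>The two intervals differ only in the endpoint \<open>2 * pi\<close>.\<close>
      using AE_lborel_singleton[of "2 * pi"]
      by eventually_elim (auto simp: indicator_def scaleR_conv_of_real)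
  qed (use fc in \<open>auto intro!: borel_measurable_scaleR borel_measurable_divide\<close>)
  also have "\<dots> = (LINT t:{0..2 * pi}|lborel. f (cis t)) / of_real (2 * pi)"
    unfolding set_lebesgue_integral_def by (rule integral_divide_zero)
  also have "(LINT t:{0..2 * pi}|lborel. f (cis t)) = integral {0..2 * pi} (\<lambda>t. f (cis t))"
    by (rule set_borel_integral_eq_integral(2)[OF borel_integrable_atLeastAtMost'[OF cont]])
  finally show ?thesis
    by (simp add: circle_mean_def)
qed

lemma moment_density:
  assumes L: "continuous_on (sphere 0 1) L"
  shows "moment (density circle_measure (\<lambda>z. ennreal (exp (L z)))) m
    = circle_mean (\<lambda>t. cis (of_int (- m) * t) * of_real (exp (L (cis t))))"
proof -
  have sets: "sets circle_measure = sets (restrict_space borel (sphere 0 1))"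
    by (simp add: circle_measure_def)
  have pw: "continuous_on (sphere 0 1) (\<lambda>z :: complex. z powi (- m))"
    by (auto intro!: continuous_intros)
  have "moment (density circle_measure (\<lambda>z. ennreal (exp (L z)))) m
      = (\<integral>z. exp (L z) *\<^sub>R (z powi (- m)) \<partial>circle_measure)"
    unfolding moment_def
  proof (rule integral_density)
    show "(\<lambda>z. z powi (- m)) \<in> borel_measurable circle_measure"
      unfolding measurable_cong_sets[OF sets refl] by (rule borel_measurable_continuous_on_restrict[OF pw])
    show "(\<lambda>z. exp (L z)) \<in> borel_measurable circle_measure"
      unfolding measurable_cong_sets[OF sets refl]
      by (rule borel_measurable_continuous_on_restrict) (intro continuous_intros L)
  qed simp
  also have "\<dots> = circle_mean (\<lambda>t. exp (L (cis t)) *\<^sub>R (cis t powi (- m)))"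
    by (rule integral_circle_measure) (intro continuous_intros L pw)
  finally show ?thesis
    by (simp add: cis_power_int scaleR_conv_of_real mult.commute)
qed

lemma circle_mean_cnj: "cnj (circle_mean f) = circle_mean (\<lambda>t. cnj (f t))"
  by (simp add: circle_mean_def integral_cnj)

text \<open>Conjugation acts on a Hermitian matrix as transposition. Realness of the Toeplitz
  determinants is what later reduces \<open>Ln\<close> to the real logarithm.\<close>

lemma det_hermitian_real:
  assumes A: "A \<in> carrier_mat n n" and h: "\<And>i j. i < n \<Longrightarrow> j < n \<Longrightarrow> cnj (A $$ (i, j)) = A $$ (j, i)"
  shows "Determinant.det A \<in> \<real>"
proof -
  have "cnj (Determinant.det A) = (\<Sum>p\<in>{p. p permutes {0..<n}}. signof p * (\<Prod>i = 0..<n. cnj (A $$ (i, p i))))"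
  proof -
    have "cnj (signof p * z) = signof p * cnj z" for p :: "nat \<Rightarrow> nat" and z
      by (simp add: sign_def)
    then show ?thesis
      unfolding det_def'[OF A] cnj_sum by (simp only: cnj_prod)
  qed
  also have "\<dots> = (\<Sum>p\<in>{p. p permutes {0..<n}}. signof p * (\<Prod>i = 0..<n. transpose_mat A $$ (i, p i)))"
  proof (intro sum.cong refl arg_cong2[where f = "(*)"] prod.cong)
    fix p i assume "p \<in> {p. p permutes {0..<n}}" "i \<in> {0..<n}"
    then have "p i < n" "i < n" using permutes_in_image[of p "{0..<n}" i] by auto
    then show "cnj (A $$ (i, p i)) = transpose_mat A $$ (i, p i)" using A h by simp
  qed
  also have "\<dots> = Determinant.det (transpose_mat A)"
    by (rule det_def'[symmetric]) (use A in simp)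
  also have "\<dots> = Determinant.det A"
    by (rule det_transpose[OF A])
  finally show ?thesis by (simp add: complex_is_Real_iff complex_eq_iff)
qed

lemma toeplitz_det_real:
  assumes "continuous_on (sphere 0 1) L"
  shows "toeplitz_det (density circle_measure (\<lambda>z. ennreal (exp (L z)))) n \<in> \<real>"
  unfolding toeplitz_det_def
proof (rule det_hermitian_real)
  show "toeplitz_matrix (density circle_measure (\<lambda>z. ennreal (exp (L z)))) n \<in> carrier_mat (n + 1) (n + 1)"
    by (simp add: toeplitz_matrix_def)
  have eq: "cnj (cis (of_int m * t) * of_real x) = cis (of_int (- m) * t) * of_real x" for m t x
    by (simp add: cis_cnj)
  show "cnj (toeplitz_matrix (density circle_measure (\<lambda>z. ennreal (exp (L z)))) n $$ (i, j))
      = toeplitz_matrix (density circle_measure (\<lambda>z. ennreal (exp (L z)))) n $$ (j, i)"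
    if "i < n + 1" "j < n + 1" for i j
    using that unfolding toeplitz_matrix_def
    by (simp only: index_mat case_prod_conv moment_density[OF assms] circle_mean_cnj eq minus_diff_eq)
qed

section \<open>Assembly: from the symbol to the logarithm of the determinant\<close>

theorem theorem11p1:
  fixes L :: "complex \<Rightarrow> real" and \<mu> :: "complex measure"
  assumes "analytic_near_circle L"
    and "\<mu> = density circle_measure (\<lambda>z. ennreal (exp (L z)))"
  shows "summable (\<lambda>k. real (Suc k) * (cmod (fourier_coeff L (int (Suc k))))\<^sup>2) \<and>
    (\<lambda>n. Ln (toeplitz_det \<mu> n) - of_nat (n + 1) * fourier_coeff L 0)
      \<longlonglongrightarrow> complex_of_real (\<Sum>k. real (Suc k) * (cmod (fourier_coeff L (int (Suc k))))\<^sup>2)"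
proof -
  obtain U F where UF: "open U" "sphere 0 1 \<subseteq> U" "F holomorphic_on U"
    "\<And>z. z \<in> sphere 0 1 \<Longrightarrow> F z = complex_of_real (L z)"
    using assms(1) unfolding analytic_near_circle_def by blast
  have contL: "continuous_on (sphere 0 1) L"
  proof -
    have "continuous_on (sphere 0 1) (\<lambda>z. Re (F z))"
      by (intro continuous_intros continuous_on_subset[OF holomorphic_on_imp_continuous_on[OF UF(3)] UF(2)])
    then show ?thesis
      by (rule continuous_on_eq) (use UF(4) in simp)
  qed
  obtain R P b where R: "1 < R" and P: "P holomorphic_on ball 0 R" and b: "b holomorphic_on ball 0 R" "b 0 = 0"
    and split: "\<And>z. cmod z = 1 \<Longrightarrow> F z = P z + b (inverse z)"
    using laurent_decomposition[OF UF(1-3)] by metis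
  \<comment> \<open>The constant term of \<open>P\<close> is split off as the mean of
    \<open>L\<close>, so that \<open>a\<close> vanishes at 0 as an exponential family
    demands.\<close>
  define a where "a = (\<lambda>z. P z - P 0)"
  have a: "a holomorphic_on ball 0 R" "a 0 = 0"
    unfolding a_def by (auto intro!: holomorphic_intros P)
  have Lcis: "complex_of_real (L (cis t)) = P 0 + a (cis t) + b (cis (- t))" for t
    using split[of "cis t"] UF(4)[of "cis t"] by (simp add: a_def)
  \<comment> \<open>The functions are controlled on an open ball only; an intermediate radius, still
    above 1, gives a compact circle on which they are bounded.\<close>
  define R' where "R' = (1 + R) / 2"
  have R': "1 < R'" "R' < R" "0 < R'" using R by (auto simp: R'_def)
  define r where "r = 1 / R'"
  have r: "0 \<le> r" "r < 1" using R' by (auto simp: r_def)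
  have bdd: "\<exists>K. \<forall>z. cmod z = R' \<longrightarrow> cmod (f z) \<le> K" if "f holomorphic_on ball 0 R" for f
  proof -
    have "bounded (f ` sphere 0 R')"
      by (intro compact_imp_bounded compact_continuous_image compact_sphere
          continuous_on_subset[OF holomorphic_on_imp_continuous_on[OF that]]) (use R' in auto)
    then obtain K where "\<forall>x\<in>f ` sphere 0 R'. norm x \<le> K" unfolding bounded_iff by blast
    then show ?thesis by (intro exI[of _ K]) simp
  qed
  obtain B1 B2 where B12: "\<And>z. cmod z = R' \<Longrightarrow> cmod (a z) \<le> B1" "\<And>z. cmod z = R' \<Longrightarrow> cmod (b z) \<le> B2"
    using bdd[OF a(1)] bdd[OF b(1)] by blast
  define B where "B = max B1 B2"
  have B: "\<And>z. cmod z = R' \<Longrightarrow> cmod (a z) \<le> B" "\<And>z. cmod z = R' \<Longrightarrow> cmod (b z) \<le> B"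
    using B12 by (auto simp: B_def le_max_iff_disj)
  define M where "M = exp B * (1 + B)\<^sup>2"
  define c where "c = (\<lambda>k. fps_nth (fps_expansion a 0) (Suc k))"
  define d where "d = (\<lambda>k. fps_nth (fps_expansion b 0) (Suc k))"
  define A where "A = (\<lambda>s :: real. fps_expansion (\<lambda>z. exp (of_real s * a z)) 0)"
  define D where "D = (\<lambda>s :: real. fps_expansion (\<lambda>z. exp (of_real s * b z)) 0)"
  have famA: "exp_family r M c A" and famD: "exp_family r M d D"
    unfolding r_def M_def c_def d_def A_def D_def
    by (intro exp_family_expansion[OF a R'(1,2) B(1)] exp_family_expansion[OF b R'(1,2) B(2)]; assumption)+
  have ser: "(\<Sum>k. fps_nth (fps_expansion f 0) k * z ^ k) = f z"
    if "f holomorphic_on ball 0 R" "cmod z = 1" for f z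
    using sums_unique[OF fps_expansion_sums[OF that(1)], of z] that(2) R by simp
  have gP: "\<exists>K. geo_bounded r K (fps_expansion f 0)" if f: "f holomorphic_on ball 0 R" for f
    using bdd[OF f] fps_expansion_nth_le[OF f R'(3,2)] unfolding geo_bounded_def r_def by blast
  \<comment> \<open>At \<open>k = 0\<close> all three terms are present, but the last two vanish
    there because \<open>a 0 = b 0 = 0\<close>.\<close>
  have fc: "fourier_coeff L k = (if k = 0 then P 0 else 0)
      + (if 0 \<le> k then fps_nth (fps_expansion a 0) (nat k) else 0)
      + (if k \<le> 0 then fps_nth (fps_expansion b 0) (nat (- k)) else 0)" for k
  proof -
    obtain Ka Kb where K: "geo_bounded r Ka (fps_expansion a 0)" "geo_bounded r Kb (fps_expansion b 0)"
      using gP[OF a(1)] gP[OF b(1)] by blast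
    let ?e = "\<lambda>t. cis (of_int (- k) * t)"
    have ca: "continuous_on {0..2 * pi} (\<lambda>t. a (cis t))" "continuous_on {0..2 * pi} (\<lambda>t. b (cis (- t)))"
      by (rule continuous_on_compose2[OF holomorphic_on_imp_continuous_on[OF a(1)]]
          continuous_on_compose2[OF holomorphic_on_imp_continuous_on[OF b(1)]];
          use R in \<open>auto intro!: continuous_intros\<close>)+
    have i: "f integrable_on {0..2 * pi}" if "continuous_on {0..2 * pi} f" for f :: "real \<Rightarrow> complex"
      using integrable_continuous_interval[OF that] .
    have "fourier_coeff L k = circle_mean (\<lambda>t. (P 0 * ?e t + ?e t * a (cis t)) + ?e t * b (cis (- t)))"
      unfolding fourier_coeff_eq_circle_mean[OF contL] Lcis by (simp add: algebra_simps)
    also have "\<dots> = P 0 * circle_mean ?e + circle_mean (\<lambda>t. ?e t * a (cis t)) + circle_mean (\<lambda>t. ?e t * b (cis (- t)))"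
      unfolding circle_mean_def
      by (subst integral_add, (auto intro!: i continuous_intros ca)[2],
          subst integral_add, (auto intro!: i continuous_intros ca)[2]) (simp add: add_divide_distrib)
    also have "circle_mean (\<lambda>t. ?e t * a (cis t)) = (if 0 \<le> k then fps_nth (fps_expansion a 0) (nat k) else 0)"
      using circle_mean_power_series(1)[OF K(1) r, of "- k"] by (simp add: ser[OF a(1)])
    also have "circle_mean (\<lambda>t. ?e t * b (cis (- t))) = (if k \<le> 0 then fps_nth (fps_expansion b 0) (nat (- k)) else 0)"
      using circle_mean_power_series(2)[OF K(2) r, of "- k"] by (simp add: ser[OF b(1)])
    also have "circle_mean ?e = (if k = 0 then 1 else 0)"
      by (subst circle_mean_cis) simp
    finally show ?thesis by simp
  qed
  have L0: "fourier_coeff L 0 = P 0"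
    using fc[of 0] a(2) b(2) by (simp add: fps_expansion_def)
  \<comment> \<open>Realness of \<open>L\<close> makes coefficients of opposite frequency conjugate,
    which turns \<open>c k * d k\<close> into a squared modulus.\<close>
  have cnjL: "cnj (fourier_coeff L k) = fourier_coeff L (- k)" for k
    unfolding fourier_coeff_eq_circle_mean[OF contL] circle_mean_cnj by (simp add: cis_cnj)
  have L0r: "fourier_coeff L 0 \<in> \<real>"
    using cnjL[of 0] by (simp add: complex_is_Real_iff complex_eq_iff)
  then obtain l where l: "fourier_coeff L 0 = of_real l" by (auto elim: Reals_cases)
  have cd: "of_nat (Suc k) * (c k * d k) = of_real (real (Suc k) * (cmod (fourier_coeff L (int (Suc k))))\<^sup>2)" for k
  proof -
    have "c k = fourier_coeff L (int (Suc k))" using fc[of "int (Suc k)"] by (simp add: c_def nat_add_distrib)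
    moreover have "d k = fourier_coeff L (- int (Suc k))" using fc[of "- int (Suc k)"] by (simp add: d_def nat_add_distrib)
    ultimately have "c k * d k = of_real ((cmod (fourier_coeff L (int (Suc k))))\<^sup>2)"
      using complex_norm_square[of "fourier_coeff L (int (Suc k))"]
      by (simp add: cnjL[symmetric] del: of_nat_Suc)
    then show ?thesis by (simp del: of_nat_Suc)
  qed
  let ?E = "\<lambda>k. real (Suc k) * (cmod (fourier_coeff L (int (Suc k))))\<^sup>2"
  have sumE: "summable ?E"
    using summable_Suc_mult[OF r famA famD] unfolding cd summable_complex_of_real .
  have lim: "(\<lambda>n. tdet n (A 1) (D 1)) \<longlonglongrightarrow> of_real (exp (suminf ?E))"
    using tdet_tendsto[OF r famA famD] unfolding cd suminf_of_real[OF sumE, symmetric] exp_of_real .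
  have D: "toeplitz_det \<mu> n = of_real (exp l) ^ (n + 1) * tdet (n + 1) (A 1) (D 1)" for n
  proof -
    have "toeplitz_matrix \<mu> n = of_real (exp l) \<cdot>\<^sub>m corner (n + 1) (upper_toeplitz (A 1) \<star> lower_toeplitz (D 1))"
    proof (rule eq_matI)
      fix i j
      assume "i < dim_row (of_real (exp l) \<cdot>\<^sub>m corner (n + 1) (upper_toeplitz (A 1) \<star> lower_toeplitz (D 1)))"
        "j < dim_col (of_real (exp l) \<cdot>\<^sub>m corner (n + 1) (upper_toeplitz (A 1) \<star> lower_toeplitz (D 1)))"
      then have ij: "i < n + 1" "j < n + 1" by auto
      \<comment> \<open>The factor \<open>of_real 1\<close> keeps the functions in the shape that
        unfolding \<open>A 1\<close> and \<open>D 1\<close> produces.\<close>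
      have hol: "(\<lambda>z. exp (of_real 1 * a z)) holomorphic_on ball 0 R" "(\<lambda>z. exp (of_real 1 * b z)) holomorphic_on ball 0 R"
        using a b by (auto intro!: holomorphic_intros)
      have e: "complex_of_real (exp (L (cis t))) = of_real (exp l) *
          ((\<Sum>k. fps_nth (A 1) k * cis t ^ k) * (\<Sum>k. fps_nth (D 1) k * cis (- t) ^ k))" for t
      proof -
        have "complex_of_real (exp (L (cis t))) = exp (of_real (L (cis t)))"
          by (rule exp_of_real[symmetric])
        also have "\<dots> = exp (of_real l) * (exp (of_real 1 * a (cis t)) * exp (of_real 1 * b (cis (- t))))"
          using Lcis[of t] l L0 by (simp add: exp_add mult.assoc)
        finally show ?thesis
          unfolding A_def D_def ser[OF hol(1) norm_cis] ser[OF hol(2) norm_cis] exp_of_real .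
      qed
      have "toeplitz_matrix \<mu> n $$ (i, j) = moment \<mu> (int j - int i)"
        using ij by (simp add: toeplitz_matrix_def)
      also have "\<dots> = circle_mean (\<lambda>t. of_real (exp l) * (cis (of_int (int i - int j) * t) *
          ((\<Sum>k. fps_nth (A 1) k * cis t ^ k) * (\<Sum>k. fps_nth (D 1) k * cis (- t) ^ k))))"
        unfolding assms(2) moment_density[OF contL] e minus_diff_eq by (simp only: mult.left_commute)
      also have "\<dots> = of_real (exp l) * (upper_toeplitz (A 1) \<star> lower_toeplitz (D 1)) i j"
        unfolding circle_mean_laurent[OF exp_familyD(4)[OF famA] exp_familyD(4)[OF famD] r, of 1 1 i j, simplified, symmetric]
        by (simp add: circle_mean_def)
      finally show "toeplitz_matrix \<mu> n $$ (i, j)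
          = (of_real (exp l) \<cdot>\<^sub>m corner (n + 1) (upper_toeplitz (A 1) \<star> lower_toeplitz (D 1))) $$ (i, j)"
        using ij by simp
    qed (auto simp: toeplitz_matrix_def)
    then show ?thesis
      unfolding toeplitz_det_def tdet_def by simp
  qed
  define x where "x = (\<lambda>n. Re (tdet (n + 1) (A 1) (D 1)))"
  have tx: "tdet (n + 1) (A 1) (D 1) = of_real (x n)" for n
  proof -
    have "toeplitz_det \<mu> n \<in> \<real>" unfolding assms(2) by (rule toeplitz_det_real[OF contL])
    moreover have "tdet (n + 1) (A 1) (D 1) = toeplitz_det \<mu> n / of_real (exp l) ^ (n + 1)"
      unfolding D by simp
    ultimately have "tdet (n + 1) (A 1) (D 1) \<in> \<real>"
      by (simp only: Reals_divide Reals_power Reals_of_real)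
    then show ?thesis by (simp add: x_def)
  qed
  have xlim: "x \<longlonglongrightarrow> exp (suminf ?E)"
  proof -
    have "(\<lambda>n. tdet (n + 1) (A 1) (D 1)) \<longlonglongrightarrow> of_real (exp (suminf ?E))"
      using LIMSEQ_ignore_initial_segment[OF lim, of 1] .
    then show ?thesis unfolding tx tendsto_of_real_iff .
  qed
  \<comment> \<open>Positivity for large \<open>n\<close> comes from the positive limit. From there
    on \<open>Ln\<close> is the real logarithm, so its product rule holds without a choice of
    branch.\<close>
  have "\<forall>\<^sub>F n in sequentially. 0 < x n"
    using order_tendstoD(1)[OF xlim, of 0] by simp
  then have "\<forall>\<^sub>F n in sequentially. of_real (ln (x n)) = Ln (toeplitz_det \<mu> n) - of_nat (n + 1) * fourier_coeff L 0"
  proof eventually_elim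
    case (elim n)
    have "toeplitz_det \<mu> n = of_real (exp l ^ (n + 1) * x n)"
      unfolding D tx by simp
    also have "Ln \<dots> = of_real (ln (exp l ^ (n + 1) * x n))"
      using elim by (intro Ln_of_real) simp
    also have "ln (exp l ^ (n + 1) * x n) = real (n + 1) * l + ln (x n)"
      using elim by (simp add: ln_mult ln_realpow del: power_Suc)
    finally show ?case by (simp add: l)
  qed
  moreover have "(\<lambda>n. complex_of_real (ln (x n))) \<longlonglongrightarrow> of_real (suminf ?E)"
    using tendsto_of_real[OF tendsto_ln[OF xlim]] by simp
  ultimately have "(\<lambda>n. Ln (toeplitz_det \<mu> n) - of_nat (n + 1) * fourier_coeff L 0) \<longlonglongrightarrow> of_real (suminf ?E)"
    by (rule Lim_transform_eventually[rotated])
  then show ?thesis using sumE by blast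
qed

end
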